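(* Let $S$ be a polynomial ring over a field $k$ and let $I \subset S$ be a squarefree monomial ideal of height $c$ that is nearly a complete intersection (NCI). Then $\sum_i \beta_i(S/I) \geq 2^c + 2^{c-1}$. Equality holds in only two cases: when $c = 2$ and the Betti numbers $(\beta_0,\beta_1,\beta_2)$ of $S/I$ are $(1,3,2)$, and when $c = 3$ and the Betti numbers $(\beta_0,\ldots,\beta_3)$ of $S/I$ are $(1,5,5,1)$.
   Context: $\beta_i(S/I)$ is the rank of the $i$-th free module in a minimal free resolution of $S/I$ over $S$. An ideal is a complete intersection (CI) if it is generated by a regular sequence. The support of a monomial ideal is the set of variables appearing in at least one minimal monomial generator. For a squarefree monomial ideal $I$ and a variable $x$, $I(x=1)$ denotes the ideal generated by the monomials obtained from the minimal monomial generators of $I$ by setting $x = 1$. A squarefree monomial ideal $I$ is nearly a complete intersection (NCI) if it is generated in degree at least two, is not a CI, and for each variable $x$ in the support of $I$, $I(x=1)$ is a CI. *)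

theory Defs
  imports Main "HOL-Library.Poly_Mapping" "HOL-Library.Extended_Nat"
begin

text \<open>The polynomial ring S = k[x_v : v in 'v] over a field k with finitely many
variables (indexed by the finite type 'v) is represented by
  the type mpoly below
(monomial exponent vectors to coefficients, convolution product).\<close>

type_synonym ('v, 'k) mpoly = "('v \<Rightarrow>\<^sub>0 nat) \<Rightarrow>\<^sub>0 'k"

definition is_ideal :: "'a::comm_ring_1 set \<Rightarrow> bool" where
  "is_ideal J \<longleftrightarrow> 0 \<in> J \<and> (\<forall>a\<in>J. \<forall>b\<in>J. a + b \<in> J) \<and> (\<forall>r. \<forall>a\<in>J. r * a \<in> J)"

definition ideal_gen :: "'a::comm_ring_1 set \<Rightarrow> 'a set" where
  "ideal_gen A = \<Inter>{J. is_ideal J \<and> A \<subseteq> J}"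

definition prime_ideal :: "'a::comm_ring_1 set \<Rightarrow> bool" where
  "prime_ideal P \<longleftrightarrow> is_ideal P \<and> 1 \<notin> P \<and> (\<forall>a b. a * b \<in> P \<longrightarrow> a \<in> P \<or> b \<in> P)"

definition prime_height :: "'a::comm_ring_1 set \<Rightarrow> enat" where
  "prime_height P = (SUP ps \<in> {ps. ps \<noteq> [] \<and> sorted_wrt (\<subset>) ps \<and> last ps = P
                                  \<and> (\<forall>Q\<in>set ps. prime_ideal Q)}. enat (length ps - 1))"

definition ideal_height :: "'a::comm_ring_1 set \<Rightarrow> enat" where
  "ideal_height I = (INF P \<in> {P. prime_ideal P \<and> I \<subseteq> P}. prime_height P)"

definition regular_sequence :: "'a::comm_ring_1 list \<Rightarrow> bool" where
  "regular_sequence fs \<longleftrightarrow>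
     (\<forall>i < length fs. \<forall>g. fs ! i * g \<in> ideal_gen (set (take i fs)) \<longrightarrow> g \<in> ideal_gen (set (take i fs)))
     \<and> 1 \<notin> ideal_gen (set fs)"

definition complete_intersection :: "'a::comm_ring_1 set \<Rightarrow> bool" where
  "complete_intersection I \<longleftrightarrow> (\<exists>fs. regular_sequence fs \<and> I = ideal_gen (set fs))"

definition monom :: "('v \<Rightarrow>\<^sub>0 nat) \<Rightarrow> ('v, 'k::comm_ring_1) mpoly" where
  "monom \<alpha> = Poly_Mapping.single \<alpha> 1"

definition squarefree_exp :: "('v \<Rightarrow>\<^sub>0 nat) \<Rightarrow> bool" where
  "squarefree_exp \<alpha> \<longleftrightarrow> (\<forall>v. Poly_Mapping.lookup \<alpha> v \<le> 1)"

definition exp_dvd :: "('v \<Rightarrow>\<^sub>0 nat) \<Rightarrow> ('v \<Rightarrow>\<^sub>0 nat) \<Rightarrow> bool" where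
  "exp_dvd \<beta> \<alpha> \<longleftrightarrow> (\<forall>v. Poly_Mapping.lookup \<beta> v \<le> Poly_Mapping.lookup \<alpha> v)"

definition exp_deg :: "('v \<Rightarrow>\<^sub>0 nat) \<Rightarrow> nat" where
  "exp_deg \<alpha> = (\<Sum>v\<in>Poly_Mapping.keys \<alpha>. Poly_Mapping.lookup \<alpha> v)"

definition squarefree_monomial_ideal :: "('v, 'k::comm_ring_1) mpoly set \<Rightarrow> bool" where
  "squarefree_monomial_ideal I \<longleftrightarrow>
     (\<exists>A. (\<forall>\<alpha>\<in>A. squarefree_exp \<alpha>) \<and> I = ideal_gen (monom ` A))"

definition min_gens :: "('v, 'k::comm_ring_1) mpoly set \<Rightarrow> ('v \<Rightarrow>\<^sub>0 nat) set" where
  "min_gens I = {\<alpha>. monom \<alpha> \<in> I \<and> (\<forall>\<beta>. exp_dvd \<beta> \<alpha> \<and> \<beta> \<noteq> \<alpha> \<longrightarrow> monom \<beta> \<notin> I)}"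

definition mon_support :: "('v, 'k::comm_ring_1) mpoly set \<Rightarrow> 'v set" where
  "mon_support I = {v. \<exists>\<alpha>\<in>min_gens I. Poly_Mapping.lookup \<alpha> v > 0}"

definition set_var_one :: "'v \<Rightarrow> ('v, 'k::comm_ring_1) mpoly set \<Rightarrow> ('v, 'k) mpoly set" where
  "set_var_one x I = ideal_gen ((\<lambda>\<alpha>. monom (Poly_Mapping.update x 0 \<alpha>)) ` min_gens I)"

definition NCI :: "('v, 'k::comm_ring_1) mpoly set \<Rightarrow> bool" where
  "NCI I \<longleftrightarrow> squarefree_monomial_ideal I
     \<and> (\<forall>\<alpha>\<in>min_gens I. exp_deg \<alpha> \<ge> 2)
     \<and> \<not> complete_intersection I
     \<and> (\<forall>x\<in>mon_support I. complete_intersection (set_var_one x I))"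

definition free_mod :: "nat \<Rightarrow> (nat \<Rightarrow> 'a::comm_ring_1) set" where
  "free_mod n = {v. \<forall>j\<ge>n. v j = 0}"

definition lin_map :: "(nat \<Rightarrow> nat \<Rightarrow> 'a::comm_ring_1) \<Rightarrow> nat \<Rightarrow> nat \<Rightarrow> (nat \<Rightarrow> 'a) \<Rightarrow> (nat \<Rightarrow> 'a)" where
  "lin_map M m n v = (\<lambda>j. if j < m then (\<Sum>l<n. M j l * v l) else 0)"

text \<open>A minimal free resolution of S/I:
  ... -> S^(b 2) --d 2--> S^(b 1) --d 1--> S^(b 0) = S -> S/I -> 0,
exact, of finite length, with all matrix entries in the homogeneous maximal
ideal (zero constant term). Then b i = beta_i(S/I).\<close>

definition min_free_res :: "('v, 'k::field) mpoly set \<Rightarrow> (nat \<Rightarrow> nat)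
                              \<Rightarrow> (nat \<Rightarrow> nat \<Rightarrow> nat \<Rightarrow> ('v, 'k) mpoly) \<Rightarrow> bool" where
  "min_free_res I b d \<longleftrightarrow>
     b 0 = 1
     \<and> lin_map (d 1) (b 0) (b 1) ` free_mod (b 1) = {v. v 0 \<in> I \<and> (\<forall>j>0. v j = 0)}
     \<and> (\<forall>i\<ge>1. {v \<in> free_mod (b i). lin_map (d i) (b (i - 1)) (b i) v = (\<lambda>_. 0)}
               = lin_map (d (i + 1)) (b i) (b (i + 1)) ` free_mod (b (i + 1)))
     \<and> (\<exists>N. \<forall>i>N. b i = 0)
     \<and> (\<forall>i\<ge>1. \<forall>j<b (i - 1). \<forall>l<b i. Poly_Mapping.lookup (d i j l) 0 = 0)"

end

theory Submission
  imports Defs "HOL-Library.FuncSet" "HOL-Library.Cardinality"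
begin

text \<open>Let \<open>V\<close> be the support of \<open>I\<close>, $n = |V|$, and let \<open>G\<close> be the graph on \<open>V\<close> in which
  \<open>u\<close> and \<open>v\<close> are adjacent iff $x_u x_v \notin I$, the 1-skeleton of the Stanley-Reisner complex of
  \<open>I\<close>. As every $I(x = 1)$ is a complete intersection, inside each neighbourhood of \<open>G\<close>
  non-adjacency is a matching. Following Terai and Yoshida, if \<open>G\<close> is connected and \<open>I\<close> is not a
  complete intersection, this forces all degrees of \<open>G\<close> to be at most 2, so that the complex is a
  path or an \<open>n\<close>-gon and $c = n - 2$.

  The Betti numbers are bounded below by Koszul homology of $S/I$. In multidegree
  $\sigma \subseteq V$ and homological degree $|\sigma| - 1$ its dimension is the number of components
  of $G[\sigma]$ minus one. If \<open>G\<close> is disconnected, counting the \<open>\<sigma>\<close> that meet both sides gives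
  $\sum_i \beta_i \ge 2^{n-1}$, which is enough unless \<open>G\<close> has no edge at all. Otherwise \<open>G\<close> has at
  most \<open>n\<close> edges, and counting vertices minus edges of $G[\sigma]$ suffices, except for the
  pentagon, which needs one further class in multidegree \<open>V\<close>.

  Of the height only upper bounds are needed: a prime generated by \<open>m\<close> variables has height at
  most \<open>m\<close>, because $n + 1$ polynomials in \<open>n\<close> variables are algebraically dependent.\<close>

section \<open>Ideals and monomials\<close>

text \<open>The resolution carries no grading, so its ranks cannot be split by multidegree. Instead
  Tor is balanced by hand: Koszul cycles are lifted through a double complex using only exactness
  and the vanishing constant terms of the matrices, and a multidegree enters only as a coefficient
  read off at a squarefree exponent \<open>ind X\<close>.

  The bound increases with the height, so any estimate c <= m allows the inequality to be proved at
  m, and equality then forces c = m.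

  With n vertices and m edges the count gives a total of at least n 2^(n-1) + 2 - 2^n - m 2^(n-2).
  For m = n this is (n - 4) 2^(n-2) + 2, which beats 2^(n-2) + 2^(n-3) from n = 6 on. For n = 4 the
  quadrilateral, which is a complete intersection, drops out, and m <= 3 gives exactly 6. For n = 5
  the pentagon yields 1 + 5 + 5 degree by degree, one short of 12; this is the gap that the class in
  multidegree \<open>V\<close> fills.\<close>

abbreviation lookup where "lookup \<equiv> Poly_Mapping.lookup"
abbreviation keys where "keys \<equiv> Poly_Mapping.keys"
abbreviation single where "single \<equiv> Poly_Mapping.single"

lemma is_ideal_ideal_gen: "is_ideal (ideal_gen A)"
  unfolding ideal_gen_def is_ideal_def by blast

lemma ideal_gen_superset: "A \<subseteq> ideal_gen A"
  unfolding ideal_gen_def by blast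

lemma ideal_gen_least: "is_ideal J \<Longrightarrow> A \<subseteq> J \<Longrightarrow> ideal_gen A \<subseteq> J"
  unfolding ideal_gen_def by blast

lemma ideal_zero: "is_ideal J \<Longrightarrow> 0 \<in> J"
  by (simp add: is_ideal_def)

lemma ideal_add: "is_ideal J \<Longrightarrow> a \<in> J \<Longrightarrow> b \<in> J \<Longrightarrow> a + b \<in> J"
  by (simp add: is_ideal_def)

lemma ideal_mult: "is_ideal J \<Longrightarrow> a \<in> J \<Longrightarrow> r * a \<in> J"
  by (simp add: is_ideal_def)

lemma ideal_uminus: "is_ideal J \<Longrightarrow> a \<in> J \<Longrightarrow> - a \<in> J"
  using ideal_mult[of J a "- 1"] by simp

lemma ideal_diff: "is_ideal J \<Longrightarrow> a \<in> J \<Longrightarrow> b \<in> J \<Longrightarrow> a - b \<in> J"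
  using ideal_add[of J a "- b"] ideal_uminus[of J b] by simp

lemma ideal_sum: "is_ideal J \<Longrightarrow> (\<And>i. i \<in> A \<Longrightarrow> f i \<in> J) \<Longrightarrow> sum f A \<in> J"
  by (induction A rule: infinite_finite_induct) (auto intro: ideal_zero ideal_add)

lemma is_ideal_zero: "is_ideal {0}"
  by (simp add: is_ideal_def)

lemma ideal_gen_image_iff:
  assumes "finite A"
  shows "p \<in> ideal_gen (h ` A) \<longleftrightarrow> (\<exists>c. p = (\<Sum>i\<in>A. c i * h i))"
proof
  let ?J = "{p. \<exists>c. p = (\<Sum>i\<in>A. c i * h i)}"
  have "is_ideal ?J"
    unfolding is_ideal_def
  proof (intro conjI ballI allI)
    show "0 \<in> ?J"
      by (auto intro!: exI[of _ "\<lambda>_. 0"])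
  next
    fix a b assume "a \<in> ?J" "b \<in> ?J"
    then obtain c c' where "a = (\<Sum>i\<in>A. c i * h i)" "b = (\<Sum>i\<in>A. c' i * h i)"
      by blast
    then have "a + b = (\<Sum>i\<in>A. (c i + c' i) * h i)"
      by (simp add: sum.distrib distrib_right)
    then show "a + b \<in> ?J" by (auto intro!: exI[of _ "\<lambda>i. c i + c' i"])
  next
    fix r a assume "a \<in> ?J"
    then obtain c where "a = (\<Sum>i\<in>A. c i * h i)" by blast
    then have "r * a = (\<Sum>i\<in>A. (r * c i) * h i)"
      by (simp add: sum_distrib_left mult.assoc)
    then show "r * a \<in> ?J" by (auto intro!: exI[of _ "\<lambda>i. r * c i"])
  qed
  moreover have "h ` A \<subseteq> ?J"
  proof
    fix x assume "x \<in> h ` A"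
    then obtain j where j: "j \<in> A" "x = h j" by auto
    have "x = (\<Sum>i\<in>A. (if i = j then 1 else 0) * h i)"
      using j assms by (simp add: if_distrib[of "\<lambda>t. t * _"] sum.delta cong: if_cong)
    then show "x \<in> ?J" by (auto intro!: exI[of _ "\<lambda>i. if i = j then 1 else 0"])
  qed
  ultimately have "ideal_gen (h ` A) \<subseteq> ?J" by (rule ideal_gen_least)
  then show "p \<in> ideal_gen (h ` A) \<Longrightarrow> \<exists>c. p = (\<Sum>i\<in>A. c i * h i)" by blast
next
  assume "\<exists>c. p = (\<Sum>i\<in>A. c i * h i)"
  then obtain c where "p = (\<Sum>i\<in>A. c i * h i)" by blast
  then show "p \<in> ideal_gen (h ` A)"
    using ideal_gen_superset[of "h ` A"] by (auto intro!: ideal_sum ideal_mult is_ideal_ideal_gen)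
qed

lemma ideal_gen_list_iff:
  "p \<in> ideal_gen (set fs) \<longleftrightarrow> (\<exists>c. p = (\<Sum>i<length fs. c i * fs ! i))"
proof -
  have "set fs = (!) fs ` {..<length fs}" by (auto simp: in_set_conv_nth)
  then show ?thesis using ideal_gen_image_iff[of "{..<length fs}" p "(!) fs"] by simp
qed

lemma exp_dvd_refl [simp]: "exp_dvd a a"
  by (simp add: exp_dvd_def)

lemma exp_dvd_trans: "exp_dvd a b \<Longrightarrow> exp_dvd b c \<Longrightarrow> exp_dvd a c"
  unfolding exp_dvd_def using order_trans by blast

lemma exp_dvd_add [simp]: "exp_dvd a (a + b)"
  by (simp add: exp_dvd_def lookup_add)

lemma exp_dvd_addI2: "exp_dvd a b \<Longrightarrow> exp_dvd a (b + c)"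
  using exp_dvd_trans exp_dvd_add by blast

lemma exp_dvd_antisym: "exp_dvd a b \<Longrightarrow> exp_dvd b a \<Longrightarrow> a = b"
  by (intro poly_mapping_eqI) (simp add: exp_dvd_def le_antisym)

lemma exp_dvd_add_diff: "exp_dvd a b \<Longrightarrow> a + (b - a) = b"
  by (intro poly_mapping_eqI) (simp add: exp_dvd_def lookup_add lookup_minus)

lemma sum_singles: "(\<Sum>\<alpha>\<in>keys p. single \<alpha> (lookup p \<alpha>)) = p"
  by (intro poly_mapping_eqI)
     (simp add: lookup_sum lookup_single when_def sum.delta' in_keys_iff)

lemma lookup_single_mult_add:
  fixes a \<beta> :: "'v \<Rightarrow>\<^sub>0 nat" and p :: "('v, 'k::comm_ring_1) mpoly"
  shows "lookup (single a c * p) (a + \<beta>) = c * lookup p \<beta>"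
proof -
  have "single a c * p = (\<Sum>\<gamma>\<in>keys p. single a c * single \<gamma> (lookup p \<gamma>))"
    by (metis sum_distrib_left sum_singles)
  also have "\<dots> = (\<Sum>\<gamma>\<in>keys p. single (a + \<gamma>) (c * lookup p \<gamma>))"
    by (simp add: mult_single)
  finally show ?thesis
    by (simp add: lookup_sum lookup_single when_def sum.delta' in_keys_iff)
qed

lemma lookup_single_mult:
  fixes a \<alpha> :: "'v \<Rightarrow>\<^sub>0 nat" and p :: "('v, 'k::comm_ring_1) mpoly"
  shows "lookup (single a c * p) \<alpha> = (if exp_dvd a \<alpha> then c * lookup p (\<alpha> - a) else 0)"
proof (cases "exp_dvd a \<alpha>")
  case True
  then show ?thesis
    using lookup_single_mult_add[of a c p "\<alpha> - a"] by (simp add: exp_dvd_add_diff)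
next
  case False
  have "\<alpha> \<notin> keys (single a c * p)"
  proof
    assume "\<alpha> \<in> keys (single a c * p)"
    then obtain \<beta> where "\<alpha> = a + \<beta>"
      using keys_mult[of "single a c" p] by (auto split: if_splits)
    with False show False by simp
  qed
  with False show ?thesis by (simp add: in_keys_iff)
qed

lemma is_ideal_keys:
  assumes "\<And>\<alpha> \<beta>. \<alpha> \<in> U \<Longrightarrow> \<beta> + \<alpha> \<in> U"
  shows "is_ideal {p :: ('v, 'k::comm_ring_1) mpoly. keys p \<subseteq> U}"
  unfolding is_ideal_def
proof (intro conjI ballI allI)
  fix a b :: "('v, 'k) mpoly" assume "a \<in> {p. keys p \<subseteq> U}" "b \<in> {p. keys p \<subseteq> U}"
  then show "a + b \<in> {p. keys p \<subseteq> U}" using keys_add[of a b] by blast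
next
  fix r a :: "('v, 'k) mpoly" assume "a \<in> {p. keys p \<subseteq> U}"
  then show "r * a \<in> {p. keys p \<subseteq> U}" using keys_mult[of r a] assms by blast
qed simp

text \<open>The polynomials all of whose exponents are multiples of elements of \<open>A\<close>
  form an ideal containing the generators, so membership is decided exponent by exponent. This is
  the bridge from monomial ideals to divisibility and later to inclusion of sets.\<close>

lemma mem_ideal_gen_monom_iff:
  fixes p :: "('v, 'k::comm_ring_1) mpoly"
  shows "p \<in> ideal_gen (monom ` A) \<longleftrightarrow> (\<forall>\<alpha>\<in>keys p. \<exists>a\<in>A. exp_dvd a \<alpha>)"
proof
  let ?U = "{\<alpha>. \<exists>a\<in>A. exp_dvd a \<alpha>}"
  have "is_ideal {p :: ('v, 'k) mpoly. keys p \<subseteq> ?U}"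
    by (rule is_ideal_keys) (auto simp: add.commute intro: exp_dvd_addI2)
  moreover have "monom ` A \<subseteq> {p :: ('v, 'k) mpoly. keys p \<subseteq> ?U}"
    by (auto simp: monom_def intro: exp_dvd_refl)
  ultimately have "ideal_gen (monom ` A) \<subseteq> {p :: ('v, 'k) mpoly. keys p \<subseteq> ?U}"
    by (rule ideal_gen_least)
  then show "p \<in> ideal_gen (monom ` A) \<Longrightarrow> \<forall>\<alpha>\<in>keys p. \<exists>a\<in>A. exp_dvd a \<alpha>" by blast
next
  assume *: "\<forall>\<alpha>\<in>keys p. \<exists>a\<in>A. exp_dvd a \<alpha>"
  have "single \<alpha> (lookup p \<alpha>) \<in> ideal_gen (monom ` A)" if "\<alpha> \<in> keys p" for \<alpha>
  proof -
    from * that obtain a where a: "a \<in> A" "exp_dvd a \<alpha>" by blast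
    have "single \<alpha> (lookup p \<alpha>) = single (\<alpha> - a) (lookup p \<alpha>) * monom a"
      using a by (simp add: monom_def mult_single exp_dvd_add_diff add.commute)
    moreover have "monom a \<in> ideal_gen (monom ` A :: ('v, 'k) mpoly set)"
      using a ideal_gen_superset by blast
    ultimately show ?thesis by (metis ideal_mult is_ideal_ideal_gen)
  qed
  then have "(\<Sum>\<alpha>\<in>keys p. single \<alpha> (lookup p \<alpha>)) \<in> ideal_gen (monom ` A)"
    by (intro ideal_sum is_ideal_ideal_gen)
  then show "p \<in> ideal_gen (monom ` A)" by (simp add: sum_singles)
qed

lemma monom_mem_ideal_gen_iff:
  "(monom \<alpha> :: ('v, 'k::comm_ring_1) mpoly) \<in> ideal_gen (monom ` A) \<longleftrightarrow> (\<exists>a\<in>A. exp_dvd a \<alpha>)"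
  by (simp add: mem_ideal_gen_monom_iff) (simp add: monom_def)

text \<open>The ideal generated by the variables in \<open>W\<close>, described through exponents so
  that membership can be read off term by term. It is zero for \<open>W = {}\<close>, and for
  \<open>W = UNIV\<close> it is the ideal of polynomials without constant term.\<close>

definition var_ideal :: "'v set \<Rightarrow> ('v, 'k::comm_ring_1) mpoly set" where
  "var_ideal W = {p. \<forall>\<alpha>\<in>keys p. \<exists>w\<in>W. lookup \<alpha> w \<noteq> 0}"

lemma is_ideal_var_ideal: "is_ideal (var_ideal W :: ('v, 'k::comm_ring_1) mpoly set)"
proof -
  have "is_ideal {p :: ('v, 'k) mpoly. keys p \<subseteq> {\<alpha>. \<exists>w\<in>W. lookup \<alpha> w \<noteq> 0}}"
    by (rule is_ideal_keys) (auto simp: lookup_add)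
  moreover have "{p :: ('v, 'k) mpoly. keys p \<subseteq> {\<alpha>. \<exists>w\<in>W. lookup \<alpha> w \<noteq> 0}} = var_ideal W"
    by (auto simp: var_ideal_def)
  ultimately show ?thesis by simp
qed

definition xvar :: "'v \<Rightarrow> ('v, 'k::comm_ring_1) mpoly" where
  "xvar v = monom (single v 1)"

lemma lookup_xvar_mult:
  fixes p :: "('v, 'k::comm_ring_1) mpoly"
  shows "lookup (xvar v * p) \<alpha> = (if lookup \<alpha> v = 0 then 0 else lookup p (\<alpha> - single v 1))"
proof -
  have "exp_dvd (single v 1) \<alpha> \<longleftrightarrow> lookup \<alpha> v \<noteq> 0"
    by (auto simp: exp_dvd_def lookup_single when_def Suc_le_eq)
  then show ?thesis
    by (simp add: xvar_def monom_def lookup_single_mult)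
qed

definition ind :: "'v::finite set \<Rightarrow> 'v \<Rightarrow>\<^sub>0 nat" where
  "ind X = Abs_poly_mapping (\<lambda>v. if v \<in> X then 1 else 0)"

lemma lookup_ind [simp]: "lookup (ind X) v = (if v \<in> X then 1 else 0)"
  by (simp add: ind_def)

lemma keys_ind [simp]: "keys (ind X) = X"
  by (auto simp: in_keys_iff split: if_splits)

lemma squarefree_exp_eq_ind: "squarefree_exp \<alpha> \<Longrightarrow> \<alpha> = ind (keys \<alpha>)"
  unfolding squarefree_exp_def
  by (intro poly_mapping_eqI) (metis One_nat_def in_keys_iff le_Suc_eq le_zero_eq lookup_ind)

lemma ind_inject [simp]: "ind X = ind Y \<longleftrightarrow> X = Y"
  by (metis keys_ind)

lemma exp_deg_ind [simp]: "exp_deg (ind X) = card X"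
  by (simp add: exp_deg_def)

section \<open>Linear systems\<close>

text \<open>Rank-nullity in coordinates: \<open>P\<close> indexes a linearly independent family of
  solutions. Each further equation costs one member, and truncated subtraction covers systems with
  more equations than unknowns.\<close>

lemma independent_solutions:
  fixes eq :: "'e \<Rightarrow> 'q \<Rightarrow> 'k::field"
  assumes "finite Q" "finite E"
  shows "\<exists>(P :: nat set) f. finite P \<and> card P = card Q - card E
    \<and> (\<forall>p\<in>P. \<forall>e\<in>E. (\<Sum>q\<in>Q. eq e q * f p q) = 0)
    \<and> (\<forall>a. (\<forall>q\<in>Q. (\<Sum>p\<in>P. a p * f p q) = 0) \<longrightarrow> (\<forall>p\<in>P. a p = 0))"
  using assms(2)
proof (induction E rule: finite_induct)
  case empty
  obtain h where h: "bij_betw h {..<card Q} Q"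
    using assms(1) by (metis atLeast0LessThan ex_bij_betw_nat_finite)
  define f where "f = (\<lambda>p q. if q = h p then 1 else 0 :: 'k)"
  have "\<forall>p<card Q. a p = 0" if z: "\<forall>q\<in>Q. (\<Sum>p<card Q. a p * f p q) = 0" for a
  proof (intro allI impI)
    fix p assume p: "p < card Q"
    then have "h p \<in> Q" using h by (auto simp: bij_betw_def)
    moreover have "(\<Sum>p'<card Q. a p' * f p' (h p)) = (\<Sum>p'<card Q. if p' = p then a p' else 0)"
      using h p by (intro sum.cong) (auto simp: f_def bij_betw_def inj_on_def)
    ultimately show "a p = 0" using z p by (simp add: sum.delta)
  qed
  then show ?case
    by (intro exI[of _ "{..<card Q}"] exI[of _ f]) auto
next
  case (insert e E)
  then obtain P :: "nat set" and f where P: "finite P" "card P = card Q - card E"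
    and sol: "\<forall>p\<in>P. \<forall>e\<in>E. (\<Sum>q\<in>Q. eq e q * f p q) = 0"
    and ind: "\<And>a. (\<forall>q\<in>Q. (\<Sum>p\<in>P. a p * f p q) = 0) \<Longrightarrow> (\<forall>p\<in>P. a p = 0)"
    by blast
  show ?case
  proof (cases "P = {}")
    case True
    then have "card Q - card E = 0" using P by simp
    then show ?thesis using insert.hyps
      by (intro exI[of _ "{}"] exI[of _ f]) auto
  next
    case False
    define t where "t p = (\<Sum>q\<in>Q. eq e q * f p q)" for p
    obtain p0 where p0: "p0 \<in> P" "t p0 \<noteq> 0 \<or> (\<forall>p\<in>P. t p = 0)"
      using False by blast
    \<comment> \<open>Elimination with pivot \<open>p0\<close>. If all \<open>t p\<close> vanish,
      \<open>0 / 0 = 0\<close> gives \<open>g = f\<close>, and \<open>p0\<close> is dropped all the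
      same.\<close>
    define g where "g p q = f p q - t p / t p0 * f p0 q" for p q
    let ?P = "P - {p0}"
    have lin: "(\<Sum>q\<in>Q. c q * g p q) = (\<Sum>q\<in>Q. c q * f p q) - t p / t p0 * (\<Sum>q\<in>Q. c q * f p0 q)"
      for c p
      by (simp add: g_def algebra_simps sum_subtractf sum_distrib_left)
    have "(\<Sum>q\<in>Q. eq e' q * g p q) = 0" if "p \<in> ?P" "e' \<in> insert e E" for p e'
    proof (cases "e' = e")
      case True
      show ?thesis unfolding True lin using p0 that by (auto simp: t_def[symmetric])
    next
      case False
      then show ?thesis unfolding lin using sol p0 that by auto
    qed
    moreover have "a p = 0" if z: "\<forall>q\<in>Q. (\<Sum>p\<in>?P. a p * g p q) = 0" and p: "p \<in> ?P" for a p
    proof -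
      \<comment> \<open>A relation among the \<open>g p\<close> becomes one among the
        \<open>f p\<close> once \<open>f p0\<close> receives the sum of all corrections as
        coefficient.\<close>
      define a' where "a' p = (if p = p0 then - (\<Sum>p\<in>?P. a p * (t p / t p0)) else a p)" for p
      have "(\<Sum>p\<in>P. a' p * f p q) = 0" if "q \<in> Q" for q
      proof -
        have "(\<Sum>p\<in>P. a' p * f p q) = a' p0 * f p0 q + (\<Sum>p\<in>?P. a' p * f p q)"
          using P p0 by (simp add: sum.remove)
        also have "(\<Sum>p\<in>?P. a' p * f p q) = (\<Sum>p\<in>?P. a p * f p q)"
          by (intro sum.cong) (auto simp: a'_def)
        also have "a' p0 * f p0 q + \<dots> = (\<Sum>p\<in>?P. a p * g p q)"
          by (simp add: a'_def g_def algebra_simps sum_subtractf sum_distrib_left)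
        finally show ?thesis using z that by simp
      qed
      then have "a' p = 0" using ind p by blast
      then show ?thesis using p by (simp add: a'_def)
    qed
    moreover have "finite ?P" "card ?P = card Q - card (insert e E)"
      using P p0 insert.hyps by auto
    ultimately show ?thesis by (intro exI[of _ ?P] exI[of _ g]) auto
  qed
qed

lemma nontrivial_solution:
  fixes eq :: "'e \<Rightarrow> 'q \<Rightarrow> 'k::field"
  assumes "finite Q" "finite E" "card E < card Q"
  shows "\<exists>f. (\<exists>q\<in>Q. f q \<noteq> 0) \<and> (\<forall>e\<in>E. (\<Sum>q\<in>Q. eq e q * f q) = 0)"
proof -
  obtain P :: "nat set" and f where P: "finite P" "card P = card Q - card E"
    and sol: "\<forall>p\<in>P. \<forall>e\<in>E. (\<Sum>q\<in>Q. eq e q * f p q) = 0"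
    and ind: "\<And>a. (\<forall>q\<in>Q. (\<Sum>p\<in>P. a p * f p q) = 0) \<Longrightarrow> (\<forall>p\<in>P. a p = 0)"
    using independent_solutions[OF assms(1,2), of eq] by blast
  have "P \<noteq> {}" using P assms by auto
  then obtain p where p: "p \<in> P" by blast
  have "\<exists>q\<in>Q. f p q \<noteq> 0"
  proof (rule ccontr)
    assume "\<not> ?thesis"
    then have "\<forall>q\<in>Q. (\<Sum>p'\<in>P. (if p' = p then 1 else 0) * f p' q) = 0"
      by (auto intro!: sum.neutral)
    from ind[OF this] p show False by auto
  qed
  then show ?thesis using sol p by blast
qed

section \<open>Heights of ideals generated by variables\<close>

definition exps_le :: "nat \<Rightarrow> ('v, 'k::comm_ring_1) mpoly set" where
  "exps_le K = {p. \<forall>\<alpha>\<in>keys p. \<forall>v. lookup \<alpha> v \<le> K}"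

lemma exps_le_one: "1 \<in> exps_le K"
  by (simp add: exps_le_def)

lemma exps_le_mult: "p \<in> exps_le K \<Longrightarrow> q \<in> exps_le L \<Longrightarrow> p * q \<in> exps_le (K + L)"
  using keys_mult[of p q] unfolding exps_le_def
  by (clarsimp simp: subset_iff) (metis add_mono lookup_add)

lemma exps_le_power: "p \<in> exps_le K \<Longrightarrow> p ^ e \<in> exps_le (K * e)"
  by (induction e) (auto simp: exps_le_one intro: exps_le_mult)

lemma exps_le_mono: "p \<in> exps_le K \<Longrightarrow> K \<le> L \<Longrightarrow> p \<in> exps_le L"
  unfolding exps_le_def using order_trans by blast

lemma exps_le_prod:
  assumes "finite J" "\<And>j. j \<in> J \<Longrightarrow> f j \<in> exps_le K"
  shows "prod f J \<in> exps_le (card J * K)"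
  using assms by (induction J rule: finite_induct) (auto simp: exps_le_one intro: exps_le_mult)

lemma exps_le_finite: "\<exists>D. (p :: ('v::finite, 'k::comm_ring_1) mpoly) \<in> exps_le D"
proof -
  let ?S = "\<Union>\<alpha>\<in>keys p. lookup \<alpha> ` UNIV"
  have "finite ?S" by simp
  then have "\<forall>\<alpha>\<in>keys p. \<forall>v. lookup \<alpha> v \<le> Max ?S" by (auto intro!: Max_ge)
  then show ?thesis unfolding exps_le_def by blast
qed

lemma finite_card_bounded_exps:
  "finite {\<alpha> :: 'v::finite \<Rightarrow>\<^sub>0 nat. \<forall>v. lookup \<alpha> v \<le> K}"
  "card {\<alpha> :: 'v::finite \<Rightarrow>\<^sub>0 nat. \<forall>v. lookup \<alpha> v \<le> K} \<le> (K + 1) ^ CARD('v)"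
proof -
  let ?A = "{\<alpha> :: 'v \<Rightarrow>\<^sub>0 nat. \<forall>v. lookup \<alpha> v \<le> K}"
  let ?B = "PiE (UNIV :: 'v set) (\<lambda>_. {..K})"
  have i: "inj_on lookup ?A" by (metis inj_onI poly_mapping_eqI)
  have s: "lookup ` ?A \<subseteq> ?B" by auto
  have f: "finite ?B" by (intro finite_PiE) auto
  show "finite ?A" using finite_imageD[OF finite_subset[OF s f] i] .
  have "card ?A \<le> card ?B" by (rule card_inj_on_le[OF i s f])
  then show "card ?A \<le> (K + 1) ^ CARD('v)" by (simp add: card_PiE)
qed

text \<open>The $N^{n+1}$ monomials with exponents below \<open>N\<close> in $n+1$ polynomials in $n$ variables
  live in a space of dimension $O(N^n)$.\<close>

lemma algebraically_dependent:
  fixes a :: "nat \<Rightarrow> ('v::finite, 'k::field) mpoly"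
  defines "m \<equiv> CARD('v) + 1"
  shows "\<exists>E g. finite E \<and> E \<noteq> {} \<and> E \<subseteq> PiE {..<m} (\<lambda>_. UNIV :: nat set) \<and> (\<forall>e\<in>E. g e \<noteq> 0)
    \<and> (\<Sum>e\<in>E. single 0 (g e) * (\<Prod>j<m. a j ^ e j)) = 0"
proof -
  let ?n = "CARD('v)"
  have "\<forall>j. \<exists>D. a j \<in> exps_le D" using exps_le_finite by blast
  then obtain Df where Df: "\<And>j. a j \<in> exps_le (Df j)" by metis
  define D where "D = (\<Sum>j<m. Df j)"
  have D: "a j \<in> exps_le D" if "j < m" for j
    using that by (intro exps_le_mono[OF Df]) (simp add: D_def member_le_sum)
  \<comment> \<open>Since \<open>K + 1\<close> is at most \<open>(m * D + 1) * N\<close>, there are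
    at most (mD + 1)^n N^n target exponents. They are fewer than the N^(n+1) unknowns as soon as
    \<open>N\<close> exceeds (mD + 1)^n.\<close>
  define N where "N = (m * D + 1) ^ ?n + 1"
  define K where "K = m * (D * N)"
  define Q where "Q = PiE {..<m} (\<lambda>_. {..<N})"
  define B where "B = {\<alpha> :: 'v \<Rightarrow>\<^sub>0 nat. \<forall>v. lookup \<alpha> v \<le> K}"
  define mon where "mon e = (\<Prod>j<m. a j ^ e j)" for e
  have finQ: "finite Q" by (simp add: Q_def finite_PiE)
  have "card B \<le> (K + 1) ^ ?n" unfolding B_def by (rule finite_card_bounded_exps)
  also have "\<dots> \<le> ((m * D + 1) * N) ^ ?n"
    by (intro power_mono) (auto simp: K_def N_def algebra_simps)
  also have "\<dots> = (m * D + 1) ^ ?n * N ^ ?n" by (rule power_mult_distrib)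
  also have "\<dots> < N * N ^ ?n" unfolding N_def by (intro mult_strict_right_mono) auto
  also have "\<dots> = card Q" by (simp add: Q_def card_PiE m_def)
  finally have "card B < card Q" .
  then obtain g where g: "\<exists>e\<in>Q. g e \<noteq> 0" "\<forall>\<alpha>\<in>B. (\<Sum>e\<in>Q. lookup (mon e) \<alpha> * g e) = 0"
    using nontrivial_solution[OF finQ, of B "\<lambda>\<alpha> e. lookup (mon e) \<alpha>"]
    by (auto simp: B_def finite_card_bounded_exps)
  have mon: "mon e \<in> exps_le K" if e: "e \<in> Q" for e
  proof -
    have "a j ^ e j \<in> exps_le (D * N)" if j: "j < m" for j
    proof -
      have "e j \<le> N" using e j by (auto simp: Q_def PiE_iff intro: less_imp_le)
      then show ?thesis using exps_le_mono[OF exps_le_power[OF D[OF j]]] by simp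
    qed
    then show ?thesis unfolding mon_def K_def using exps_le_prod[of "{..<m}"] by fastforce
  qed
  have z: "(\<Sum>e\<in>Q. single 0 (g e) * mon e) = 0"
  proof (rule poly_mapping_eqI)
    fix \<alpha>
    have "lookup (\<Sum>e\<in>Q. single 0 (g e) * mon e) \<alpha> = (\<Sum>e\<in>Q. lookup (mon e) \<alpha> * g e)"
      unfolding lookup_sum
    proof (intro sum.cong refl)
      fix e show "lookup (single 0 (g e) * mon e) \<alpha> = lookup (mon e) \<alpha> * g e"
        using lookup_single_mult_add[of 0 "g e" "mon e" \<alpha>] by simp
    qed
    also have "\<dots> = 0"
    proof (cases "\<alpha> \<in> B")
      case False
      then have "lookup (mon e) \<alpha> = 0" if "e \<in> Q" for e
        using mon[OF that] by (auto simp: exps_le_def B_def in_keys_iff)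
      then show ?thesis by simp
    qed (use g in auto)
    finally show "lookup (\<Sum>e\<in>Q. single 0 (g e) * mon e) \<alpha> = lookup 0 \<alpha>" by simp
  qed
  let ?E = "{e \<in> Q. g e \<noteq> 0}"
  have "(\<Sum>e\<in>?E. single 0 (g e) * mon e) = (\<Sum>e\<in>Q. single 0 (g e) * mon e)"
    using finQ by (intro sum.mono_neutral_left) auto
  with z have "(\<Sum>e\<in>?E. single 0 (g e) * mon e) = 0" by simp
  moreover have "?E \<subseteq> PiE {..<m} (\<lambda>_. UNIV)" unfolding Q_def using PiE_mono by blast
  moreover have "finite ?E" "?E \<noteq> {}" "\<forall>e\<in>?E. g e \<noteq> 0" using finQ g(1) by simp_all blast
  ultimately show ?thesis unfolding mon_def by blast
qed

lemma prime_ideal_power_notin: "prime_ideal P \<Longrightarrow> a \<notin> P \<Longrightarrow> a ^ e \<notin> P"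
  by (induction e) (auto simp: prime_ideal_def)

lemma prime_ideal_is_ideal: "prime_ideal P \<Longrightarrow> is_ideal P"
  by (simp add: prime_ideal_def)

text \<open>An algebraic relation between elements chosen from the successive differences of a long
  chain of primes is reduced, one prime at a time, to its lexicographically least term.\<close>

lemma no_long_prime_chain:
  fixes P :: "nat \<Rightarrow> ('v::finite, 'k::field) mpoly set"
  defines "m \<equiv> CARD('v) + 1"
  assumes prime: "\<And>i. i \<le> m \<Longrightarrow> prime_ideal (P i)"
    and chain: "\<And>i. i < m \<Longrightarrow> P i \<subset> P (Suc i)"
  shows False
proof -
  have "\<exists>x. x \<in> P (Suc i) \<and> x \<notin> P i" if "i < m" for i using chain[OF that] by blast
  then obtain a where a: "\<And>i. i < m \<Longrightarrow> a i \<in> P (Suc i) \<and> a i \<notin> P i" by metis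
  obtain E0 g where E0: "finite E0" "E0 \<noteq> {}" "E0 \<subseteq> PiE {..<m} (\<lambda>_. UNIV :: nat set)"
    "\<forall>e\<in>E0. g e \<noteq> 0" "(\<Sum>e\<in>E0. single 0 (g e) * (\<Prod>j<m. a j ^ e j)) = 0"
    using algebraically_dependent[of a] unfolding m_def by blast
  \<comment> \<open>Invariant after \<open>i\<close> rounds: the surviving terms agree in their
    first \<open>i\<close> exponents, and those powers have been stripped off.\<close>
  have "\<exists>E. E \<subseteq> E0 \<and> E \<noteq> {} \<and> (\<forall>e\<in>E. \<forall>e'\<in>E. \<forall>j<i. e j = e' j)
      \<and> (\<Sum>e\<in>E. single 0 (g e) * (\<Prod>j=i..<m. a j ^ e j)) \<in> P i" if "i \<le> m" for i
    using that
  proof (induction i)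
    case 0
    then show ?case using E0 prime[of 0]
      by (intro exI[of _ E0]) (auto simp: atLeast0LessThan ideal_zero prime_ideal_is_ideal)
  next
    case (Suc i)
    then obtain E where E: "E \<subseteq> E0" "E \<noteq> {}" "\<forall>e\<in>E. \<forall>e'\<in>E. \<forall>j<i. e j = e' j"
      "(\<Sum>e\<in>E. single 0 (g e) * (\<Prod>j=i..<m. a j ^ e j)) \<in> P i" by auto
    have finE: "finite E" using E E0 finite_subset by blast
    \<comment> \<open>As \<open>a i\<close> is not in the prime \<open>P i\<close>, its common power
      can be cancelled. Terms that still contain \<open>a i\<close> then lie in
      \<open>P (Suc i)\<close>, so only the terms with least exponent at \<open>i\<close> survive
      the round.\<close>
    define \<mu> where "\<mu> = Min ((\<lambda>e. e i) ` E)"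
    have \<mu>: "\<mu> \<le> e i" if "e \<in> E" for e using that finE by (simp add: \<mu>_def)
    have "\<mu> \<in> (\<lambda>e. e i) ` E" unfolding \<mu>_def using finE E by (intro Min_in) auto
    then obtain e0 where e0: "e0 \<in> E" "e0 i = \<mu>" by auto
    define r where "r e = single 0 (g e) * (\<Prod>j=Suc i..<m. a j ^ e j)" for e
    have "(\<Prod>j=i..<m. a j ^ e j) = a i ^ \<mu> * (a i ^ (e i - \<mu>) * (\<Prod>j=Suc i..<m. a j ^ e j))"
      if "e \<in> E" for e
      using Suc.prems \<mu>[OF that]
      by (subst prod.atLeast_Suc_lessThan) (auto simp: power_add[symmetric] mult.assoc[symmetric])
    then have "(\<Sum>e\<in>E. single 0 (g e) * (\<Prod>j=i..<m. a j ^ e j))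
        = a i ^ \<mu> * (\<Sum>e\<in>E. a i ^ (e i - \<mu>) * r e)"
      by (simp add: sum_distrib_left r_def mult.left_commute)
    then have "(\<Sum>e\<in>E. a i ^ (e i - \<mu>) * r e) \<in> P i"
      using E(4) prime[of i] Suc.prems a[of i] prime_ideal_power_notin[of "P i" "a i" \<mu>]
      unfolding prime_ideal_def by auto
    then have s: "(\<Sum>e\<in>E. a i ^ (e i - \<mu>) * r e) \<in> P (Suc i)" using chain[of i] Suc.prems by auto
    let ?E = "{e \<in> E. e i = \<mu>}"
    have idl: "is_ideal (P (Suc i))" using prime Suc.prems by (simp add: prime_ideal_is_ideal)
    have "(\<Sum>e\<in>E. a i ^ (e i - \<mu>) * r e)
        = (\<Sum>e\<in>E - ?E. a i ^ (e i - \<mu>) * r e) + (\<Sum>e\<in>?E. a i ^ (e i - \<mu>) * r e)"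
      using finE by (intro sum.subset_diff) auto
    moreover have "(\<Sum>e\<in>E - ?E. a i ^ (e i - \<mu>) * r e) \<in> P (Suc i)"
    proof (intro ideal_sum idl)
      fix e assume "e \<in> E - ?E"
      then obtain t where t: "e i - \<mu> = Suc t" using \<mu>[of e] by (cases "e i - \<mu>") auto
      have "a i ^ (e i - \<mu>) * r e = (a i ^ t * r e) * a i" unfolding t by (simp add: mult_ac)
      then show "a i ^ (e i - \<mu>) * r e \<in> P (Suc i)"
        using a[of i] Suc.prems ideal_mult[OF idl] by auto
    qed
    moreover have "(\<Sum>e\<in>?E. a i ^ (e i - \<mu>) * r e) = (\<Sum>e\<in>?E. r e)" by (intro sum.cong) auto
    ultimately have "(\<Sum>e\<in>?E. r e) \<in> P (Suc i)"
      using ideal_diff[OF idl s, of "\<Sum>e\<in>E - ?E. a i ^ (e i - \<mu>) * r e"] by simp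
    then show ?case using E e0 by (intro exI[of _ ?E]) (auto simp: r_def less_Suc_eq)
  qed
  from this[of m] obtain E where E: "E \<subseteq> E0" "E \<noteq> {}" "\<forall>e\<in>E. \<forall>e'\<in>E. \<forall>j<m. e j = e' j"
    "(\<Sum>e\<in>E. single 0 (g e) * (\<Prod>j=m..<m. a j ^ e j)) \<in> P m" by blast
  then obtain e where e: "e \<in> E" by blast
  have "E = {e}"
  proof -
    have "e' = e" if e': "e' \<in> E" for e'
    proof (rule PiE_ext)
      show "e' \<in> PiE {..<m} (\<lambda>_. UNIV)" "e \<in> PiE {..<m} (\<lambda>_. UNIV)"
        using E(1) E0(3) e e' by blast+
      show "e' j = e j" if "j \<in> {..<m}" for j using E(3) e e' that by blast
    qed
    then show ?thesis using e by blast
  qed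
  then have "single 0 (g e) \<in> P m" using E by simp
  then have "single 0 (inverse (g e)) * single 0 (g e) \<in> P m"
    using prime[of m] by (intro ideal_mult) (auto simp: prime_ideal_is_ideal)
  moreover have "g e \<noteq> 0" using E0(4) E(1) e by blast
  ultimately have "1 \<in> P m" by (simp add: mult_single)
  then show False using prime[of m] by (simp add: prime_ideal_def)
qed

section \<open>Primality of ideals generated by variables\<close>

lemma lookup_mult_sum:
  fixes p q :: "('v, 'k::comm_ring_1) mpoly"
  shows "lookup (p * q) \<gamma> =
    (\<Sum>\<alpha>\<in>keys p. \<Sum>\<beta>\<in>keys q. if \<alpha> + \<beta> = \<gamma> then lookup p \<alpha> * lookup q \<beta> else 0)"
proof -
  have "p * q = (\<Sum>\<alpha>\<in>keys p. \<Sum>\<beta>\<in>keys q. single (\<alpha> + \<beta>) (lookup p \<alpha> * lookup q \<beta>))"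
    by (subst (1 2) sum_singles[symmetric]) (simp add: sum_product mult_single)
  then show ?thesis by (simp add: lookup_sum lookup_single when_def)
qed

text \<open>The type \<open>'v\<close> has no order. Renaming the variables by natural numbers makes
  the linear order on exponents over \<open>nat\<close>, which is compatible with addition,
  available as a monomial order.\<close>

lemma ex_additive_order_embedding:
  "\<exists>T :: ('v::finite \<Rightarrow>\<^sub>0 nat) \<Rightarrow> (nat \<Rightarrow>\<^sub>0 nat). inj T \<and> (\<forall>\<alpha> \<beta>. T (\<alpha> + \<beta>) = T \<alpha> + T \<beta>)"
proof -
  obtain h :: "'v \<Rightarrow> nat" where h: "inj h"
    using finite_imp_inj_to_nat_seg[of "UNIV :: 'v set"] by auto
  define T :: "('v \<Rightarrow>\<^sub>0 nat) \<Rightarrow> (nat \<Rightarrow>\<^sub>0 nat)"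
    where "T \<alpha> = (\<Sum>v\<in>UNIV. single (h v) (lookup \<alpha> v))" for \<alpha>
  have "lookup (T \<alpha>) (h v) = lookup \<alpha> v" for \<alpha> v
  proof -
    have "lookup (T \<alpha>) (h v) = (\<Sum>u\<in>UNIV. if u = v then lookup \<alpha> u else 0)"
      unfolding T_def lookup_sum lookup_single when_def
      using h by (intro sum.cong) (auto dest: injD)
    then show ?thesis by simp
  qed
  then have "inj T" by (metis injI poly_mapping_eqI)
  moreover have "\<forall>\<alpha> \<beta>. T (\<alpha> + \<beta>) = T \<alpha> + T \<beta>"
    by (simp add: T_def lookup_add single_add sum.distrib)
  ultimately show ?thesis by blast
qed

text \<open>If neither factor lies in the ideal, both have terms free of the variables in
  \<open>W\<close>. The product of the largest such terms cannot cancel: any other pair with the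
  same exponent would also be free of \<open>W\<close>, and one of its members would exceed a
  maximum.\<close>

lemma prime_ideal_var_ideal: "prime_ideal (var_ideal W :: ('v::finite, 'k::field) mpoly set)"
  unfolding prime_ideal_def
proof (intro conjI allI impI)
  show "is_ideal (var_ideal W :: ('v, 'k) mpoly set)" by (rule is_ideal_var_ideal)
  show "1 \<notin> (var_ideal W :: ('v, 'k) mpoly set)" by (simp add: var_ideal_def)
  fix p q :: "('v, 'k) mpoly" assume pq: "p * q \<in> var_ideal W"
  show "p \<in> var_ideal W \<or> q \<in> var_ideal W"
  proof (rule ccontr)
    assume n: "\<not> ?thesis"
    obtain T :: "('v \<Rightarrow>\<^sub>0 nat) \<Rightarrow> (nat \<Rightarrow>\<^sub>0 nat)"
      where T: "inj T" "\<And>\<alpha> \<beta>. T (\<alpha> + \<beta>) = T \<alpha> + T \<beta>"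
      using ex_additive_order_embedding by blast
    define F where "F r = {\<alpha> \<in> keys r. \<forall>w\<in>W. lookup \<alpha> w = 0}" for r :: "('v, 'k) mpoly"
    have top: "\<exists>\<alpha>\<in>F r. \<forall>\<beta>\<in>F r. T \<beta> \<le> T \<alpha>" if "r \<notin> var_ideal W" for r :: "('v, 'k) mpoly"
    proof -
      have fin: "finite (T ` F r)" by (simp add: F_def)
      have ne: "T ` F r \<noteq> {}" using that by (auto simp: F_def var_ideal_def)
      from Max_in[OF fin ne] obtain \<alpha> where "\<alpha> \<in> F r" "T \<alpha> = Max (T ` F r)" by auto
      then show ?thesis using Max_ge[OF fin] by (intro bexI[of _ \<alpha>]) auto
    qed
    from top n obtain \<alpha>0 where \<alpha>0: "\<alpha>0 \<in> F p" "\<forall>\<beta>\<in>F p. T \<beta> \<le> T \<alpha>0" by blast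
    from top n obtain \<beta>0 where \<beta>0: "\<beta>0 \<in> F q" "\<forall>\<beta>\<in>F q. T \<beta> \<le> T \<beta>0" by blast
    have u: "\<alpha> + \<beta> = \<alpha>0 + \<beta>0 \<longleftrightarrow> \<alpha> = \<alpha>0 \<and> \<beta> = \<beta>0" if "\<alpha> \<in> keys p" "\<beta> \<in> keys q" for \<alpha> \<beta>
    proof
      assume s: "\<alpha> + \<beta> = \<alpha>0 + \<beta>0"
      have "lookup \<alpha> w + lookup \<beta> w = 0" if "w \<in> W" for w
        using arg_cong[OF s, of "\<lambda>\<gamma>. lookup \<gamma> w"] \<alpha>0(1) \<beta>0(1) that by (simp add: F_def lookup_add)
      then have "\<alpha> \<in> F p" "\<beta> \<in> F q" using that by (auto simp: F_def)
      then have "T \<alpha> \<le> T \<alpha>0" "T \<beta> \<le> T \<beta>0" using \<alpha>0 \<beta>0 by auto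
      moreover have "T \<alpha> + T \<beta> = T \<alpha>0 + T \<beta>0" using s T(2) by metis
      ultimately have "T \<alpha> = T \<alpha>0"
        by (metis add_less_le_mono order_less_irrefl le_less)
      then have "\<alpha> = \<alpha>0" using T(1) by (auto dest: injD)
      then show "\<alpha> = \<alpha>0 \<and> \<beta> = \<beta>0" using s by simp
    qed simp
    have k: "\<alpha>0 \<in> keys p" "\<beta>0 \<in> keys q" using \<alpha>0 \<beta>0 by (auto simp: F_def)
    have "lookup (p * q) (\<alpha>0 + \<beta>0)
      = (\<Sum>\<alpha>\<in>keys p. \<Sum>\<beta>\<in>keys q. if \<alpha> = \<alpha>0 then if \<beta> = \<beta>0 then lookup p \<alpha> * lookup q \<beta> else 0 else 0)"
      unfolding lookup_mult_sum by (intro sum.cong refl) (simp add: u)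
    also have "\<dots> = (\<Sum>\<alpha>\<in>keys p. if \<alpha> = \<alpha>0 then lookup p \<alpha> * lookup q \<beta>0 else 0)"
      using k by (intro sum.cong) (auto simp: sum.delta)
    also have "\<dots> = lookup p \<alpha>0 * lookup q \<beta>0" using k by (simp add: sum.delta)
    also have "\<dots> \<noteq> 0" using k by (simp add: in_keys_iff)
    finally have "\<alpha>0 + \<beta>0 \<in> keys (p * q)" by (simp add: in_keys_iff)
    then obtain w where "w \<in> W" "lookup (\<alpha>0 + \<beta>0) w \<noteq> 0" using pq by (auto simp: var_ideal_def)
    then show False using \<alpha>0 \<beta>0 by (auto simp: F_def lookup_add)
  qed
qed

lemma var_ideal_strict_mono:
  assumes "W \<subset> W'"
  shows "(var_ideal W :: ('v::finite, 'k::field) mpoly set) \<subset> var_ideal W'"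
proof -
  obtain w where w: "w \<in> W'" "w \<notin> W" using assms by blast
  have "(xvar w :: ('v, 'k) mpoly) \<in> var_ideal W'"
    using w by (auto simp: var_ideal_def xvar_def monom_def intro!: bexI[of _ w])
  moreover have "(xvar w :: ('v, 'k) mpoly) \<notin> var_ideal W"
    using w by (auto simp: var_ideal_def xvar_def monom_def lookup_single when_def)
  moreover have "(var_ideal W :: ('v, 'k) mpoly set) \<subseteq> var_ideal W'"
    using assms by (fastforce simp: var_ideal_def)
  ultimately show ?thesis by blast
qed

text \<open>A chain with more than \<open>card W\<close> steps below \<open>var_ideal W\<close>
  could be prolonged by adjoining the other variables one at a time. The result would have more
  steps than there are variables.\<close>

lemma prime_height_var_ideal:
  "prime_height (var_ideal W :: ('v::finite, 'k::field) mpoly set) \<le> enat (card W)"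
  unfolding prime_height_def
proof (intro SUP_least)
  fix ps :: "('v, 'k) mpoly set list"
  assume "ps \<in> {ps. ps \<noteq> [] \<and> sorted_wrt (\<subset>) ps \<and> last ps = var_ideal W \<and> (\<forall>Q\<in>set ps. prime_ideal Q)}"
  then have ps: "ps \<noteq> []" "sorted_wrt (\<subset>) ps" "last ps = var_ideal W" "\<And>Q. Q \<in> set ps \<Longrightarrow> prime_ideal Q"
    by auto
  let ?n = "CARD('v)" and ?l = "length ps"
  obtain ys where ys: "set ys = - W" "distinct ys" using finite_distinct_list[of "- W"] by auto
  have len: "length ys = ?n - card W"
    using ys distinct_card[of ys] by (simp add: Compl_eq_Diff_UNIV card_Diff_subset)
  \<comment> \<open>The last member of \<open>ps\<close> is \<open>var_ideal W\<close>, so the first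
    new prime, at index \<open>?l\<close>, already contains one more variable.\<close>
  define C where "C i = (if i < ?l then ps ! i else var_ideal (W \<union> set (take (Suc i - ?l) ys)))" for i
  show "enat (?l - 1) \<le> enat (card W)"
  proof (rule ccontr)
    assume "\<not> ?thesis"
    then have big: "card W < ?l - 1" by simp
    show False
    proof (rule no_long_prime_chain[of C])
      fix i assume "i \<le> ?n + 1"
      then show "prime_ideal (C i)" using ps by (auto simp: C_def prime_ideal_var_ideal)
    next
      fix i assume i: "i < ?n + 1"
      consider "Suc i < ?l" | "Suc i = ?l" | "?l \<le> i" by linarith
      then show "C i \<subset> C (Suc i)"
      proof cases
        case 1
        then show ?thesis using ps(2) by (simp add: C_def sorted_wrt_iff_nth_less)
      next
        case 2
        then have "?l - 1 = i" by simp
        then have "C i = var_ideal (W \<union> set (take 0 ys))"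
          using ps(1,3) 2 by (simp add: C_def last_conv_nth)
        moreover have "C (Suc i) = var_ideal (W \<union> set (take 1 ys))"
          using 2 by (simp add: C_def)
        moreover have "length ys > 0" using len big i 2 by simp
        then have "W \<union> set (take 0 ys) \<subset> W \<union> set (take 1 ys)"
          using ys by (cases ys) auto
        ultimately show ?thesis using var_ideal_strict_mono by metis
      next
        case 3
        define k where "k = Suc i - ?l"
        have k: "k < length ys" using len big i 3 by (simp add: k_def)
        have "Suc (Suc i) - ?l = Suc k" using 3 by (simp add: k_def)
        then have "C i = var_ideal (W \<union> set (take k ys))" "C (Suc i) = var_ideal (W \<union> set (take (Suc k) ys))"
          using 3 by (auto simp: C_def k_def)
        moreover have "ys ! k \<notin> set (take k ys)"
          using ys(2) k by (auto simp: in_set_conv_nth distinct_conv_nth)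
        then have "W \<union> set (take k ys) \<subset> W \<union> set (take (Suc k) ys)"
          using ys(1) nth_mem[OF k] k by (auto simp: take_Suc_conv_app_nth)
        ultimately show ?thesis using var_ideal_strict_mono by metis
      qed
    qed
  qed
qed

lemma ideal_height_le_card:
  assumes "I \<subseteq> (var_ideal W :: ('v::finite, 'k::field) mpoly set)"
  shows "ideal_height I \<le> enat (card W)"
proof -
  have "ideal_height I \<le> prime_height (var_ideal W :: ('v, 'k) mpoly set)"
    unfolding ideal_height_def using assms prime_ideal_var_ideal by (intro INF_lower) auto
  then show ?thesis using prime_height_var_ideal order_trans by blast
qed

section \<open>Complete intersections of monomials\<close>

text \<open>By regularity the last coefficient of a relation is a combination of the earlier
  elements. Substituting this combination turns the relation into a shorter one, to which induction
  applies.\<close>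

lemma regular_sequence_syzygy:
  assumes "\<And>i g. i < length fs \<Longrightarrow> fs ! i * g \<in> ideal_gen (set (take i fs))
             \<Longrightarrow> g \<in> ideal_gen (set (take i fs))"
    and "(\<Sum>i<length fs. a i * fs ! i) = 0" and "i < length fs"
  shows "a i \<in> ideal_gen (set fs)"
  using assms
proof (induction fs arbitrary: a i rule: rev_induct)
  case Nil
  then show ?case by simp
next
  case (snoc f fs)
  let ?r = "length fs"
  have sum: "(\<Sum>i<?r. a i * fs ! i) + a ?r * f = 0"
    using snoc.prems(2) by (simp add: nth_append)
  have sub: "ideal_gen (set fs) \<subseteq> ideal_gen (set (fs @ [f]))"
    by (intro ideal_gen_least is_ideal_ideal_gen order_trans[OF _ ideal_gen_superset]) auto
  have "f * a ?r = (\<Sum>i<?r. (- a i) * fs ! i)"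
    using sum by (simp add: sum_negf eq_neg_iff_add_eq_0 add.commute mult.commute)
  then have "f * a ?r \<in> ideal_gen (set fs)"
    unfolding ideal_gen_list_iff by (intro exI[of _ "\<lambda>i. - a i"])
  then have ar: "a ?r \<in> ideal_gen (set fs)" using snoc.prems(1)[of ?r "a ?r"] by simp
  then obtain c where c: "a ?r = (\<Sum>i<?r. c i * fs ! i)" unfolding ideal_gen_list_iff by blast
  have "(\<Sum>i<?r. (a i + c i * f) * fs ! i) = (\<Sum>i<?r. a i * fs ! i) + (\<Sum>i<?r. c i * fs ! i) * f"
    by (simp add: distrib_right sum.distrib sum_distrib_right mult.assoc mult.commute[of f])
  then have z: "(\<Sum>i<?r. (a i + c i * f) * fs ! i) = 0" using sum c by simp
  show ?case
  proof (cases "i = ?r")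
    case True
    then show ?thesis using ar sub by blast
  next
    case False
    then have i: "i < ?r" using snoc.prems(3) by simp
    have "a i + c i * f \<in> ideal_gen (set fs)"
    proof (rule snoc.IH[OF _ z i])
      fix i g assume "i < ?r" "fs ! i * g \<in> ideal_gen (set (take i fs))"
      then show "g \<in> ideal_gen (set (take i fs))"
        using snoc.prems(1)[of i g] by (simp add: nth_append)
    qed
    moreover have "c i * f \<in> ideal_gen (set (fs @ [f]))"
      using ideal_gen_superset[of "set (fs @ [f])"] by (intro ideal_mult is_ideal_ideal_gen) auto
    ultimately have "(a i + c i * f) - c i * f \<in> ideal_gen (set (fs @ [f]))"
      using sub by (intro ideal_diff is_ideal_ideal_gen) auto
    then show ?thesis by simp
  qed
qed

lemma exp_dvd_strict_sum:
  fixes \<alpha> \<beta> :: "'v::finite \<Rightarrow>\<^sub>0 nat"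
  assumes "exp_dvd \<beta> \<alpha>" "\<beta> \<noteq> \<alpha>"
  shows "(\<Sum>v\<in>UNIV. lookup \<beta> v) < (\<Sum>v\<in>UNIV. lookup \<alpha> v)"
proof -
  have "\<exists>v. lookup \<beta> v \<noteq> lookup \<alpha> v" using assms(2) by (auto intro: poly_mapping_eqI)
  then obtain v where "lookup \<beta> v < lookup \<alpha> v" using assms(1) by (auto simp: exp_dvd_def nat_less_le)
  then show ?thesis using assms(1) by (intro sum_strict_mono_ex1) (auto simp: exp_dvd_def)
qed

lemma ex_min_gen_dvd:
  fixes I :: "('v::finite, 'k::comm_ring_1) mpoly set"
  assumes "monom \<alpha> \<in> I"
  shows "\<exists>\<mu>\<in>min_gens I. exp_dvd \<mu> \<alpha>"
  using assms
proof (induction "\<Sum>v\<in>UNIV. lookup \<alpha> v" arbitrary: \<alpha> rule: less_induct)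
  case less
  show ?case
  proof (cases "\<alpha> \<in> min_gens I")
    case False
    then obtain \<beta> where b: "exp_dvd \<beta> \<alpha>" "\<beta> \<noteq> \<alpha>" "monom \<beta> \<in> I"
      using less.prems by (auto simp: min_gens_def)
    then obtain \<mu> where "\<mu> \<in> min_gens I" "exp_dvd \<mu> \<beta>"
      using less.hyps[OF exp_dvd_strict_sum[OF b(1,2)]] by blast
    then show ?thesis using b exp_dvd_trans by blast
  qed (use exp_dvd_refl in blast)
qed

lemma min_gens_subset:
  "min_gens (ideal_gen (monom ` A) :: ('v, 'k::comm_ring_1) mpoly set) \<subseteq> A"
  unfolding min_gens_def by (auto simp: monom_mem_ideal_gen_iff) (metis exp_dvd_refl)

lemma ideal_gen_min_gens:
  fixes A :: "('v::finite \<Rightarrow>\<^sub>0 nat) set"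
  defines "J \<equiv> (ideal_gen (monom ` A) :: ('v, 'k::comm_ring_1) mpoly set)"
  shows "ideal_gen (monom ` min_gens J) = J"
proof
  have "monom ` min_gens J \<subseteq> J" by (auto simp: min_gens_def)
  then show "ideal_gen (monom ` min_gens J) \<subseteq> J"
    unfolding J_def by (intro ideal_gen_least is_ideal_ideal_gen)
  show "J \<subseteq> ideal_gen (monom ` min_gens J)"
  proof
    fix p assume "p \<in> J"
    then have "\<forall>\<alpha>\<in>keys p. monom \<alpha> \<in> J"
      unfolding J_def monom_mem_ideal_gen_iff by (simp add: mem_ideal_gen_monom_iff)
    then show "p \<in> ideal_gen (monom ` min_gens J)"
      unfolding mem_ideal_gen_monom_iff using ex_min_gen_dvd by blast
  qed
qed

text \<open>With \<gamma> the exponent of the gcd, \<open>\<alpha> = \<gamma> + \<alpha>'\<close>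
  and \<open>\<beta> = \<gamma> + \<beta>'\<close>, the two generators satisfy the relation with
  coefficients \<open>monom \<beta>'\<close> and \<open>- monom \<alpha>'\<close>. Over the regular
  sequence its coefficients must lie in \<open>J\<close>. Written back over the minimal generators,
  the coefficient at \<alpha> contains the term \<open>monom \<beta>'\<close>; so
  \<open>monom \<beta>'\<close> is in \<open>J\<close>, and minimality of \<beta> forces
  \<open>\<gamma> = 0\<close>.\<close>

lemma complete_intersection_min_gens_disjoint:
  fixes A :: "('v::finite \<Rightarrow>\<^sub>0 nat) set"
  defines "J \<equiv> (ideal_gen (monom ` A) :: ('v, 'k::comm_ring_1) mpoly set)"
  assumes "finite A" and ci: "complete_intersection J"
    and \<alpha>: "\<alpha> \<in> min_gens J" and \<beta>: "\<beta> \<in> min_gens J" and "\<alpha> \<noteq> \<beta>"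
  shows "keys \<alpha> \<inter> keys \<beta> = {}"
proof -
  let ?M = "min_gens J"
  have finM: "finite ?M" unfolding J_def using min_gens_subset \<open>finite A\<close> by (rule finite_subset)
  have J: "J = ideal_gen (monom ` ?M)" unfolding J_def by (rule ideal_gen_min_gens[symmetric])
  have idl: "is_ideal J" unfolding J_def by (rule is_ideal_ideal_gen)
  have min: "\<mu> = \<nu>" if "\<mu> \<in> ?M" "\<nu> \<in> ?M" "exp_dvd \<mu> \<nu>" for \<mu> \<nu>
    using that unfolding min_gens_def by blast
  obtain fs where fs: "regular_sequence fs" "J = ideal_gen (set fs)"
    using ci unfolding complete_intersection_def by blast
  let ?r = "length fs"
  have "\<forall>\<mu>\<in>?M. \<exists>c. monom \<mu> = (\<Sum>j<?r. c j * fs ! j)"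
  proof
    fix \<mu> assume "\<mu> \<in> ?M"
    then have "monom \<mu> \<in> ideal_gen (set fs)" unfolding fs(2)[symmetric] by (simp add: min_gens_def)
    then show "\<exists>c. monom \<mu> = (\<Sum>j<?r. c j * fs ! j)" unfolding ideal_gen_list_iff .
  qed
  then obtain C where C: "\<And>\<mu>. \<mu> \<in> ?M \<Longrightarrow> monom \<mu> = (\<Sum>j<?r. C \<mu> j * fs ! j)" by metis
  have "\<forall>j<?r. \<exists>c. fs ! j = (\<Sum>\<nu>\<in>?M. c \<nu> * monom \<nu>)"
  proof (intro allI impI)
    fix j assume "j < ?r"
    then have "fs ! j \<in> J" unfolding fs(2) using ideal_gen_superset[of "set fs"] by auto
    then have "fs ! j \<in> ideal_gen (monom ` ?M)" using J by simp
    then show "\<exists>c. fs ! j = (\<Sum>\<nu>\<in>?M. c \<nu> * monom \<nu>)" unfolding ideal_gen_image_iff[OF finM] .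
  qed
  then obtain D where D: "\<And>j. j < ?r \<Longrightarrow> fs ! j = (\<Sum>\<nu>\<in>?M. D j \<nu> * monom \<nu>)" by metis
  \<comment> \<open>The passage to the regular sequence and back. It need not be the identity
    matrix, but by minimality of the generators its constant terms are those of the identity
    (\<open>X0\<close>).\<close>
  define X where "X \<mu> \<nu> = (\<Sum>j<?r. C \<mu> j * D j \<nu>)" for \<mu> \<nu>
  have X: "monom \<mu> = (\<Sum>\<nu>\<in>?M. X \<mu> \<nu> * monom \<nu>)" if "\<mu> \<in> ?M" for \<mu>
  proof -
    have "monom \<mu> = (\<Sum>j<?r. C \<mu> j * (\<Sum>\<nu>\<in>?M. D j \<nu> * monom \<nu>))"
      using C[OF that] D by simp
    also have "\<dots> = (\<Sum>\<nu>\<in>?M. X \<mu> \<nu> * monom \<nu>)"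
      unfolding X_def sum_distrib_left sum_distrib_right mult.assoc by (rule sum.swap)
    finally show ?thesis .
  qed
  have X0: "lookup (X \<mu> \<nu>) 0 = (if \<mu> = \<nu> then 1 else 0)" if \<mu>: "\<mu> \<in> ?M" and \<nu>: "\<nu> \<in> ?M" for \<mu> \<nu>
  proof -
    have "lookup (monom \<mu>) \<nu> = (\<Sum>\<nu>'\<in>?M. lookup (X \<mu> \<nu>' * monom \<nu>') \<nu>)"
      by (subst X[OF \<mu>]) (simp add: lookup_sum)
    also have "\<dots> = (\<Sum>\<nu>'\<in>?M. if \<nu>' = \<nu> then lookup (X \<mu> \<nu>') 0 else 0)"
    proof (intro sum.cong refl)
      fix \<nu>' assume "\<nu>' \<in> ?M"
      then have "exp_dvd \<nu>' \<nu> \<longleftrightarrow> \<nu>' = \<nu>" using min[of \<nu>' \<nu>] \<nu> by auto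
      then show "lookup (X \<mu> \<nu>' * monom \<nu>') \<nu> = (if \<nu>' = \<nu> then lookup (X \<mu> \<nu>') 0 else 0)"
        by (simp add: monom_def mult.commute[of "X \<mu> \<nu>'"] lookup_single_mult)
    qed
    also have "\<dots> = lookup (X \<mu> \<nu>) 0" using finM \<nu> by simp
    finally show ?thesis by (simp add: monom_def lookup_single when_def)
  qed
  define \<gamma> where "\<gamma> = Abs_poly_mapping (\<lambda>v. min (lookup \<alpha> v) (lookup \<beta> v))"
  have lg: "lookup \<gamma> v = min (lookup \<alpha> v) (lookup \<beta> v)" for v by (simp add: \<gamma>_def)
  have dv: "exp_dvd \<gamma> \<alpha>" "exp_dvd \<gamma> \<beta>" by (auto simp: exp_dvd_def lg)
  define \<alpha>' \<beta>' where "\<alpha>' = \<alpha> - \<gamma>" and "\<beta>' = \<beta> - \<gamma>"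
  have ab: "\<alpha> = \<gamma> + \<alpha>'" "\<beta> = \<gamma> + \<beta>'" using dv by (simp_all add: \<alpha>'_def \<beta>'_def exp_dvd_add_diff)
  define a where "a j = monom \<beta>' * C \<alpha> j - monom \<alpha>' * C \<beta> j" for j
  have "(\<Sum>j<?r. a j * fs ! j)
      = monom \<beta>' * (\<Sum>j<?r. C \<alpha> j * fs ! j) - monom \<alpha>' * (\<Sum>j<?r. C \<beta> j * fs ! j)"
    by (simp add: a_def left_diff_distrib sum_subtractf sum_distrib_left mult.assoc)
  also have "\<dots> = monom \<beta>' * monom \<alpha> - monom \<alpha>' * monom \<beta>"
    by (simp only: C[OF \<alpha>, symmetric] C[OF \<beta>, symmetric])
  also have "\<dots> = 0" by (simp add: ab monom_def mult_single add_ac)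
  finally have "(\<Sum>j<?r. a j * fs ! j) = 0" .
  then have aJ: "a j \<in> J" if "j < ?r" for j
    using regular_sequence_syzygy[of fs a j] fs that unfolding regular_sequence_def by blast
  have "(\<Sum>j<?r. D j \<alpha> * a j) \<in> J" using aJ by (intro ideal_sum ideal_mult idl) auto
  also have "(\<Sum>j<?r. D j \<alpha> * a j) = monom \<beta>' * X \<alpha> \<alpha> - monom \<alpha>' * X \<beta> \<alpha>"
    by (simp add: a_def X_def right_diff_distrib sum_subtractf sum_distrib_left mult_ac)
  finally have inJ: "monom \<beta>' * X \<alpha> \<alpha> - monom \<alpha>' * X \<beta> \<alpha> \<in> J" .
  \<comment> \<open>Hence the second product has no term at \<open>\<beta>'\<close>, and the
    coefficient there is the constant term of \<open>X \<alpha> \<alpha>\<close>, which is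
    1.\<close>
  have "\<not> exp_dvd \<alpha>' \<beta>'"
  proof
    assume "exp_dvd \<alpha>' \<beta>'"
    then have "exp_dvd \<alpha> \<beta>" by (simp add: ab exp_dvd_def lookup_add)
    then show False using min[OF \<alpha> \<beta>] \<open>\<alpha> \<noteq> \<beta>\<close> by simp
  qed
  then have "lookup (monom \<beta>' * X \<alpha> \<alpha> - monom \<alpha>' * X \<beta> \<alpha>) \<beta>' = 1"
    using X0[OF \<alpha> \<alpha>] by (simp add: lookup_minus monom_def lookup_single_mult)
  then have "\<beta>' \<in> keys (monom \<beta>' * X \<alpha> \<alpha> - monom \<alpha>' * X \<beta> \<alpha>)" by (simp add: in_keys_iff)
  then have "\<exists>a\<in>A. exp_dvd a \<beta>'"
    using inJ[unfolded J_def mem_ideal_gen_monom_iff, rule_format, of \<beta>'] by simp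
  then have "monom \<beta>' \<in> J" unfolding J_def monom_mem_ideal_gen_iff .
  moreover have "exp_dvd \<beta>' \<beta>" by (simp add: ab exp_dvd_def lookup_add)
  ultimately have "\<beta>' = \<beta>" using \<beta> unfolding min_gens_def by blast
  then have "\<gamma> = 0" using ab(2) by simp
  then have "lookup \<alpha> v = 0 \<or> lookup \<beta> v = 0" for v
    using lg[of v] by (simp add: min_def split: if_splits)
  then show ?thesis by (force simp: in_keys_iff)
qed

text \<open>A monomial coprime to \<open>ms ! i\<close> that divides a multiple of it divides the
  cofactor, so every enumeration of \<open>M\<close> is a regular sequence. The condition
  \<open>0 \<notin> M\<close> keeps the ideal proper.\<close>

lemma complete_intersection_disjoint:
  fixes M :: "('v \<Rightarrow>\<^sub>0 nat) set"
  assumes "finite M" "0 \<notin> M"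
    and disj: "\<And>\<alpha> \<beta>. \<alpha> \<in> M \<Longrightarrow> \<beta> \<in> M \<Longrightarrow> \<alpha> \<noteq> \<beta> \<Longrightarrow> keys \<alpha> \<inter> keys \<beta> = {}"
  shows "complete_intersection (ideal_gen (monom ` M) :: ('v, 'k::comm_ring_1) mpoly set)"
proof -
  obtain ms where ms: "set ms = M" "distinct ms" using finite_distinct_list[OF assms(1)] by blast
  let ?fs = "map monom ms :: ('v, 'k) mpoly list"
  have "regular_sequence ?fs"
    unfolding regular_sequence_def
  proof (intro conjI allI impI)
    fix i and g :: "('v, 'k) mpoly"
    assume i: "i < length ?fs" and m: "?fs ! i * g \<in> ideal_gen (set (take i ?fs))"
    have st: "set (take i ?fs) = monom ` set (take i ms)" by (simp add: take_map)
    have m': "monom (ms ! i) * g \<in> ideal_gen (monom ` set (take i ms))"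
      using m i unfolding st by simp
    show "g \<in> ideal_gen (set (take i ?fs))"
      unfolding st mem_ideal_gen_monom_iff
    proof
      fix \<alpha> assume "\<alpha> \<in> keys g"
      then have "ms ! i + \<alpha> \<in> keys (monom (ms ! i) * g)"
        by (simp add: in_keys_iff monom_def lookup_single_mult_add)
      then obtain a where a: "a \<in> set (take i ms)" "exp_dvd a (ms ! i + \<alpha>)"
        using m' unfolding mem_ideal_gen_monom_iff by blast
      obtain j where j: "j < i" "a = ms ! j" using a(1) i by (auto simp: in_set_conv_nth)
      then have "a \<noteq> ms ! i" using ms(2) i by (auto simp: distinct_conv_nth)
      then have d: "keys a \<inter> keys (ms ! i) = {}" using disj[of a "ms ! i"] j i ms(1) by auto
      have "lookup a v \<le> lookup \<alpha> v" for v
      proof (cases "lookup a v = 0")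
        case False
        then have "lookup (ms ! i) v = 0" using d by (auto simp: in_keys_iff)
        then show ?thesis using a(2) by (auto simp: exp_dvd_def lookup_add dest: spec[of _ v])
      qed simp
      then show "\<exists>a\<in>set (take i ms). exp_dvd a \<alpha>" using a(1) by (auto simp: exp_dvd_def)
    qed
  next
    have "\<not> exp_dvd a 0" if "a \<in> M" for a
      using that assms(2) exp_dvd_antisym[of a 0] by (metis exp_dvd_add add.left_neutral)
    then have "monom 0 \<notin> ideal_gen (monom ` M :: ('v, 'k) mpoly set)"
      unfolding monom_mem_ideal_gen_iff by blast
    then show "1 \<notin> ideal_gen (set ?fs)" using ms(1) by (simp add: monom_def)
  qed
  then show ?thesis unfolding complete_intersection_def using ms(1)
    by (intro exI[of _ ?fs]) simp
qed

section \<open>Complexes whose links are complete intersections\<close>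

text \<open>Stated for an arbitrary predicate because it serves both for the minimal nonfaces, which
  are the minimal generators of \<open>I\<close>, and for those after \<open>x = 1\<close>, where
  the predicate is \<open>\<lambda>X. nonface (insert x X)\<close>.\<close>

definition minimal_set :: "('v set \<Rightarrow> bool) \<Rightarrow> 'v set \<Rightarrow> bool" where
  "minimal_set P X \<longleftrightarrow> P X \<and> (\<forall>Y. Y \<subset> X \<longrightarrow> \<not> P Y)"

lemma ex_minimal_set: "finite X \<Longrightarrow> P X \<Longrightarrow> \<exists>Y\<subseteq>X. minimal_set P Y"
proof (induction X rule: finite_psubset_induct)
  case (psubset X)
  then show ?case unfolding minimal_set_def by (metis order_refl psubset_imp_subset subset_trans)
qed

text \<open>\<open>nonface X\<close> stands for $\prod_{v \in X} x_v \in I$. The axiom \<open>link_disjoint\<close> says that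
  $I(x = 1)$ is a complete intersection, \<open>not_disjoint\<close> that \<open>I\<close> is not.\<close>

locale nci_complex =
  fixes V :: "'v::finite set" and nonface :: "'v set \<Rightarrow> bool"
  assumes nonface_mono: "nonface X \<Longrightarrow> X \<subseteq> Y \<Longrightarrow> nonface Y"
    and minimal_subset: "minimal_set nonface X \<Longrightarrow> X \<subseteq> V"
    and minimal_card: "minimal_set nonface X \<Longrightarrow> 2 \<le> card X"
    and link_disjoint: "x \<in> V \<Longrightarrow> minimal_set (\<lambda>X. nonface (insert x X)) X
      \<Longrightarrow> minimal_set (\<lambda>X. nonface (insert x X)) Y \<Longrightarrow> X \<noteq> Y \<Longrightarrow> X \<inter> Y = {}"
    and not_disjoint: "\<exists>X Y. minimal_set nonface X \<and> minimal_set nonface Y \<and> X \<noteq> Y \<and> X \<inter> Y \<noteq> {}"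
begin

definition adj :: "'v \<Rightarrow> 'v \<Rightarrow> bool" where
  "adj u v \<longleftrightarrow> u \<in> V \<and> v \<in> V \<and> u \<noteq> v \<and> \<not> nonface {u, v}"

lemma adj_sym: "adj u v \<Longrightarrow> adj v u"
  by (auto simp: adj_def insert_commute)

lemma adj_V: "adj u v \<Longrightarrow> u \<in> V \<and> v \<in> V" and adj_neq: "adj u v \<Longrightarrow> u \<noteq> v"
  by (auto simp: adj_def)

lemma nonface_card: "nonface X \<Longrightarrow> 2 \<le> card X"
  by (metis card_mono ex_minimal_set finite le_trans minimal_card)

lemma not_nonface_singleton [simp]: "\<not> nonface {x}" "\<not> nonface {}"
  using nonface_card by fastforce+

text \<open>Both \<open>{x, a}\<close> and \<open>{x, b}\<close> would be minimal nonfaces of the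
  link of \<open>v\<close>, and they share \<open>x\<close>. This is the statement that
  non-adjacency is a matching on each neighbourhood.\<close>

lemma no_claw:
  assumes adj: "adj v x" "adj v a" "adj v b" and ne: "a \<noteq> b" "x \<noteq> a" "x \<noteq> b"
  shows "\<not> (nonface {x, a} \<and> nonface {x, b})"
proof
  assume nf: "nonface {x, a} \<and> nonface {x, b}"
  have m: "minimal_set (\<lambda>X. nonface (insert v X)) {x, c}"
    if "nonface {x, c}" "adj v c" "x \<noteq> c" for c
    unfolding minimal_set_def
  proof (intro conjI allI impI notI)
    show "nonface (insert v {x, c})" using nonface_mono[OF that(1)] by blast
    fix Y assume Y: "Y \<subset> {x, c}" "nonface (insert v Y)"
    then consider "insert v Y \<subseteq> {v, x}" | "insert v Y \<subseteq> {v, c}" by blast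
    then show False using Y(2) nonface_mono adj(1) that(2) unfolding adj_def by cases blast+
  qed
  have "{x, a} \<inter> {x, b} = {}"
    using m[of a] m[of b] nf adj ne by (intro link_disjoint[of v]) (auto simp: adj_def doubleton_eq_iff)
  then show False by simp
qed

lemma minimal_link:
  assumes "minimal_set nonface X" "w \<in> X"
  shows "minimal_set (\<lambda>X. nonface (insert w X)) (X - {w})"
  unfolding minimal_set_def
proof (intro conjI allI impI notI)
  show "nonface (insert w (X - {w}))" using assms by (simp add: minimal_set_def insert_absorb)
  fix Y assume Y: "Y \<subset> X - {w}" "nonface (insert w Y)"
  then have "insert w Y \<subset> X" using assms(2) by blast
  then show False using assms(1) Y(2) unfolding minimal_set_def by blast
qed

text \<open>In the link of a common vertex \<open>w\<close> the sets \<open>X - {w}\<close> and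
  \<open>Y - {w}\<close> are distinct and minimal, hence disjoint.\<close>

lemma minimal_inter:
  assumes "minimal_set nonface X" "minimal_set nonface Y" "X \<noteq> Y" "x \<in> X \<inter> Y" "w \<in> X \<inter> Y"
  shows "w = x"
proof (rule ccontr)
  assume "w \<noteq> x"
  have "(X - {w}) \<inter> (Y - {w}) = {}"
    using assms minimal_link[of X w] minimal_link[of Y w] minimal_subset[of X]
    by (intro link_disjoint[of w]) auto
  then show False using assms \<open>w \<noteq> x\<close> by blast
qed

text \<open>This makes the failure to be a complete intersection visible in the graph. Two
  intersecting minimal nonfaces of size two show it directly. If one of them, \<open>X\<close>, is
  larger, the links of two of its vertices \<open>x\<close> and \<open>y\<close> are used in turn to
  produce a vertex \<open>z\<close> of \<open>Y\<close> that is adjacent to neither.\<close>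

lemma ex_vertex_with_two_nonneighbours:
  "\<exists>z x y. z \<in> V \<and> x \<in> V \<and> y \<in> V \<and> z \<noteq> x \<and> z \<noteq> y \<and> x \<noteq> y \<and> nonface {z, x} \<and> nonface {z, y}"
proof -
  have big: ?thesis
    if X: "minimal_set nonface X" and Y: "minimal_set nonface Y" and ne: "X \<noteq> Y"
      and x: "x \<in> X \<inter> Y" and c: "3 \<le> card X" for X Y x
  proof -
    have XV: "X \<subseteq> V" and YV: "Y \<subseteq> V" using X Y minimal_subset by auto
    have "\<not> X \<subseteq> {x}" using c card_mono[of "{x}" X] by auto
    then obtain y where y: "y \<in> X" "y \<noteq> x" by blast
    have yY: "y \<notin> Y" using minimal_inter[OF X Y ne x] y by blast
    let ?Ly = "\<lambda>Z. nonface (insert y Z)"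
    have my: "minimal_set ?Ly (X - {y})" using minimal_link[OF X] y by blast
    have "?Ly Y" using Y nonface_mono[of Y "insert y Y"] unfolding minimal_set_def by auto
    \<comment> \<open>In the link of \<open>y\<close> the set \<open>F\<close> is disjoint from
      \<open>X - {y}\<close>, so it avoids \<open>x\<close> and is a proper part of
      \<open>Y\<close>. A minimal nonface \<open>G\<close> inside \<open>insert y F\<close> must
      therefore contain \<open>y\<close>; it meets \<open>Y\<close> in one vertex \<open>z\<close>,
      so \<open>G = {y, z}\<close>.\<close>
    then obtain F where F: "F \<subseteq> Y" "minimal_set ?Ly F" using ex_minimal_set[of Y ?Ly] by auto
    have cy: "2 \<le> card (X - {y})" using c y by simp
    have "X - {y} \<noteq> F"
    proof
      assume "X - {y} = F"
      then have "X - {y} \<subseteq> {x}" using F minimal_inter[OF X Y ne x] by blast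
      then show False using cy card_mono[of "{x}" "X - {y}"] by auto
    qed
    then have "(X - {y}) \<inter> F = {}" using link_disjoint[of y, OF _ my F(2)] y XV by blast
    then have xF: "x \<notin> F" using x y by blast
    obtain G where G: "G \<subseteq> insert y F" "minimal_set nonface G"
      using ex_minimal_set[of "insert y F" nonface] F(2) unfolding minimal_set_def by auto
    have "y \<in> G"
    proof (rule ccontr)
      assume "y \<notin> G"
      then have "G \<subset> Y" using G F xF x by blast
      then show False using Y G unfolding minimal_set_def by blast
    qed
    obtain z where z: "z \<in> G" "z \<noteq> y"
    proof -
      have "\<not> G \<subseteq> {y}" using minimal_card[OF G(2)] card_mono[of "{y}" G] by auto
      then show ?thesis using that by blast
    qed
    have zY: "z \<in> Y" "z \<noteq> x" using z G F xF by auto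
    have zX: "z \<notin> X" using minimal_inter[OF X Y ne x] zY by blast
    have "G \<noteq> Y" using \<open>y \<in> G\<close> yY by blast
    have "G \<subseteq> {y, z}"
    proof
      fix w assume w: "w \<in> G"
      show "w \<in> {y, z}"
      proof (cases "w = y")
        case False
        then have "w \<in> G \<inter> Y" using w G F by blast
        then show ?thesis using minimal_inter[OF G(2) Y \<open>G \<noteq> Y\<close>, of z w] z zY by blast
      qed simp
    qed
    then have yz: "nonface {y, z}" using G(2) nonface_mono[of G "{y, z}"] unfolding minimal_set_def by simp
    \<comment> \<open>The same argument in the link of \<open>x\<close>, now with
      \<open>{y, z}\<close> in place of \<open>Y\<close>: the minimal set found there avoids
      \<open>y\<close>, which leaves the nonface \<open>{x, z}\<close>.\<close>
    let ?Lx = "\<lambda>Z. nonface (insert x Z)"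
    have mx: "minimal_set ?Lx (X - {x})" using minimal_link[OF X] x by blast
    have "?Lx {y, z}" using nonface_mono[OF yz] by auto
    then obtain K where K: "K \<subseteq> {y, z}" "minimal_set ?Lx K" using ex_minimal_set[of "{y, z}" ?Lx] by auto
    have "X - {x} \<noteq> K"
    proof
      assume "X - {x} = K"
      then have "X - {x} \<subseteq> {y}" using K zX by blast
      then have "card (X - {x}) \<le> 1" using card_mono[of "{y}" "X - {x}"] by auto
      moreover have "2 \<le> card (X - {x})" using c x by simp
      ultimately show False by simp
    qed
    then have "(X - {x}) \<inter> K = {}" using link_disjoint[of x, OF _ mx K(2)] x XV by blast
    then have "K \<subseteq> {z}" using K y by blast
    then have "nonface {x, z}" using K(2) nonface_mono[of "insert x K" "{x, z}"] unfolding minimal_set_def by auto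
    then show ?thesis using yz zY zX y x XV YV
      by (intro exI[of _ z] exI[of _ x] exI[of _ y]) (auto simp: insert_commute)
  qed
  obtain X Y x where XY: "minimal_set nonface X" "minimal_set nonface Y" "X \<noteq> Y" "x \<in> X \<inter> Y"
    using not_disjoint by blast
  show ?thesis
  proof (cases "3 \<le> card X \<or> 3 \<le> card Y")
    case True
    then show ?thesis using big[of X Y x] big[of Y X x] XY by blast
  next
    case False
    then have c: "card X = 2" "card Y = 2" using minimal_card XY by (auto simp: le_antisym)
    obtain a where a: "X = {x, a}" "a \<noteq> x" using c(1) XY(4) by (auto simp: card_2_iff)
    obtain b where b: "Y = {x, b}" "b \<noteq> x" using c(2) XY(4) by (auto simp: card_2_iff)
    have "nonface {x, a}" "nonface {x, b}" "X \<subseteq> V" "Y \<subseteq> V"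
      using XY a b minimal_subset unfolding minimal_set_def by auto
    then show ?thesis using a b XY(3) by (intro exI[of _ x] exI[of _ a] exI[of _ b]) auto
  qed
qed

section \<open>Degrees and edges of a connected 1-skeleton\<close>

definition connected :: bool where
  "connected \<longleftrightarrow> (\<forall>A\<subseteq>V. A \<noteq> {} \<longrightarrow> (\<forall>u\<in>A. \<forall>v. adj u v \<longrightarrow> v \<in> A) \<longrightarrow> A = V)"

definition nbrs :: "'v \<Rightarrow> 'v set" where
  "nbrs v = {u. adj v u}"

lemma nonadj_iff: "u \<in> V \<Longrightarrow> v \<in> V \<Longrightarrow> u \<noteq> v \<Longrightarrow> \<not> adj u v \<longleftrightarrow> nonface {u, v}"
  by (auto simp: adj_def)

lemma claw:
  assumes "adj v x" "adj v a" "adj v b" "a \<noteq> b" "x \<noteq> a" "x \<noteq> b" "\<not> adj x a"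
  shows "adj x b"
  using no_claw[OF assms(1-6)] assms adj_V nonadj_iff by metis

text \<open>At a common neighbour \<open>r\<close> of \<open>v\<close> and \<open>w\<close>, these
  two are a matched non-adjacent pair, so every further neighbour of \<open>r\<close> is adjacent to
  both (\<open>others\<close>). If \<open>t\<close> is adjacent to \<open>u\<close>, take
  \<open>r = u\<close>. Otherwise a third neighbour \<open>r\<close> of \<open>v\<close> is adjacent
  to both \<open>u\<close> and \<open>t\<close>; \<open>others\<close> at \<open>u\<close> gives
  that \<open>r\<close> is adjacent to \<open>w\<close>, and \<open>others\<close> at
  \<open>r\<close> gives the same for \<open>t\<close>. The degree hypothesis provides this third
  neighbour.\<close>

lemma distance_two_adjacent:
  assumes deg: "3 \<le> card (nbrs v)" and w: "adj v u" "adj u w" "w \<noteq> v" "\<not> adj v w" and t: "adj v t"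
  shows "adj t w"
proof -
  have others: "adj s w \<and> adj s v" if "adj r v" "adj r w" "adj r s" "s \<noteq> v" "s \<noteq> w" for r s
    using claw[of r v w s] claw[of r w v s] that w(3,4) adj_sym by metis
  have "\<not> nbrs v \<subseteq> {u, s}" for s
    using deg card_mono[of "{u, s}" "nbrs v"] card_insert_le_m1[of 2 "{s}" u] by force
  \<comment> \<open>The choice term denotes the neighbour of \<open>v\<close> not adjacent to
    \<open>u\<close>, if there is one; by \<open>claw\<close> there is at most one. Avoiding it
    makes \<open>r\<close> adjacent to \<open>u\<close>.\<close>
  then obtain r where r: "adj v r" "r \<noteq> u" "r \<noteq> (SOME s. adj v s \<and> s \<noteq> u \<and> \<not> adj u s)"
    unfolding nbrs_def by blast
  have ur: "adj u r"
  proof (rule ccontr)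
    assume nur: "\<not> adj u r"
    let ?s = "SOME s. adj v s \<and> s \<noteq> u \<and> \<not> adj u s"
    have "adj v ?s \<and> ?s \<noteq> u \<and> \<not> adj u ?s" using someI[of "\<lambda>s. adj v s \<and> s \<noteq> u \<and> \<not> adj u s" r] r nur by blast
    then show False using claw[of v u r ?s] w(1) r nur by metis
  qed
  have tw: "t \<noteq> w" using t w(4) by blast
  show ?thesis
  proof (cases "t = u")
    case True
    then show ?thesis using w by blast
  next
    case False
    show ?thesis
    proof (cases "adj u t")
      case True
      then show ?thesis using others[of u t] w t tw adj_sym adj_neq by metis
    next
      case nut: False
      have rw: "adj r w" using others[of u r] w r ur adj_sym adj_neq by metis
      have "r \<noteq> t" using ur nut by blast
      have "adj r t"
        using claw[of v t u r] t w(1) r False nut \<open>r \<noteq> t\<close> adj_sym by metis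
      then show ?thesis using others[of r t] r(1) rw t tw adj_sym adj_neq by metis
    qed
  qed
qed

text \<open>A vertex of degree at least 3 would be within distance two of everything, and then
  non-adjacency would be a matching on all of \<open>V\<close>. That contradicts the existence of a
  vertex with two non-neighbours.\<close>

lemma connected_degree_le_2:
  assumes conn: connected and v: "v \<in> V"
  shows "card (nbrs v) \<le> 2"
proof (rule ccontr)
  assume "\<not> ?thesis"
  then have deg: "3 \<le> card (nbrs v)" by simp
  define A where "A = insert v (nbrs v \<union> {w. \<exists>u. adj v u \<and> adj u w})"
  \<comment> \<open>The vertex \<open>w\<close> is adjacent to all neighbours of \<open>v\<close>,
    so it also has degree at least 3 and the roles of \<open>v\<close> and \<open>w\<close> can be
    exchanged.\<close>
  have far: "adj v s" if w: "adj v u" "adj u w" "w \<noteq> v" "\<not> adj v w" and s: "adj w s" for u w s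
  proof -
    have "nbrs v \<subseteq> nbrs w"
      using distance_two_adjacent[OF deg w] adj_sym unfolding nbrs_def by blast
    then have "card (nbrs v) \<le> card (nbrs w)" by (intro card_mono) auto
    then have "3 \<le> card (nbrs w)" using deg by simp
    then have "adj s v" using distance_two_adjacent[of w u v s] w s adj_sym by metis
    then show ?thesis by (rule adj_sym)
  qed
  have "A \<subseteq> V" using v adj_V unfolding A_def nbrs_def by blast
  moreover have "\<forall>u\<in>A. \<forall>s. adj u s \<longrightarrow> s \<in> A"
    using far unfolding A_def nbrs_def by blast
  ultimately have AV: "A = V" using conn unfolding connected_def A_def by blast
  have matching: "x = y" if h: "z \<in> V" "x \<in> V" "y \<in> V" "z \<noteq> x" "z \<noteq> y" "\<not> adj z x" "\<not> adj z y" for x y z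
  proof (rule ccontr)
    assume "x \<noteq> y"
    have cases_A: "a = v \<or> adj v a \<or> (a \<noteq> v \<and> \<not> adj v a \<and> (\<exists>u. adj v u \<and> adj u a))" if "a \<in> V" for a
      using that AV unfolding A_def nbrs_def by blast
    \<comment> \<open>Two non-neighbours of \<open>v\<close> would both be adjacent to the same
      neighbour \<open>u\<close> of \<open>v\<close>, and in the neighbourhood of \<open>u\<close>
      they would both be matched with \<open>v\<close>.\<close>
    have uniq: "a = b" if h: "a \<in> V" "b \<in> V" "a \<noteq> v" "b \<noteq> v" "\<not> adj v a" "\<not> adj v b" for a b
    proof (rule ccontr)
      assume "a \<noteq> b"
      obtain u where u: "adj v u" "adj u a" using cases_A[of a] h by blast
      obtain u' where u': "adj v u'" "adj u' b" using cases_A[of b] h by blast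
      have "adj u b" using distance_two_adjacent[OF deg u' _ _ u(1)] h by blast
      then show False using claw[of u v a b] u h \<open>a \<noteq> b\<close> adj_sym by metis
    qed
    consider "z = v" | "adj v z" | "z \<noteq> v" "\<not> adj v z" by blast
    then show False
    proof cases
      case 1
      then show False using uniq[of x y] h 1 \<open>x \<noteq> y\<close> by blast
    next
      case 2
      have "adj v a" if "a \<in> V" "z \<noteq> a" "\<not> adj z a" for a
        using cases_A[OF that(1)] distance_two_adjacent[OF deg _ _ _ _ 2] that 2 adj_sym by metis
      then show False using claw[of v z x y] 2 h \<open>x \<noteq> y\<close> by blast
    next
      case 3
      then obtain u where u: "adj v u" "adj u z" using cases_A[of z] h by blast
      have "\<not> adj v a" if "\<not> adj z a" for a
        using distance_two_adjacent[OF deg u 3, of a] that adj_sym by blast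
      then have "x = v \<or> x = z" "y = v \<or> y = z" using uniq[of x z] uniq[of y z] h 3 by blast+
      then show False using h \<open>x \<noteq> y\<close> by blast
    qed
  qed
  obtain z x y where "z \<in> V" "x \<in> V" "y \<in> V" "z \<noteq> x" "z \<noteq> y" "x \<noteq> y" "nonface {z, x}" "nonface {z, y}"
    using ex_vertex_with_two_nonneighbours by blast
  then show False using matching[of z x y] nonadj_iff by blast
qed

definition edges :: "'v set set" where
  "edges = {e. \<exists>u v. e = {u, v} \<and> adj u v}"

lemma edges_subset: "e \<in> edges \<Longrightarrow> e \<subseteq> V \<and> card e = 2"
  using adj_V adj_neq unfolding edges_def by (fastforce simp: card_2_iff)

lemma sum_degrees: "(\<Sum>v\<in>V. card (nbrs v)) = 2 * card edges"
proof -
  have "card {e \<in> edges. v \<in> e} = card (nbrs v)" for v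
  proof -
    have "{e \<in> edges. v \<in> e} = (\<lambda>u. {v, u}) ` nbrs v"
      using adj_sym unfolding edges_def nbrs_def by auto
    moreover have "inj_on (\<lambda>u. {v, u}) (nbrs v)" by (auto simp: inj_on_def doubleton_eq_iff)
    ultimately show ?thesis by (simp add: card_image)
  qed
  moreover have "(\<Sum>v\<in>V. card {e \<in> edges. v \<in> e}) = (\<Sum>e\<in>edges. 2)"
  proof (rule sum_multicount_gen)
    show "\<forall>e\<in>edges. card {v \<in> V. v \<in> e} = 2"
    proof
      fix e assume "e \<in> edges"
      then have "{v \<in> V. v \<in> e} = e" "card e = 2" using edges_subset by auto
      then show "card {v \<in> V. v \<in> e} = 2" by simp
    qed
  qed auto
  ultimately show ?thesis by simp
qed

text \<open>Everything comes from a vertex \<open>z\<close> with two non-neighbours and, by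
  connectedness, a neighbour, combined with the degree bound. A triangle would be closed under
  adjacency and so be all of \<open>V\<close>, which has at least four elements.\<close>

lemma connected_structure:
  assumes conn: connected
  shows "4 \<le> card V" "card edges \<le> card V" "card V = 4 \<Longrightarrow> card edges \<le> 3" "edges \<noteq> {}"
    and "a \<in> V \<Longrightarrow> b \<in> V \<Longrightarrow> c \<in> V \<Longrightarrow> a \<noteq> b \<Longrightarrow> a \<noteq> c \<Longrightarrow> b \<noteq> c
      \<Longrightarrow> nonface {a, b} \<or> nonface {a, c} \<or> nonface {b, c}"
proof -
  obtain z x y where z: "z \<in> V" "x \<in> V" "y \<in> V" "z \<noteq> x" "z \<noteq> y" "x \<noteq> y" "nonface {z, x}" "nonface {z, y}"
    using ex_vertex_with_two_nonneighbours by blast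
  have nz: "\<not> adj z x" "\<not> adj z y" using z by (auto simp: adj_def)
  have "{z} \<noteq> V" using z by blast
  then obtain t where t: "adj z t" using conn z(1) unfolding connected_def by blast
  then have tV: "t \<in> V" "t \<noteq> z" "t \<noteq> x" "t \<noteq> y" using nz adj_V adj_neq by blast+
  have "card {z, x, y, t} = 4" using z tV by auto
  moreover have "{z, x, y, t} \<subseteq> V" using z tV by blast
  ultimately show n4: "4 \<le> card V" using card_mono[of V "{z, x, y, t}"] by simp
  have "2 * card edges \<le> (\<Sum>v\<in>V. 2)"
    unfolding sum_degrees[symmetric] using connected_degree_le_2[OF conn] by (intro sum_mono) auto
  then show "card edges \<le> card V" by simp
  \<comment> \<open>On four vertices \<open>z\<close> has degree at most 1, so the degrees sum to at
    most 7. This is what excludes the quadrilateral.\<close>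
  show "card edges \<le> 3" if n: "card V = 4"
  proof -
    have "nbrs z \<subseteq> V - {z, x, y}" using nz adj_V adj_neq unfolding nbrs_def by blast
    then have "card (nbrs z) \<le> card (V - {z, x, y})" by (intro card_mono) auto
    also have "\<dots> = 1" using n z by (subst card_Diff_subset) auto
    finally have "card (nbrs z) \<le> 1" .
    moreover have "(\<Sum>v\<in>V - {z}. card (nbrs v)) \<le> (\<Sum>v\<in>V - {z}. 2)"
      using connected_degree_le_2[OF conn] by (intro sum_mono) auto
    ultimately have "(\<Sum>v\<in>V. card (nbrs v)) \<le> 1 + 2 * 3"
      using z(1) n by (simp add: sum.remove[of V z])
    then show ?thesis unfolding sum_degrees by simp
  qed
  show "edges \<noteq> {}" using t unfolding edges_def by blast
  show "nonface {a, b} \<or> nonface {a, c} \<or> nonface {b, c}"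
    if V: "a \<in> V" "b \<in> V" "c \<in> V" and ne: "a \<noteq> b" "a \<noteq> c" "b \<noteq> c"
  proof (rule ccontr)
    assume "\<not> ?thesis"
    then have ad: "adj a b" "adj a c" "adj b c" using V ne by (auto simp: adj_def)
    have full: "nbrs p = {q, r}" if "adj p q" "adj p r" "q \<noteq> r" for p q r
    proof -
      have "{q, r} \<subseteq> nbrs p" using that by (auto simp: nbrs_def)
      moreover have "card (nbrs p) \<le> card {q, r}"
        using connected_degree_le_2[OF conn, of p] adj_V[OF that(1)] that(3) by simp
      ultimately show ?thesis using card_seteq[of "nbrs p" "{q, r}"] by simp
    qed
    have "nbrs a = {b, c}" "nbrs b = {a, c}" "nbrs c = {a, b}"
      using full[of a b c] full[of b a c] full[of c a b] ad ne adj_sym by blast+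
    then have "\<forall>u\<in>{a, b, c}. \<forall>v. adj u v \<longrightarrow> v \<in> {a, b, c}" unfolding nbrs_def by blast
    moreover have "{a, b, c} \<subseteq> V" "{a, b, c} \<noteq> {}" using V by auto
    ultimately have "{a, b, c} = V" using conn unfolding connected_def by blast
    moreover have "card {a, b, c} \<le> 3" by (simp add: card_insert_le_m1)
    ultimately show False using n4 by simp
  qed
qed

end

section \<open>The Koszul complex\<close>

text \<open>An arbitrary fixed enumeration of the variables, which orders the exterior generators
  and so determines the Koszul signs.\<close>

definition vidx :: "'v::finite \<Rightarrow> nat" where
  "vidx = (SOME f. inj f)"

lemma inj_vidx: "inj (vidx :: 'v::finite \<Rightarrow> nat)"
proof -
  have "\<exists>f :: 'v \<Rightarrow> nat. inj f" using finite_imp_inj_to_nat_seg[of "UNIV :: 'v set"] by auto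
  then show ?thesis unfolding vidx_def by (rule someI_ex)
qed

text \<open>The sign of moving \<open>e_v\<close> past the smaller generators in \<open>e_A\<close>.
  The result type is left open because the same sign is used in the polynomial ring and, after
  taking coefficients, in the field.\<close>

definition ksign :: "'v::finite \<Rightarrow> 'v set \<Rightarrow> 'a::comm_ring_1" where
  "ksign v A = (- 1) ^ card {u \<in> A. vidx u < vidx v}"

lemma ksign_empty [simp]: "ksign v {} = 1"
  by (simp add: ksign_def)

lemma ksign_square [simp]: "ksign v A * ksign v A = 1"
  by (simp add: ksign_def power_mult_distrib[symmetric])

lemma ksign_square' [simp]: "ksign v A * (ksign v A * x) = x"
  by (simp add: mult.assoc[symmetric])

lemma ksign_insert:
  assumes "u \<notin> A"
  shows "ksign v (insert u A) = (if vidx u < vidx v then - ksign v A else ksign v A)"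
proof -
  have "{w \<in> insert u A. vidx w < vidx v}
      = (if vidx u < vidx v then insert u {w \<in> A. vidx w < vidx v} else {w \<in> A. vidx w < vidx v})"
    by auto
  then show ?thesis using assms by (simp add: ksign_def)
qed

lemma ksign_swap:
  assumes "u \<noteq> v" "u \<notin> A" "v \<notin> A"
  shows "ksign u (insert v A) * ksign v (insert u A) = - (ksign u A * ksign v A)"
proof -
  have "vidx u \<noteq> vidx v" using assms(1) inj_vidx by (auto dest: injD)
  then consider "vidx u < vidx v" | "vidx v < vidx u" by linarith
  then show ?thesis using assms by cases (auto simp: ksign_insert)
qed

lemma ksign_swap':
  assumes "u \<noteq> v" "u \<notin> A" "v \<notin> A"
  shows "ksign u A * ksign v (insert u A) = - (ksign v A * ksign u (insert v A))"
proof -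
  have "vidx u \<noteq> vidx v" using assms(1) inj_vidx by (auto dest: injD)
  then consider "vidx u < vidx v" | "vidx v < vidx u" by linarith
  then show ?thesis using assms by cases (auto simp: ksign_insert mult.commute)
qed

text \<open>A chain \<open>z\<close> stands for the element $\sum_A z(A)\, e_A$ of the Koszul complex on all
  variables, and \<open>bd\<close> is the Koszul differential.\<close>

definition bd :: "('v::finite set \<Rightarrow> ('v, 'k::comm_ring_1) mpoly) \<Rightarrow> 'v set \<Rightarrow> ('v, 'k) mpoly" where
  "bd z A = (\<Sum>v\<in>- A. ksign v A * (xvar v * z (insert v A)))"

lemma bd_lincomb: "bd (\<lambda>B. \<Sum>p\<in>P. c p * f p B) A = (\<Sum>p\<in>P. c p * bd (f p) A)"
  unfolding bd_def sum_distrib_left by (subst sum.swap) (simp add: mult_ac)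

lemma bd_add: "bd (\<lambda>B. f B + g B) A = bd f A + bd g A"
  by (simp add: bd_def distrib_left sum.distrib)

lemma bd_diff: "bd (\<lambda>B. f B - g B) A = bd f A - bd g A"
  by (simp add: bd_def right_diff_distrib sum_subtractf)

lemma bd_zero [simp]: "bd (\<lambda>B. 0) A = 0"
  by (simp add: bd_def)

text \<open>Signs cancel in pairs. With \<open>J = {0}\<close> this gives that the Koszul
  differential squares to zero; with \<open>J = I\<close> it shows that a chain is a cycle modulo
  \<open>I\<close>.\<close>

lemma sum_ordered_pairs_ideal:
  assumes J: "is_ideal J" and "finite S"
    and "\<And>u v. u \<in> S \<Longrightarrow> v \<in> S \<Longrightarrow> u \<noteq> v \<Longrightarrow> g u v + g v u \<in> J"
  shows "(\<Sum>u\<in>S. \<Sum>v\<in>S - {u}. g u v) \<in> J"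
  using assms(2,3)
proof (induction S rule: finite_induct)
  case empty
  then show ?case by (simp add: ideal_zero J)
next
  case (insert x S)
  have "(\<Sum>v\<in>insert x S - {u}. g u v) = g u x + (\<Sum>v\<in>S - {u}. g u v)" if "u \<in> S" for u
  proof -
    have "insert x S - {u} = insert x (S - {u})" using that insert.hyps by auto
    then show ?thesis using insert.hyps by simp
  qed
  moreover have "insert x S - {x} = S" using insert.hyps by auto
  ultimately have "(\<Sum>u\<in>insert x S. \<Sum>v\<in>insert x S - {u}. g u v)
      = (\<Sum>u\<in>S. g x u + g u x) + (\<Sum>u\<in>S. \<Sum>v\<in>S - {u}. g u v)"
    using insert.hyps by (simp add: sum.distrib add_ac)
  moreover have "(\<Sum>u\<in>S. g x u + g u x) \<in> J"
    using insert by (intro ideal_sum J) auto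
  moreover have "(\<Sum>u\<in>S. \<Sum>v\<in>S - {u}. g u v) \<in> J"
    using insert by blast
  ultimately show ?case by (simp add: ideal_add J)
qed

lemma bd_bd_sum:
  "bd (\<lambda>B. \<Sum>v\<in>- B. ksign v B * f v B) A
    = (\<Sum>u\<in>- A. \<Sum>v\<in>- A - {u}. ksign u A * ksign v (insert u A) * (xvar u * f v (insert u A)))"
proof -
  have "- insert u A = - A - {u}" for u by auto
  then show ?thesis by (simp add: bd_def sum_distrib_left mult_ac)
qed

lemma bd_bd [simp]: "bd (bd (z :: 'v::finite set \<Rightarrow> ('v, 'k::comm_ring_1) mpoly)) A = 0"
proof -
  let ?g = "\<lambda>u v. ksign u A * ksign v (insert u A) * (xvar u * (xvar v * z (insert v (insert u A))))"
  have "bd (bd z) A = (\<Sum>u\<in>- A. \<Sum>v\<in>- A - {u}. ?g u v)"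
    using bd_bd_sum[of "\<lambda>v B. xvar v * z (insert v B)" A] unfolding bd_def[of z, abs_def] .
  also have "\<dots> \<in> {0}"
  proof (rule sum_ordered_pairs_ideal[OF is_ideal_zero])
    fix u v assume "u \<in> - A" "v \<in> - A" "u \<noteq> v"
    then have "ksign u A * ksign v (insert u A) = (- (ksign v A * ksign u (insert v A)) :: ('v, 'k) mpoly)"
      by (intro ksign_swap') auto
    then have "?g u v = - (ksign v A * ksign u (insert v A)) * (xvar u * (xvar v * z (insert v (insert u A))))"
      by (simp only:)
    also have "\<dots> = - ?g v u" by (simp add: insert_commute mult.left_commute)
    finally show "?g u v + ?g v u \<in> {0}" by simp
  qed simp
  finally show ?thesis by simp
qed

lemma xvar_mult_mem_var_ideal:
  assumes "xvar v * p \<in> var_ideal W" "v \<notin> W"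
  shows "(p :: ('v, 'k::comm_ring_1) mpoly) \<in> var_ideal W"
  unfolding var_ideal_def
proof (clarify)
  fix \<alpha> assume "\<alpha> \<in> keys p"
  then have "single v 1 + \<alpha> \<in> keys (xvar v * p)"
    by (simp add: in_keys_iff xvar_def monom_def lookup_single_mult_add)
  then obtain w where "w \<in> W" "lookup (single v 1 + \<alpha>) w \<noteq> 0"
    using assms(1) unfolding var_ideal_def by blast
  then show "\<exists>w\<in>W. lookup \<alpha> w \<noteq> 0"
    using assms(2) by (intro bexI[of _ w]) (auto simp: lookup_add lookup_single when_def split: if_splits)
qed

lemma xvar_mem_var_ideal: "v \<in> W \<Longrightarrow> xvar v \<in> var_ideal W"
  by (auto simp: var_ideal_def xvar_def monom_def intro!: bexI[of _ v])

lemma xvar_mult_mem: "v \<in> W \<Longrightarrow> xvar v * p \<in> var_ideal W"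
  using ideal_mult[OF is_ideal_var_ideal xvar_mem_var_ideal, of v W p] by (simp add: mult.commute)

lemma var_ideal_insert_split:
  assumes "(f :: ('v, 'k::comm_ring_1) mpoly) \<in> var_ideal (insert v W)"
  shows "\<exists>p q. p \<in> var_ideal W \<and> f = p + xvar v * q"
proof -
  let ?K = "{\<alpha> \<in> keys f. \<exists>w\<in>W. lookup \<alpha> w \<noteq> 0}"
  define p where "p = (\<Sum>\<alpha>\<in>?K. single \<alpha> (lookup f \<alpha>))"
  define q where "q = (\<Sum>\<alpha>\<in>keys f - ?K. single (\<alpha> - single v 1) (lookup f \<alpha>))"
  have "xvar v * q = (\<Sum>\<alpha>\<in>keys f - ?K. single \<alpha> (lookup f \<alpha>))"
    unfolding q_def sum_distrib_left
  proof (intro sum.cong refl)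
    fix \<alpha> assume "\<alpha> \<in> keys f - ?K"
    then have "lookup \<alpha> v \<noteq> 0" using assms unfolding var_ideal_def by auto
    then have "exp_dvd (single v 1) \<alpha>" by (simp add: exp_dvd_def lookup_single when_def Suc_le_eq)
    then show "xvar v * single (\<alpha> - single v 1) (lookup f \<alpha>) = single \<alpha> (lookup f \<alpha>)"
      by (simp add: xvar_def monom_def mult_single exp_dvd_add_diff)
  qed
  moreover have "(\<Sum>\<alpha>\<in>keys f. single \<alpha> (lookup f \<alpha>)) = (\<Sum>\<alpha>\<in>keys f - ?K. single \<alpha> (lookup f \<alpha>)) + p"
    unfolding p_def by (intro sum.subset_diff) auto
  ultimately have "f = xvar v * q + p" by (simp add: sum_singles)
  then have "f = p + xvar v * q" by (simp add: add.commute)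
  moreover have "p \<in> var_ideal W"
    unfolding p_def by (intro ideal_sum is_ideal_var_ideal) (auto simp: var_ideal_def)
  ultimately show ?thesis by blast
qed

text \<open>Chains of all homological degrees are treated at once, so exactness at degree zero
  appears as the condition on \<open>z {}\<close>. In the induction the terms containing the new
  generator \<open>e_v\<close> are removed first, then the part of the degree zero coefficient that
  needs \<open>x_v\<close>.\<close>

lemma koszul_exact_on:
  fixes z :: "'v::finite set \<Rightarrow> ('v, 'k::comm_ring_1) mpoly"
  assumes "\<And>A. \<not> A \<subseteq> W \<Longrightarrow> z A = 0" "\<And>A. bd z A = 0" "z {} \<in> var_ideal W"
  shows "\<exists>y. (\<forall>A. \<not> A \<subseteq> W \<longrightarrow> y A = 0) \<and> (\<forall>A. bd y A = z A)"
  using finite[of W] assms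
proof (induction W arbitrary: z rule: finite_induct)
  case empty
  have "keys (z {}) = {}" using empty.prems(3) by (auto simp: var_ideal_def)
  then have "z {} = 0" by (intro poly_mapping_eqI) (simp flip: not_in_keys_iff_lookup_eq_zero)
  then have "z A = 0" for A using empty.prems(1)[of A] by (cases "A = {}") auto
  then show ?case by (intro exI[of _ "\<lambda>_. 0"]) simp
next
  case (insert v W)
  \<comment> \<open>The terms of \<open>z\<close> that contain \<open>e_v\<close>, with
    \<open>e_v\<close> split off. They form a cycle on \<open>W\<close>.\<close>
  define t where "t A = (if v \<in> A then 0 else ksign v A * z (insert v A))" for A
  have bdt: "bd t A = 0" for A
  proof (cases "v \<in> A")
    case True
    then show ?thesis by (simp add: bd_def t_def)
  next
    case False
    have "bd t A = (\<Sum>u\<in>- A - {v}. ksign u A * (xvar u * t (insert u A)))"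
      unfolding bd_def using False by (intro sum.mono_neutral_right) (auto simp: t_def)
    also have "\<dots> = (\<Sum>u\<in>- A - {v}. - ksign v A * (ksign u (insert v A) * (xvar u * z (insert u (insert v A)))))"
    proof (intro sum.cong refl)
      fix u assume u: "u \<in> - A - {v}"
      have "ksign u A * (xvar u * t (insert u A))
          = (ksign u A * ksign v (insert u A)) * (xvar u * z (insert v (insert u A)))"
        using u False by (auto simp: t_def mult_ac)
      also have "ksign u A * ksign v (insert u A) = (- (ksign v A * ksign u (insert v A)) :: ('v, 'k) mpoly)"
        using u False by (intro ksign_swap') auto
      finally show "ksign u A * (xvar u * t (insert u A))
          = - ksign v A * (ksign u (insert v A) * (xvar u * z (insert u (insert v A))))"
        by (simp add: insert_commute mult.assoc)
    qed
    also have "\<dots> = - ksign v A * bd z (insert v A)"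
    proof -
      have "- insert v A = - A - {v}" by auto
      then show ?thesis by (simp add: bd_def sum_distrib_left)
    qed
    finally show ?thesis using insert.prems(2) by simp
  qed
  \<comment> \<open>The cycle condition at \<open>{}\<close> puts \<open>x_v\<close> times
    \<open>z {v}\<close> into \<open>var_ideal W\<close>, modulo which \<open>x_v\<close> is not a
    zero divisor. This is the degree zero condition for \<open>t\<close>.\<close>
  have "z {v} \<in> var_ideal W"
  proof (rule xvar_mult_mem_var_ideal)
    have "bd z {} = (\<Sum>u\<in>UNIV. xvar u * z {u})" by (simp add: bd_def)
    also have "\<dots> = xvar v * z {v} + (\<Sum>u\<in>UNIV - {v}. xvar u * z {u})"
      by (rule sum.remove) auto
    finally have "xvar v * z {v} = - (\<Sum>u\<in>UNIV - {v}. xvar u * z {u})"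
      using insert.prems(2) by (simp add: eq_neg_iff_add_eq_0)
    moreover have "(\<Sum>u\<in>UNIV - {v}. xvar u * z {u}) \<in> var_ideal W"
    proof (intro ideal_sum is_ideal_var_ideal)
      fix u assume u: "u \<in> UNIV - {v}"
      show "xvar u * z {u} \<in> var_ideal W"
      proof (cases "u \<in> W")
        case False
        then have "z {u} = 0" using u by (intro insert.prems(1)) auto
        then show ?thesis by (simp add: ideal_zero is_ideal_var_ideal)
      qed (rule xvar_mult_mem)
    qed
    ultimately show "xvar v * z {v} \<in> var_ideal W" by (simp add: ideal_uminus is_ideal_var_ideal)
  qed (use insert.hyps in simp)
  then have "t {} \<in> var_ideal W" by (simp add: t_def)
  moreover have "t A = 0" if "\<not> A \<subseteq> W" for A
  proof (cases "v \<in> A")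
    case False
    then have "\<not> insert v A \<subseteq> insert v W" using that by blast
    then show ?thesis using insert.prems(1) by (simp add: t_def)
  qed (simp add: t_def)
  ultimately obtain y1 where y1: "\<And>A. \<not> A \<subseteq> W \<Longrightarrow> y1 A = 0" "\<And>A. bd y1 A = t A"
    using insert.IH[of t] bdt by blast
  \<comment> \<open>This is \<open>e_v\<close> times \<open>y1\<close>. Its boundary is
    \<open>x_v y1\<close> minus \<open>e_v\<close> times \<open>bd y1\<close>, so adding it to
    \<open>z\<close> cancels every term with \<open>e_v\<close>.\<close>
  define Y where "Y B = (if v \<in> B then ksign v (B - {v}) * y1 (B - {v}) else 0)" for B
  have Ysupp: "Y B = 0" if "\<not> B \<subseteq> insert v W" for B
  proof -
    have "\<not> B - {v} \<subseteq> W" using that by blast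
    then show ?thesis by (simp add: Y_def y1(1))
  qed
  have bdY: "bd Y (insert v A) = - z (insert v A)" if v: "v \<notin> A" for A
  proof -
    have c: "- insert v A = - A - {v}" by auto
    have "bd Y (insert v A) = (\<Sum>u\<in>- A - {v}. - ksign v A * (ksign u A * (xvar u * y1 (insert u A))))"
      unfolding bd_def c
    proof (intro sum.cong refl)
      fix u assume u: "u \<in> - A - {v}"
      have "insert u (insert v A) - {v} = insert u A" using u v by auto
      then have "ksign u (insert v A) * (xvar u * Y (insert u (insert v A)))
          = (ksign u (insert v A) * ksign v (insert u A)) * (xvar u * y1 (insert u A))"
        by (simp add: Y_def mult_ac)
      also have "ksign u (insert v A) * ksign v (insert u A) = (- (ksign u A * ksign v A) :: ('v, 'k) mpoly)"
        using u v by (intro ksign_swap) auto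
      finally show "ksign u (insert v A) * (xvar u * Y (insert u (insert v A)))
          = - ksign v A * (ksign u A * (xvar u * y1 (insert u A)))"
        by (simp add: mult_ac)
    qed
    also have "\<dots> = - ksign v A * bd y1 A"
    proof -
      have "y1 (insert v A) = 0" using insert.hyps by (intro y1(1)) auto
      then have "bd y1 A = (\<Sum>u\<in>- A - {v}. ksign u A * (xvar u * y1 (insert u A)))"
        unfolding bd_def by (intro sum.mono_neutral_right) auto
      then show ?thesis by (simp add: sum_distrib_left)
    qed
    also have "\<dots> = - z (insert v A)" using v by (simp add: y1(2) t_def)
    finally show ?thesis .
  qed
  define z' where "z' A = z A + bd Y A" for A
  have z'supp: "z' A = 0" if "\<not> A \<subseteq> W" for A
  proof (cases "v \<in> A")
    case True
    then show ?thesis using bdY[of "A - {v}"] by (simp add: z'_def insert_absorb)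
  next
    case False
    then have n: "\<not> A \<subseteq> insert v W" using that by blast
    then have "Y (insert u A) = 0" for u by (intro Ysupp) auto
    then show ?thesis using insert.prems(1)[OF n] by (simp add: z'_def bd_def)
  qed
  have bdz': "bd z' A = 0" for A
    unfolding z'_def bd_add using insert.prems(2) by simp
  have "bd Y {} \<in> var_ideal (insert v W)"
    unfolding bd_def
  proof (intro ideal_sum is_ideal_var_ideal)
    fix u
    show "ksign u {} * (xvar u * Y (insert u {})) \<in> var_ideal (insert v W)"
      by (cases "u = v") (auto simp: Y_def xvar_mult_mem ideal_zero is_ideal_var_ideal)
  qed
  then have "z' {} \<in> var_ideal (insert v W)"
    unfolding z'_def using insert.prems(3) by (intro ideal_add is_ideal_var_ideal)
  from var_ideal_insert_split[OF this]
  obtain p q where pq: "p \<in> var_ideal W" "z' {} = p + xvar v * q" by (elim exE conjE)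
  \<comment> \<open>The summand \<open>x_v q\<close> of \<open>z' {}\<close> is the boundary of
    \<open>q e_v\<close>; after its removal the rest is a cycle on \<open>W\<close>.\<close>
  define Q where "Q B = (if B = {v} then q else 0)" for B
  have bdQ: "bd Q A = (if A = {} then xvar v * q else 0)" for A
  proof (cases "A = {}")
    case True
    have "bd Q {} = (\<Sum>u\<in>UNIV. xvar u * Q {u})" by (simp add: bd_def)
    also have "\<dots> = (\<Sum>u\<in>UNIV. if u = v then xvar v * q else 0)"
      by (intro sum.cong) (auto simp: Q_def)
    finally show ?thesis using True by simp
  next
    case False
    then have "Q (insert u A) = 0" if "u \<notin> A" for u using that by (auto simp: Q_def)
    then show ?thesis using False by (simp add: bd_def)
  qed
  define z'' where "z'' A = z' A - bd Q A" for A
  have "z'' A = 0" if "\<not> A \<subseteq> W" for A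
    using z'supp[OF that] that by (auto simp: z''_def bdQ)
  moreover have "bd z'' A = 0" for A unfolding z''_def bd_diff using bdz' by simp
  moreover have "z'' {} \<in> var_ideal W" using pq by (simp add: z''_def bdQ)
  ultimately obtain y2 where y2: "\<And>A. \<not> A \<subseteq> W \<Longrightarrow> y2 A = 0" "\<And>A. bd y2 A = z'' A"
    using insert.IH[of z''] by blast
  define y where "y A = y2 A + Q A - Y A" for A
  have "bd y A = z A" for A
    unfolding y_def bd_diff bd_add by (simp add: y2 z''_def z'_def)
  moreover have "y A = 0" if "\<not> A \<subseteq> insert v W" for A
  proof -
    have "\<not> A \<subseteq> W" "A \<noteq> {v}" using that by auto
    then show ?thesis using that by (simp add: y_def y2 Q_def Ysupp)
  qed
  ultimately show ?case by blast
qed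

lemma mem_var_ideal_UNIV: "(p :: ('v, 'k::comm_ring_1) mpoly) \<in> var_ideal UNIV \<longleftrightarrow> lookup p 0 = 0"
proof -
  have "(\<exists>w. lookup \<alpha> w \<noteq> 0) \<longleftrightarrow> \<alpha> \<noteq> 0" for \<alpha> :: "'v \<Rightarrow>\<^sub>0 nat"
    by (metis lookup_zero poly_mapping_eqI)
  then show ?thesis by (auto simp: var_ideal_def in_keys_iff)
qed

lemma koszul_exact:
  fixes z :: "'v::finite set \<Rightarrow> ('v, 'k::comm_ring_1) mpoly"
  assumes "\<And>A. bd z A = 0" "lookup (z {}) 0 = 0"
  shows "\<exists>y. \<forall>A. bd y A = z A"
  using koszul_exact_on[of UNIV z] assms by (auto simp: mem_var_ideal_UNIV)

section \<open>Koszul cycles and Betti numbers\<close>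

lemma lin_map_lincomb:
  "lin_map M m n (\<lambda>l. \<Sum>p\<in>P. c p * f p l) = (\<lambda>j. \<Sum>p\<in>P. c p * lin_map M m n (f p) j)"
proof
  fix j
  have "(\<Sum>l<n. M j l * (\<Sum>p\<in>P. c p * f p l)) = (\<Sum>p\<in>P. c p * (\<Sum>l<n. M j l * f p l))"
    unfolding sum_distrib_left by (subst sum.swap) (simp add: mult_ac)
  then show "lin_map M m n (\<lambda>l. \<Sum>p\<in>P. c p * f p l) j = (\<Sum>p\<in>P. c p * lin_map M m n (f p) j)"
    by (simp add: lin_map_def)
qed

lemma lin_map_zero [simp]: "lin_map M m n (\<lambda>_. 0) = (\<lambda>_. 0)"
  by (auto simp: lin_map_def)

lemma lin_map_add: "lin_map M m n (\<lambda>l. f l + g l) = (\<lambda>j. lin_map M m n f j + lin_map M m n g j)"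
  by (auto simp: lin_map_def distrib_left sum.distrib)

lemma lin_map_free_mod: "lin_map M m n f \<in> free_mod m"
  by (auto simp: lin_map_def free_mod_def)

definition vbd :: "('v::finite set \<Rightarrow> nat \<Rightarrow> ('v, 'k::comm_ring_1) mpoly) \<Rightarrow> 'v set \<Rightarrow> nat \<Rightarrow> ('v, 'k) mpoly" where
  "vbd z A = (\<lambda>l. bd (\<lambda>B. z B l) A)"

lemma lin_map_vbd: "lin_map M m n (vbd z A) = vbd (\<lambda>B. lin_map M m n (z B)) A"
proof
  fix j
  have "lin_map M m n (vbd z A) j
      = lin_map M m n (\<lambda>l. \<Sum>v\<in>- A. (ksign v A * xvar v) * z (insert v A) l) j"
    by (simp add: vbd_def bd_def mult.assoc)
  also have "\<dots> = (\<Sum>v\<in>- A. (ksign v A * xvar v) * lin_map M m n (z (insert v A)) j)"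
    by (simp only: lin_map_lincomb)
  finally show "lin_map M m n (vbd z A) j = vbd (\<lambda>B. lin_map M m n (z B)) A j"
    by (simp add: vbd_def bd_def mult.assoc)
qed

lemma vbd_vbd: "vbd (vbd z) A = (\<lambda>_. 0)"
  by (simp add: vbd_def)

lemma vbd_free_mod: "(\<And>A. z A \<in> free_mod n) \<Longrightarrow> vbd z A \<in> free_mod n"
  by (simp add: free_mod_def vbd_def)

locale resolution =
  fixes I :: "('v::finite, 'k::field) mpoly set" and b :: "nat \<Rightarrow> nat"
    and d :: "nat \<Rightarrow> nat \<Rightarrow> nat \<Rightarrow> ('v, 'k) mpoly"
  assumes res: "min_free_res I b d" and idl: "is_ideal I"
begin

abbreviation D :: "nat \<Rightarrow> (nat \<Rightarrow> ('v, 'k) mpoly) \<Rightarrow> nat \<Rightarrow> ('v, 'k) mpoly" where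
  "D j \<equiv> lin_map (d j) (b (j - 1)) (b j)"

lemma b0: "b 0 = 1"
  using res by (simp add: min_free_res_def)

lemma image_D1: "D 1 ` free_mod (b 1) = {v. v 0 \<in> I \<and> (\<forall>j>0. v j = 0)}"
  using res unfolding min_free_res_def diff_self_eq_0 by blast

lemma exact_D:
  "1 \<le> j \<Longrightarrow> {v \<in> free_mod (b j). D j v = (\<lambda>_. 0)} = D (Suc j) ` free_mod (b (Suc j))"
  using res by (simp add: min_free_res_def)

lemma D_const_term: "lookup (D (Suc j) v l) 0 = 0"
proof -
  have "d (Suc j) l q * v q \<in> var_ideal UNIV" if "l < b j" "q < b (Suc j)" for q
  proof -
    have "d (Suc j) l q \<in> var_ideal UNIV"
      using res that unfolding mem_var_ideal_UNIV min_free_res_def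
      by (metis diff_Suc_1 le_add1 plus_1_eq_Suc)
    from ideal_mult[OF is_ideal_var_ideal this, of "v q"] show ?thesis by (simp add: mult.commute)
  qed
  then have "(\<Sum>q<b (Suc j). d (Suc j) l q * v q) \<in> var_ideal UNIV" if "l < b j"
    using that by (intro ideal_sum is_ideal_var_ideal) auto
  then show ?thesis by (simp add: lin_map_def mem_var_ideal_UNIV)
qed

text \<open>A zigzag lifts a Koszul cycle of \<open>S/I\<close> through the double complex formed by the
  Koszul complex and the resolution.\<close>

definition zigzag :: "nat \<Rightarrow> nat \<Rightarrow> (nat \<Rightarrow> 'v set \<Rightarrow> nat \<Rightarrow> ('v, 'k) mpoly) \<Rightarrow> bool" where
  "zigzag i k zs \<longleftrightarrow>
     (\<forall>j\<le>k. \<forall>A. zs j A \<in> free_mod (b j) \<and> (card A \<noteq> i - j \<longrightarrow> zs j A = (\<lambda>_. 0)))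
     \<and> (\<forall>j<k. \<forall>A. D (Suc j) (zs (Suc j) A) = vbd (zs j) A)"

lemma ex_zigzag:
  assumes z: "\<And>A. card A \<noteq> i \<Longrightarrow> z A = 0" and cyc: "\<And>A. bd z A \<in> I" and "k \<le> i"
  shows "\<exists>zs. zigzag i k zs \<and> (\<forall>A. zs 0 A = (\<lambda>l. if l = 0 then z A else 0))"
  using \<open>k \<le> i\<close>
proof (induction k)
  case 0
  show ?case
    by (intro exI[of _ "\<lambda>_ A l. if l = 0 then z A else 0"])
       (auto simp: zigzag_def free_mod_def b0 z)
next
  case (Suc k)
  then obtain zs where zs: "zigzag i k zs" "\<forall>A. zs 0 A = (\<lambda>l. if l = 0 then z A else 0)" by auto
  have "\<exists>w\<in>free_mod (b (Suc k)). D (Suc k) w = vbd (zs k) A" for A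
  proof (cases k)
    case 0
    have "vbd (zs 0) A = (\<lambda>l. if l = 0 then bd z A else 0)"
      using zs(2) by (auto simp: vbd_def)
    then have "vbd (zs 0) A \<in> D 1 ` free_mod (b 1)" unfolding image_D1 using cyc by simp
    then show ?thesis using 0 by auto
  next
    case (Suc k')
    have "D k (vbd (zs k) A) = vbd (\<lambda>B. D k (zs k B)) A" by (rule lin_map_vbd)
    also have "(\<lambda>B. D k (zs k B)) = vbd (zs k')" using zs(1) Suc by (auto simp: zigzag_def)
    finally have "D k (vbd (zs k) A) = (\<lambda>_. 0)" by (simp add: vbd_vbd)
    moreover have "vbd (zs k) A \<in> free_mod (b k)"
      using zs(1) by (intro vbd_free_mod) (auto simp: zigzag_def)
    ultimately have "vbd (zs k) A \<in> {v \<in> free_mod (b k). D k v = (\<lambda>_. 0)}" by simp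
    also have "\<dots> = D (Suc k) ` free_mod (b (Suc k))" using Suc by (intro exact_D) simp
    finally have "vbd (zs k) A \<in> D (Suc k) ` free_mod (b (Suc k))" .
    then show ?thesis by auto
  qed
  then obtain w where w: "\<And>A. w A \<in> free_mod (b (Suc k))" "\<And>A. D (Suc k) (w A) = vbd (zs k) A" by metis
  \<comment> \<open>The lifts are cut down to the right homological degree. Nothing is lost, since
    \<open>vbd (zs k) A\<close> vanishes for every other size of \<open>A\<close>.\<close>
  define w' where "w' A = (if card A = i - Suc k then w A else (\<lambda>_. 0))" for A
  have Dw': "D (Suc k) (w' A) = vbd (zs k) A" for A
  proof (cases "card A = i - Suc k")
    case False
    have "zs k (insert v A) = (\<lambda>_. 0)" if "v \<notin> A" for v
    proof -
      have "card (insert v A) \<noteq> i - k" using that False Suc.prems by simp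
      then show ?thesis using zs(1) by (simp add: zigzag_def)
    qed
    then have "vbd (zs k) A = (\<lambda>_. 0)" by (simp add: vbd_def bd_def)
    then show ?thesis using False by (simp add: w'_def)
  qed (use w(2) in \<open>simp add: w'_def\<close>)
  define zs' where "zs' j = (if j = Suc k then w' else zs j)" for j
  have "zigzag i (Suc k) zs'"
    unfolding zigzag_def
  proof (intro conjI allI impI)
    fix j and A :: "'v set" assume j: "j \<le> Suc k"
    show "zs' j A \<in> free_mod (b j)"
    proof (cases "j = Suc k")
      case True
      then show ?thesis using w(1)[of A] by (simp add: zs'_def w'_def free_mod_def)
    next
      case False
      then show ?thesis using zs(1) j by (simp add: zs'_def zigzag_def)
    qed
    assume c: "card A \<noteq> i - j"
    show "zs' j A = (\<lambda>_. 0)"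
    proof (cases "j = Suc k")
      case True
      then show ?thesis using c by (simp add: zs'_def w'_def)
    next
      case False
      then show ?thesis using zs(1) j c by (simp add: zs'_def zigzag_def)
    qed
  next
    fix j and A :: "'v set" assume j: "j < Suc k"
    show "D (Suc j) (zs' (Suc j) A) = vbd (zs' j) A"
    proof (cases "j = k")
      case True
      then show ?thesis using Dw'[of A] by (simp add: zs'_def)
    next
      case False
      then show ?thesis using zs(1) j by (simp add: zs'_def zigzag_def)
    qed
  qed
  moreover have "\<forall>A. zs' 0 A = (\<lambda>l. if l = 0 then z A else 0)" using zs(2) by (simp add: zs'_def)
  ultimately show ?case by blast
qed

lemma vkoszul_exact:
  assumes "\<And>A. z A \<in> free_mod n" "\<And>A. vbd z A = (\<lambda>_. 0)" "\<And>l. lookup (z {} l) 0 = 0"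
  shows "\<exists>y. (\<forall>A. y A \<in> free_mod n) \<and> (\<forall>A. vbd y A = (z A :: nat \<Rightarrow> ('v, 'k) mpoly))"
proof -
  have "\<exists>y. \<forall>A. bd y A = z A l" for l
    using assms(2,3) by (intro koszul_exact) (auto simp: vbd_def fun_eq_iff)
  then obtain y where y: "\<And>l A. bd (y l) A = z A l" by metis
  define y' where "y' A l = (if l < n then y l A else 0)" for A l
  have "vbd y' A l = z A l" for A l
    using assms(1)[of A] by (cases "l < n") (auto simp: vbd_def y'_def y free_mod_def)
  then show ?thesis by (intro exI[of _ y']) (auto simp: y'_def free_mod_def)
qed

lemma D_D: "D (Suc j) (D (Suc (Suc j)) w) = (\<lambda>_. 0)" if "w \<in> free_mod (b (Suc (Suc j)))"
  using exact_D[of "Suc j"] that by auto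

text \<open>The zigzag unravels from its end. The last entry is supported at \<open>{}\<close> and,
  without constant term, is a Koszul boundary. Subtracting the image of a primitive from the
  preceding entry leaves a Koszul cycle again. At \<open>j = i\<close> the starting cycle is a
  boundary modulo the image of \<open>D 1\<close>.\<close>

lemma zigzag_vanish:
  assumes zz: "zigzag i i zs" and z0: "\<And>l. l < b i \<Longrightarrow> lookup (zs i {} l) 0 = 0" and "j \<le> i"
  shows "\<exists>u w. (\<forall>A. u A \<in> free_mod (b (i - j)))
    \<and> (\<forall>A. w A \<in> free_mod (b (Suc (i - j))))
    \<and> (\<forall>A. zs (i - j) A = (\<lambda>l. vbd u A l + D (Suc (i - j)) (w A) l))"
  using \<open>j \<le> i\<close>
proof (induction j)
  case 0
  have fm: "zs i A \<in> free_mod (b i)" for A using zz by (simp add: zigzag_def)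
  have "zs i A = (\<lambda>_. 0)" if "A \<noteq> {}" for A using zz that by (simp add: zigzag_def)
  then have "vbd (zs i) A = (\<lambda>_. 0)" for A by (simp add: vbd_def bd_def)
  moreover have "lookup (zs i {} l) 0 = 0" for l
    using z0[of l] fm[of "{}"] by (cases "l < b i") (auto simp: free_mod_def)
  ultimately obtain u where "\<forall>A. u A \<in> free_mod (b i)" "\<forall>A. vbd u A = zs i A"
    using vkoszul_exact[of "zs i", OF fm] by blast
  then show ?case by (intro exI[of _ u] exI[of _ "\<lambda>_ _. 0"]) (auto simp: free_mod_def)
next
  case (Suc j)
  define m where "m = i - Suc j"
  have m: "i - j = Suc m" using Suc.prems by (simp add: m_def)
  obtain u w where u: "\<forall>A. u A \<in> free_mod (b (Suc m))" "\<forall>A. w A \<in> free_mod (b (Suc (Suc m)))"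
    "\<forall>A. zs (Suc m) A = (\<lambda>l. vbd u A l + D (Suc (Suc m)) (w A) l)"
    using Suc unfolding m by auto
  define z where "z A = (\<lambda>l. zs m A l - D (Suc m) (u A) l)" for A
  have zsm: "zs m A \<in> free_mod (b m)" for A using zz Suc.prems by (simp add: zigzag_def m_def)
  have "vbd z A = (\<lambda>_. 0)" for A
  proof -
    have "vbd (zs m) A = D (Suc m) (zs (Suc m) A)"
      using zz Suc.prems by (simp add: zigzag_def m_def)
    also have "\<dots> = D (Suc m) (\<lambda>l. vbd u A l + D (Suc (Suc m)) (w A) l)"
      using u(3) by simp
    also have "\<dots> = D (Suc m) (vbd u A)"
      unfolding lin_map_add using D_D[of "w A" m] u(2) by simp
    also have "\<dots> = vbd (\<lambda>B. D (Suc m) (u B)) A" by (rule lin_map_vbd)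
    finally show ?thesis by (simp add: z_def vbd_def bd_diff fun_eq_iff)
  qed
  moreover have "z A \<in> free_mod (b m)" for A
    using zsm[of A] lin_map_free_mod[of "d (Suc m)" "b m"] by (auto simp: z_def free_mod_def lin_map_def)
  moreover have "lookup (z {} l) 0 = 0" for l
  proof -
    \<comment> \<open>Here \<open>i - m = Suc j\<close> is positive, so the zigzag vanishes at the
      empty set; for the other summand minimality of the resolution is used.\<close>
    have "zs m {} = (\<lambda>_. 0)" using zz Suc.prems by (simp add: zigzag_def m_def)
    then show ?thesis using D_const_term by (simp add: z_def lookup_minus)
  qed
  ultimately obtain y where y: "\<forall>A. y A \<in> free_mod (b m)" "\<forall>A. vbd y A = z A"
    using vkoszul_exact[of z "b m"] by blast
  have "zs m A = (\<lambda>l. vbd y A l + D (Suc m) (u A) l)" for A using y(2) by (simp add: z_def fun_eq_iff)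
  then show ?case using y(1) u(1) unfolding m_def[symmetric] by blast
qed

text \<open>The cycles $z_p$ are lifted to elements of the \<open>i\<close>-th free module; if there
  are more than its rank, some combination lands in the maximal ideal, hence is a boundary.\<close>

lemma card_koszul_cycles_le:
  fixes z :: "'p \<Rightarrow> 'v set \<Rightarrow> ('v, 'k) mpoly"
  assumes fin: "finite P"
    and z: "\<And>p A. p \<in> P \<Longrightarrow> card A \<noteq> i \<Longrightarrow> z p A = 0"
    and cyc: "\<And>p A. p \<in> P \<Longrightarrow> bd (z p) A \<in> I"
    and ind: "\<And>a y. (\<And>A. (\<Sum>p\<in>P. single 0 (a p) * z p A) - bd y A \<in> I) \<Longrightarrow> \<forall>p\<in>P. a p = 0"
  shows "card P \<le> b i"
proof (rule ccontr)
  assume "\<not> ?thesis"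
  then have lt: "card {..<b i} < card P" by simp
  have "\<exists>zs. zigzag i i zs \<and> (\<forall>A. zs 0 A = (\<lambda>l. if l = 0 then z p A else 0))" if "p \<in> P" for p
    using z[OF that] cyc[OF that] by (intro ex_zigzag) auto
  then obtain zs where zs: "\<And>p. p \<in> P \<Longrightarrow> zigzag i i (zs p)"
    "\<And>p A. p \<in> P \<Longrightarrow> zs p 0 A = (\<lambda>l. if l = 0 then z p A else 0)" by metis
  obtain a where a: "\<exists>p\<in>P. a p \<noteq> 0" "\<forall>l\<in>{..<b i}. (\<Sum>p\<in>P. lookup (zs p i {} l) 0 * a p) = 0"
    using nontrivial_solution[OF fin _ lt, of "\<lambda>l p. lookup (zs p i {} l) 0"] by blast
  define ys :: "nat \<Rightarrow> 'v set \<Rightarrow> nat \<Rightarrow> ('v, 'k) mpoly" where "ys j A l = (\<Sum>p\<in>P. single 0 (a p) * zs p j A l)" for j A l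
  have "zigzag i i ys"
    unfolding zigzag_def
  proof (intro conjI allI impI)
    fix j A assume "j \<le> i"
    then show "ys j A \<in> free_mod (b j)"
      using zs(1) by (auto simp: ys_def zigzag_def free_mod_def intro!: sum.neutral)
  next
    fix j and A :: "'v set" assume "j \<le> i" "card A \<noteq> i - j"
    then have "zs p j A = (\<lambda>_. 0)" if "p \<in> P" for p using zs(1)[OF that] by (simp add: zigzag_def)
    then show "ys j A = (\<lambda>_. 0)" by (simp add: ys_def fun_eq_iff)
  next
    fix j A assume j: "j < i"
    have "D (Suc j) (ys (Suc j) A) = (\<lambda>l. \<Sum>p\<in>P. single 0 (a p) * D (Suc j) (zs p (Suc j) A) l)"
      unfolding ys_def[abs_def] lin_map_lincomb ..
    also have "\<dots> = (\<lambda>l. \<Sum>p\<in>P. single 0 (a p) * vbd (zs p j) A l)"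
      using zs(1) j by (simp add: zigzag_def)
    also have "\<dots> = vbd (ys j) A" unfolding vbd_def ys_def bd_lincomb ..
    finally show "D (Suc j) (ys (Suc j) A) = vbd (ys j) A" .
  qed
  moreover have "lookup (ys i {} l) 0 = 0" if "l < b i" for l
  proof -
    have "lookup (single 0 (a p) * q) 0 = lookup q 0 * a p" for p and q :: "('v, 'k) mpoly"
      using lookup_single_mult_add[of 0 "a p" q 0] by simp
    then show ?thesis using a(2) that by (simp add: ys_def lookup_sum)
  qed
  ultimately obtain u w where u: "\<forall>A. w A \<in> free_mod (b 1)" "\<forall>A. ys 0 A = (\<lambda>l. vbd u A l + D 1 (w A) l)"
    using zigzag_vanish[of i ys i] by auto
  have "(\<Sum>p\<in>P. single 0 (a p) * z p A) - bd (\<lambda>B. u B 0) A \<in> I" for A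
  proof -
    have D: "D 1 (w A) 0 \<in> I" using image_D1 u(1) by blast
    have "ys 0 A 0 = (\<Sum>p\<in>P. single 0 (a p) * z p A)" using zs(2) by (simp add: ys_def)
    moreover have "ys 0 A 0 = bd (\<lambda>B. u B 0) A + D 1 (w A) 0" using u(2) by (simp add: vbd_def)
    ultimately have "(\<Sum>p\<in>P. single 0 (a p) * z p A) = bd (\<lambda>B. u B 0) A + D 1 (w A) 0" by simp
    then have "(\<Sum>p\<in>P. single 0 (a p) * z p A) - bd (\<lambda>B. u B 0) A = D 1 (w A) 0"
      by (simp only: add_diff_cancel_left')
    with D show ?thesis by simp
  qed
  then show False using ind[of a "\<lambda>B. u B 0"] a(1) by blast
qed

end

section \<open>Lower bounds from the 1-skeleton\<close>

lemma lookup_scale: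
  "lookup (single 0 c * q :: ('v, 'k::comm_ring_1) mpoly) \<alpha> = c * lookup q \<alpha>"
  using lookup_single_mult_add[of 0 c q \<alpha>] by simp

lemma lookup_ksign:
  "lookup (ksign v A * q :: ('v::finite, 'k::comm_ring_1) mpoly) \<alpha> = ksign v A * lookup q \<alpha>"
proof -
  have "ksign v A = (1 :: ('v, 'k) mpoly) \<and> ksign v A = (1 :: 'k)
      \<or> ksign v A = (- 1 :: ('v, 'k) mpoly) \<and> ksign v A = (- 1 :: 'k)"
    unfolding ksign_def by (cases "even (card {u \<in> A. vidx u < vidx v})") auto
  then show ?thesis by auto
qed

lemma single_eq_ind: "single v (1 :: nat) = ind {v}"
  by (intro poly_mapping_eqI) (auto simp: lookup_single when_def)

lemma xvar_eq_monom_ind: "xvar v = monom (ind {v})"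
  unfolding xvar_def single_eq_ind ..

lemma ind_diff: "w \<in> X \<Longrightarrow> ind X - single w 1 = ind (X - {w})"
  by (intro poly_mapping_eqI) (auto simp: lookup_single lookup_minus when_def)

lemma lookup_xvar_mult_ind:
  "lookup (xvar w * q :: ('v::finite, 'k::comm_ring_1) mpoly) (ind X)
    = (if w \<in> X then lookup q (ind (X - {w})) else 0)"
  using ind_diff[of w X] by (auto simp: lookup_xvar_mult)

lemma ind_empty [simp]: "ind {} = 0"
  by (intro poly_mapping_eqI) simp

lemma lookup_bd_ind:
  "lookup (bd y A) (ind X) = (\<Sum>w\<in>X - A. ksign w A * lookup (y (insert w A)) (ind (X - {w})))"
proof -
  have "lookup (bd y A) (ind X)
      = (\<Sum>w\<in>- A. ksign w A * (if w \<in> X then lookup (y (insert w A)) (ind (X - {w})) else 0))"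
    unfolding bd_def lookup_sum lookup_ksign lookup_xvar_mult_ind ..
  also have "\<dots> = (\<Sum>w\<in>X - A. ksign w A * (if w \<in> X then lookup (y (insert w A)) (ind (X - {w})) else 0))"
    by (intro sum.mono_neutral_right) auto
  finally show ?thesis by simp
qed

lemma xvar_pair: "u \<noteq> v \<Longrightarrow> xvar u * xvar v = (monom (ind {u, v}) :: ('v::finite, 'k::comm_ring_1) mpoly)"
proof -
  assume "u \<noteq> v"
  then have "single u 1 + single v 1 = ind {u, v}"
    by (intro poly_mapping_eqI) (auto simp: lookup_single lookup_add when_def)
  then show ?thesis by (simp add: xvar_def monom_def mult_single)
qed

context resolution
begin

text \<open>The cycles of multidegree \<open>\<sigma>\<close> and homological degree $|\sigma| - 1$ are
  $\sum_{v \in \sigma} \pm f(v)\, x_v\, e_{\sigma \setminus v}$ with \<open>f\<close> constant along the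
  edges of the complex; the boundaries are those with \<open>f\<close> constant.\<close>

lemma linear_strand_bound:
  fixes F :: "'p \<Rightarrow> 'v set \<Rightarrow> 'v \<Rightarrow> 'k"
  assumes lin: "\<And>p v. p \<in> I \<Longrightarrow> lookup p (ind {v}) = 0"
    and fin: "finite P" and T: "\<And>\<sigma>. \<sigma> \<in> T \<Longrightarrow> card \<sigma> = Suc i"
    and loc: "\<And>p \<sigma> u v. p \<in> P \<Longrightarrow> \<sigma> \<in> T \<Longrightarrow> u \<in> \<sigma> \<Longrightarrow> v \<in> \<sigma> \<Longrightarrow> u \<noteq> v
      \<Longrightarrow> xvar u * xvar v \<in> I \<or> F p \<sigma> u = F p \<sigma> v"
    and ind: "\<And>a. (\<And>\<sigma>. \<sigma> \<in> T \<Longrightarrow> \<exists>c. \<forall>v\<in>\<sigma>. (\<Sum>p\<in>P. a p * F p \<sigma> v) = c) \<Longrightarrow> \<forall>p\<in>P. a p = 0"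
  shows "card P \<le> b i"
proof -
  define f :: "'p \<Rightarrow> 'v \<Rightarrow> 'v set \<Rightarrow> ('v, 'k) mpoly"
    where "f p v B = (if insert v B \<in> T then single 0 (F p (insert v B) v) * xvar v else 0)" for p v B
  define z where "z p A = (\<Sum>v\<in>- A. ksign v A * f p v A)" for p A
  show ?thesis
  proof (rule card_koszul_cycles_le[OF fin, of i z])
    fix p and A :: "'v set" assume p: "p \<in> P" and "card A \<noteq> i"
    then have "insert v A \<notin> T" if "v \<notin> A" for v using T[of "insert v A"] that by auto
    then show "z p A = 0" by (simp add: z_def f_def)
  next
    fix p and A :: "'v set" assume p: "p \<in> P"
    let ?s = "\<lambda>u v. ksign u A * ksign v (insert u A) :: ('v, 'k) mpoly"
    let ?g = "\<lambda>u v. ?s u v * (xvar u * f p v (insert u A))"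
    have "bd (z p) A = (\<Sum>u\<in>- A. \<Sum>v\<in>- A - {u}. ?g u v)"
      unfolding z_def[abs_def] by (rule bd_bd_sum)
    also have "\<dots> \<in> I"
    proof (rule sum_ordered_pairs_ideal[OF idl])
      fix u v assume uv: "u \<in> - A" "v \<in> - A" "u \<noteq> v"
      let ?\<sigma> = "insert u (insert v A)"
      have \<sigma>: "insert v (insert u A) = ?\<sigma>" by auto
      show "?g u v + ?g v u \<in> I"
      proof (cases "?\<sigma> \<in> T")
        case True
        have "?s v u = - ?s u v" using ksign_swap'[of v u A] uv by auto
        then have "?g u v + ?g v u
            = ?s u v * (xvar u * (single 0 (F p ?\<sigma> v) * xvar v)) + (- ?s u v) * (xvar v * (single 0 (F p ?\<sigma> u) * xvar u))"
          using True by (simp only: f_def \<sigma> if_True)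
        also have "\<dots> = ?s u v * (single 0 (F p ?\<sigma> v) - single 0 (F p ?\<sigma> u)) * (xvar u * xvar v)"
          by (simp add: algebra_simps)
        also have "\<dots> \<in> I"
          using loc[OF p True, of u v] uv ideal_mult[OF idl] by (auto simp: ideal_zero[OF idl])
        finally show ?thesis .
      next
        case False
        then show ?thesis by (simp add: f_def \<sigma> ideal_zero[OF idl])
      qed
    qed simp
    finally show "bd (z p) A \<in> I" .
  next
    fix a :: "'p \<Rightarrow> 'k" and y
    assume bnd: "\<And>A. (\<Sum>p\<in>P. single 0 (a p) * z p A) - bd y A \<in> I"
    show "\<forall>p\<in>P. a p = 0"
    proof (rule ind)
      fix \<sigma> assume \<sigma>: "\<sigma> \<in> T"
      \<comment> \<open>Coefficients of \<open>x_v\<close> are compared at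
        \<open>\<sigma> - {v}\<close>. Members of \<open>I\<close> have none, and a boundary
        contributes, up to the common sign, the constant term of \<open>y \<sigma>\<close>, which
        does not depend on \<open>v\<close>.\<close>
      have "(\<Sum>p\<in>P. a p * F p \<sigma> v) = lookup (y \<sigma>) 0" if v: "v \<in> \<sigma>" for v
      proof -
        define A where "A = \<sigma> - {v}"
        have iA: "insert v A = \<sigma>" and vA: "v \<notin> A" using v by (auto simp: A_def)
        have f: "lookup (f p u A) (ind {v}) = (if u = v then F p \<sigma> v else 0)" for p u
          using \<sigma> iA by (auto simp: f_def lookup_scale xvar_eq_monom_ind monom_def lookup_single when_def)
        have z: "lookup (z p A) (ind {v}) = ksign v A * F p \<sigma> v" for p
        proof -
          have "lookup (z p A) (ind {v}) = (\<Sum>u\<in>- A. if u = v then ksign v A * F p \<sigma> v else 0)"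
            unfolding z_def lookup_sum lookup_ksign f by (intro sum.cong) auto
          then show ?thesis using vA by simp
        qed
        have "{v} - A = {v}" using vA by auto
        then have bd: "lookup (bd y A) (ind {v}) = ksign v A * lookup (y \<sigma>) 0"
          by (simp add: lookup_bd_ind iA)
        have "0 = (\<Sum>p\<in>P. a p * (ksign v A * F p \<sigma> v)) - ksign v A * lookup (y \<sigma>) 0"
          using lin[OF bnd[of A], of v] by (simp add: lookup_minus lookup_sum lookup_scale z bd)
        also have "(\<Sum>p\<in>P. a p * (ksign v A * F p \<sigma> v)) = ksign v A * (\<Sum>p\<in>P. a p * F p \<sigma> v)"
          by (simp add: sum_distrib_left mult.left_commute)
        finally have "ksign v A * (\<Sum>p\<in>P. a p * F p \<sigma> v) = ksign v A * lookup (y \<sigma>) 0" by simp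
        then have "ksign v A * (ksign v A * (\<Sum>p\<in>P. a p * F p \<sigma> v)) = ksign v A * (ksign v A * lookup (y \<sigma>) 0)"
          by (simp only:)
        then show ?thesis by (simp only: ksign_square')
      qed
      then show "\<exists>c. \<forall>v\<in>\<sigma>. (\<Sum>p\<in>P. a p * F p \<sigma> v) = c" by blast
    qed
  qed
qed

text \<open>On each such \<sigma> the indicator function of \<open>A\<close> is constant along
  edges, since no edge joins \<open>A\<close> and \<open>B\<close>, but it is not constant.
  Different \<sigma> give independent classes because their multidegrees differ.\<close>

lemma betti_ge_card_split_sets:
  assumes lin: "\<And>p v. p \<in> I \<Longrightarrow> lookup p (ind {v}) = 0"
    and AB: "A \<inter> B = {}" "\<And>u v. u \<in> A \<Longrightarrow> v \<in> B \<Longrightarrow> xvar u * xvar v \<in> I"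
  shows "card {\<sigma>. \<sigma> \<subseteq> A \<union> B \<and> card \<sigma> = Suc i \<and> \<sigma> \<inter> A \<noteq> {} \<and> \<sigma> \<inter> B \<noteq> {}} \<le> b i" (is "card ?T \<le> _")
proof (rule linear_strand_bound[OF lin, of _ ?T _ "\<lambda>p \<sigma> v. if p = \<sigma> \<and> v \<in> A then 1 else 0"])
  fix p \<sigma> u v assume "p \<in> ?T" "\<sigma> \<in> ?T" "u \<in> \<sigma>" "v \<in> \<sigma>"
  then show "xvar u * xvar v \<in> I
      \<or> (if p = \<sigma> \<and> u \<in> A then 1 else 0) = (if p = \<sigma> \<and> v \<in> A then 1 else (0 :: 'k))"
    using AB(2)[of u v] AB(2)[of v u] by (auto simp: mult.commute)
next
  fix a :: "'v set \<Rightarrow> 'k"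
  assume c: "\<And>\<sigma>. \<sigma> \<in> ?T \<Longrightarrow> \<exists>c. \<forall>v\<in>\<sigma>. (\<Sum>p\<in>?T. a p * (if p = \<sigma> \<and> v \<in> A then 1 else 0)) = c"
  show "\<forall>p\<in>?T. a p = 0"
  proof
    fix \<sigma> assume \<sigma>: "\<sigma> \<in> ?T"
    have s: "(\<Sum>p\<in>?T. a p * (if p = \<sigma> \<and> v \<in> A then 1 else 0)) = (if v \<in> A then a \<sigma> else 0)" for v
    proof -
      have "(\<Sum>p\<in>?T. a p * (if p = \<sigma> \<and> v \<in> A then 1 else 0))
          = (\<Sum>p\<in>?T. if p = \<sigma> then (if v \<in> A then a \<sigma> else 0) else 0)"
        by (intro sum.cong) auto
      then show ?thesis using \<sigma> by (simp add: sum.delta)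
    qed
    obtain u v where uv: "u \<in> \<sigma>" "u \<in> A" "v \<in> \<sigma>" "v \<in> B" using \<sigma> by blast
    obtain c where c: "\<forall>v\<in>\<sigma>. (if v \<in> A then a \<sigma> else 0) = c" using c[OF \<sigma>] unfolding s by blast
    have "v \<notin> A" using uv AB(1) by blast
    then show "a \<sigma> = 0" using bspec[OF c uv(1)] bspec[OF c uv(3)] uv(2) by simp
  qed
qed auto

lemma card_supersets_le:
  fixes V :: "'v set"
  assumes "e \<subseteq> V" "card e = 2"
  shows "card {\<sigma>. \<sigma> \<subseteq> V \<and> card \<sigma> = Suc i \<and> e \<subseteq> \<sigma>} \<le> (card V - 2) choose (i - 1)"
proof -
  let ?S = "{\<sigma>. \<sigma> \<subseteq> V \<and> card \<sigma> = Suc i \<and> e \<subseteq> \<sigma>}"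
  have "inj_on (\<lambda>\<sigma>. \<sigma> - e) ?S" by (rule inj_onI) blast
  moreover have "(\<lambda>\<sigma>. \<sigma> - e) ` ?S \<subseteq> {\<tau>. \<tau> \<subseteq> V - e \<and> card \<tau> = i - 1}"
    using assms(2) by (auto simp: card_Diff_subset)
  ultimately have "card ?S \<le> card {\<tau>. \<tau> \<subseteq> V - e \<and> card \<tau> = i - 1}"
    by (intro card_inj_on_le) auto
  also have "\<dots> = card (V - e) choose (i - 1)" by (intro n_subsets) auto
  also have "card (V - e) = card V - 2" using assms by (simp add: card_Diff_subset)
  finally show ?thesis .
qed

text \<open>For each \<sigma> of size \<open>Suc i\<close>, functions modulo constants have
  dimension \<open>i\<close>, and every edge inside \<sigma> imposes one condition. An edge lies in
  at most \<open>(card V - 2) choose (i - 1)\<close> such sets. The additive form avoids truncated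
  subtraction.\<close>

lemma betti_ge_graph:
  fixes V :: "'v set" and E :: "'v set set"
  assumes lin: "\<And>p v. p \<in> I \<Longrightarrow> lookup p (ind {v}) = 0"
    and E: "\<And>e. e \<in> E \<Longrightarrow> e \<subseteq> V \<and> card e = 2"
    and nonE: "\<And>u v. u \<in> V \<Longrightarrow> v \<in> V \<Longrightarrow> u \<noteq> v \<Longrightarrow> {u, v} \<notin> E \<Longrightarrow> xvar u * xvar v \<in> I"
  shows "i * (card V choose Suc i) \<le> b i + card E * ((card V - 2) choose (i - 1))"
proof -
  define T where "T = {\<sigma>. \<sigma> \<subseteq> V \<and> card \<sigma> = Suc i}"
  have cT: "card T = card V choose Suc i" unfolding T_def by (intro n_subsets) auto
  \<comment> \<open>Functions modulo constants are represented by those vanishing at a chosen vertex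
    of \<sigma>; the values at the other vertices are the unknowns in \<open>Q\<close>.\<close>
  define base where "base \<sigma> = (SOME v. v \<in> \<sigma>)" for \<sigma> :: "'v set"
  have base: "base \<sigma> \<in> \<sigma>" if "\<sigma> \<in> T" for \<sigma>
  proof -
    have "\<sigma> \<noteq> {}" using that by (auto simp: T_def)
    then show ?thesis unfolding base_def by (rule some_in_eq[THEN iffD2])
  qed
  define Q where "Q = Sigma T (\<lambda>\<sigma>. \<sigma> - {base \<sigma>})"
  define G where "G = Sigma T (\<lambda>\<sigma>. {e \<in> E. e \<subseteq> \<sigma>})"
  have "\<forall>e\<in>E. \<exists>u v. e = {u, v} \<and> u \<noteq> v" using E by (auto simp: card_2_iff)
  then obtain hd tl where ht: "\<And>e. e \<in> E \<Longrightarrow> e = {hd e, tl e}" by metis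
  \<comment> \<open>The equation of an edge equates the values at its two ends. An end that is the
    base vertex is not in \<open>Q\<close> and thus counts as value zero.\<close>
  define eq :: "('v set \<times> 'v set) \<Rightarrow> ('v set \<times> 'v) \<Rightarrow> 'k"
    where "eq g q = (if q = (fst g, hd (snd g)) then 1 else 0) - (if q = (fst g, tl (snd g)) then 1 else 0)" for g q
  have finQ: "finite Q" and finG: "finite G" by simp_all
  have "card Q = (\<Sum>\<sigma>\<in>T. card (\<sigma> - {base \<sigma>}))" by (simp add: Q_def)
  also have "\<dots> = (\<Sum>\<sigma>\<in>T. i)" using base by (intro sum.cong) (auto simp: T_def)
  finally have cQ: "card Q = i * (card V choose Suc i)" by (simp add: cT)
  have "card G = (\<Sum>\<sigma>\<in>T. card {e \<in> E. e \<subseteq> \<sigma>})" by (simp add: G_def)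
  also have "\<dots> = (\<Sum>e\<in>E. card {\<sigma> \<in> T. e \<subseteq> \<sigma>})" by (intro sum_multicount_gen) auto
  also have "\<dots> \<le> (\<Sum>e\<in>E. (card V - 2) choose (i - 1))"
  proof (intro sum_mono)
    fix e assume "e \<in> E"
    then have "card {\<sigma>. \<sigma> \<subseteq> V \<and> card \<sigma> = Suc i \<and> e \<subseteq> \<sigma>} \<le> (card V - 2) choose (i - 1)"
      using E by (intro card_supersets_le) auto
    moreover have "{\<sigma> \<in> T. e \<subseteq> \<sigma>} = {\<sigma>. \<sigma> \<subseteq> V \<and> card \<sigma> = Suc i \<and> e \<subseteq> \<sigma>}" by (auto simp: T_def)
    ultimately show "card {\<sigma> \<in> T. e \<subseteq> \<sigma>} \<le> (card V - 2) choose (i - 1)" by simp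
  qed
  finally have cG: "card G \<le> card E * ((card V - 2) choose (i - 1))" by simp
  obtain P :: "nat set" and f where P: "finite P" "card P = card Q - card G"
    and sol: "\<forall>p\<in>P. \<forall>g\<in>G. (\<Sum>q\<in>Q. eq g q * f p q) = 0"
    and indep: "\<And>a. (\<forall>q\<in>Q. (\<Sum>p\<in>P. a p * f p q) = 0) \<Longrightarrow> (\<forall>p\<in>P. a p = 0)"
    using independent_solutions[OF finQ finG, of eq] by blast
  define F where "F p \<sigma> v = (if (\<sigma>, v) \<in> Q then f p (\<sigma>, v) else 0)" for p \<sigma> v
  have Feq: "F p \<sigma> (hd e) = F p \<sigma> (tl e)" if p: "p \<in> P" and g: "(\<sigma>, e) \<in> G" for p \<sigma> e
  proof -
    have "(\<Sum>q\<in>Q. eq (\<sigma>, e) q * f p q)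
        = (\<Sum>q\<in>Q. if q = (\<sigma>, hd e) then f p q else 0) - (\<Sum>q\<in>Q. if q = (\<sigma>, tl e) then f p q else 0)"
      unfolding sum_subtractf[symmetric] by (intro sum.cong) (auto simp: eq_def)
    also have "\<dots> = F p \<sigma> (hd e) - F p \<sigma> (tl e)" using finQ by (simp add: sum.delta F_def)
    finally show ?thesis using sol p g by simp
  qed
  have "card P \<le> b i"
  proof (rule linear_strand_bound[OF lin P(1), of T i F])
    fix p \<sigma> u v assume h: "p \<in> P" "\<sigma> \<in> T" "u \<in> \<sigma>" "v \<in> \<sigma>" "u \<noteq> v"
    show "xvar u * xvar v \<in> I \<or> F p \<sigma> u = F p \<sigma> v"
    proof (cases "{u, v} \<in> E")
      case True
      then have "(\<sigma>, {u, v}) \<in> G" using h by (auto simp: G_def)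
      from Feq[OF h(1) this] ht[OF True] show ?thesis by (auto simp: doubleton_eq_iff)
    next
      case False
      then show ?thesis using nonE[of u v] h by (auto simp: T_def)
    qed
  next
    fix a :: "nat \<Rightarrow> 'k"
    assume c: "\<And>\<sigma>. \<sigma> \<in> T \<Longrightarrow> \<exists>c. \<forall>v\<in>\<sigma>. (\<Sum>p\<in>P. a p * F p \<sigma> v) = c"
    have "(\<Sum>p\<in>P. a p * f p q) = 0" if q: "q \<in> Q" for q
    proof -
      obtain \<sigma> v where \<sigma>: "q = (\<sigma>, v)" "\<sigma> \<in> T" "v \<in> \<sigma>" using q by (auto simp: Q_def)
      from c[OF \<sigma>(2)] obtain c where c: "\<forall>v\<in>\<sigma>. (\<Sum>p\<in>P. a p * F p \<sigma> v) = c" by blast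
      have "(\<Sum>p\<in>P. a p * F p \<sigma> v) = (\<Sum>p\<in>P. a p * F p \<sigma> (base \<sigma>))"
        using c base[OF \<sigma>(2)] \<sigma>(3) by simp
      also have "\<dots> = 0" by (simp add: F_def Q_def)
      finally show ?thesis using q \<sigma>(1) by (simp add: F_def)
    qed
    then show "\<forall>p\<in>P. a p = 0" using indep by blast
  qed (auto simp: T_def)
  then show ?thesis using P(2) cQ cG by linarith
qed

text \<open>Otherwise the functions \<open>C e\<close>, one for each edge, together with the
  constant 1 would be more than \<open>card V\<close> functions on \<open>V\<close>, hence
  dependent. Differences along an edge remove the constant and isolate the coefficient of that edge,
  so all coefficients vanish.\<close>

lemma ex_edge_not_coboundary:
  fixes hd tl :: "'v set \<Rightarrow> 'v" and V :: "'v set" and E :: "'v set set"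
  assumes "card V \<le> card E" "V \<noteq> {}" and E: "\<And>e. e \<in> E \<Longrightarrow> hd e \<in> V \<and> tl e \<in> V"
  shows "\<exists>e0\<in>E. \<forall>C :: 'v \<Rightarrow> 'k. \<not> (\<forall>e\<in>E. C (hd e) - C (tl e) = (if e = e0 then 1 else 0))"
proof (rule ccontr)
  assume "\<not> ?thesis"
  then have "\<forall>e0\<in>E. \<exists>C :: 'v \<Rightarrow> 'k. \<forall>e\<in>E. C (hd e) - C (tl e) = (if e = e0 then 1 else 0)" by blast
  then obtain C :: "'v set \<Rightarrow> 'v \<Rightarrow> 'k"
    where C: "\<And>e0 e. e0 \<in> E \<Longrightarrow> e \<in> E \<Longrightarrow> C e0 (hd e) - C e0 (tl e) = (if e = e0 then 1 else 0)" by metis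
  let ?Q = "insert None (Some ` E)"
  define eq where "eq v q = (case q of None \<Rightarrow> 1 | Some e \<Rightarrow> C e v)" for v q
  have fin: "finite E" by simp
  have "card ?Q = Suc (card E)" by (simp add: card_image)
  then have "card V < card ?Q" using assms(1) by simp
  then obtain f where f: "\<exists>q\<in>?Q. f q \<noteq> 0" "\<forall>v\<in>V. (\<Sum>q\<in>?Q. eq v q * f q) = 0"
    using nontrivial_solution[of ?Q V eq] by auto
  have s: "f None + (\<Sum>e\<in>E. C e v * f (Some e)) = 0" if "v \<in> V" for v
  proof -
    have "(\<Sum>q\<in>?Q. eq v q * f q) = f None + (\<Sum>q\<in>Some ` E. eq v q * f q)"
      by (subst sum.insert) (auto simp: eq_def)
    also have "(\<Sum>q\<in>Some ` E. eq v q * f q) = (\<Sum>e\<in>E. C e v * f (Some e))"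
      by (subst sum.reindex) (auto simp: eq_def)
    finally show ?thesis using f(2) that by simp
  qed
  have fE: "f (Some e) = 0" if e: "e \<in> E" for e
  proof -
    have "0 = (\<Sum>e'\<in>E. C e' (hd e) * f (Some e')) - (\<Sum>e'\<in>E. C e' (tl e) * f (Some e'))"
      using s[of "hd e"] s[of "tl e"] E[OF e] by (metis add_left_cancel diff_self)
    also have "\<dots> = (\<Sum>e'\<in>E. (C e' (hd e) - C e' (tl e)) * f (Some e'))"
      by (simp add: sum_subtractf left_diff_distrib)
    also have "\<dots> = (\<Sum>e'\<in>E. if e' = e then f (Some e') else 0)"
      using C e by (intro sum.cong) auto
    finally show ?thesis using e by (simp add: sum.delta)
  qed
  obtain v where "v \<in> V" using assms(2) by blast
  from s[OF this] have "f None = 0" using fE by simp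
  then show False using f(1) fE by auto
qed

text \<open>On a graph without triangles every edge gives a cocycle in the top multidegree; if there are
  at least as many edges as vertices, one of them is not a coboundary.\<close>

lemma betti_ge_one_cycle:
  fixes V :: "'v set" and E :: "'v set set"
  assumes E: "\<And>e. e \<in> E \<Longrightarrow> e \<subseteq> V \<and> card e = 2"
    and quad: "\<And>p e. p \<in> I \<Longrightarrow> e \<in> E \<Longrightarrow> lookup p (ind e) = 0"
    and triple: "\<And>e w. e \<in> E \<Longrightarrow> w \<in> V \<Longrightarrow> w \<notin> e \<Longrightarrow> xvar w * monom (ind e) \<in> I"
    and card: "card V \<le> card E" "V \<noteq> {}"
  shows "1 \<le> b (card V - 2)"
proof -
  have "\<forall>e\<in>E. \<exists>u v. e = {u, v} \<and> u \<noteq> v" using E by (auto simp: card_2_iff)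
  then obtain hd tl where ht: "\<And>e. e \<in> E \<Longrightarrow> e = {hd e, tl e} \<and> hd e \<noteq> tl e" by metis
  have htV: "hd e \<in> V \<and> tl e \<in> V" if "e \<in> E" for e using ht[OF that] E[OF that] by blast
  obtain e0 where e0: "e0 \<in> E"
    "\<And>C :: 'v \<Rightarrow> 'k. \<not> (\<forall>e\<in>E. C (hd e) - C (tl e) = (if e = e0 then 1 else 0))"
    using ex_edge_not_coboundary[OF card, of hd tl] htV by blast
  \<comment> \<open>A single term, the edge monomial of \<open>e0\<close> at \<open>V - e0\<close>.
    It is a cycle modulo \<open>I\<close> because multiplying the monomial by any further vertex
    gives an element of \<open>I\<close>.\<close>
  define z :: "unit \<Rightarrow> 'v set \<Rightarrow> ('v, 'k) mpoly" where "z p A = (if A = V - e0 then monom (ind e0) else 0)" for p A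
  have "card {()} \<le> b (card V - 2)"
  proof (rule card_koszul_cycles_le[of _ _ z])
    fix p and A :: "'v set" assume "card A \<noteq> card V - 2"
    then have "A \<noteq> V - e0" using E[OF e0(1)] by (auto simp: card_Diff_subset)
    then show "z p A = 0" by (simp add: z_def)
  next
    fix p and A :: "'v set"
    have "ksign v A * (xvar v * z p (insert v A)) \<in> I" if "v \<in> - A" for v
    proof (cases "insert v A = V - e0")
      case True
      then have "xvar v * monom (ind e0) \<in> I" using triple[OF e0(1), of v] by blast
      then show ?thesis using True ideal_mult[OF idl] by (simp add: z_def)
    qed (simp add: z_def ideal_zero[OF idl])
    then show "bd (z p) A \<in> I" unfolding bd_def by (intro ideal_sum idl)
  next
    fix a :: "unit \<Rightarrow> 'k" and y
    assume bnd: "\<And>A. (\<Sum>p\<in>{()}. single 0 (a p) * z p A) - bd y A \<in> I"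
    \<comment> \<open>If \<open>a ()\<close> times \<open>z\<close> bounds \<open>y\<close> modulo
      \<open>I\<close>, the coefficients of \<open>x_w\<close> in \<open>y (V - {w})\<close>,
      corrected by the sign \<open>t w\<close>, form a function \<open>C\<close> on the vertices.
      Its coboundary is, up to the signs \<open>s e\<close>, \<open>a ()\<close> times the indicator
      of \<open>e0\<close>.\<close>
    define t :: "'v \<Rightarrow> 'k" where "t w = ksign w (V - {w})" for w
    define C where "C w = t w * lookup (y (V - {w})) (ind {w})" for w
    define s :: "'v set \<Rightarrow> 'k" where "s e = ksign (hd e) (V - e) * t (tl e)" for e
    have tt: "t w * (t w * x) = x" for w x by (simp add: t_def)
    have ss: "s e * s e = 1" for e
      by (simp add: s_def t_def mult.assoc mult.left_commute[of _ "ksign (hd e) _"])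
    have main: "s e * (C (tl e) - C (hd e)) = a () * (if e = e0 then 1 else 0)" if e: "e \<in> E" for e
    proof -
      define u v A where "u = hd e" and "v = tl e" and "A = V - e"
      have uv: "e = {u, v}" "u \<noteq> v" "u \<in> V" "v \<in> V" using ht[OF e] htV[OF e] by (auto simp: u_def v_def)
      have A: "u \<notin> A" "v \<notin> A" "insert u A = V - {v}" "insert v A = V - {u}" using uv by (auto simp: A_def)
      have "e - A = {u, v}" using uv A by auto
      then have bd: "lookup (bd y A) (ind e)
          = ksign u A * lookup (y (V - {v})) (ind {v}) + ksign v A * lookup (y (V - {u})) (ind {u})"
        unfolding lookup_bd_ind using uv A by (simp add: insert_Diff_if)
      have zz: "lookup (z () A) (ind e) = (if e = e0 then 1 else 0)"
      proof -
        have "A = V - e0 \<longleftrightarrow> e = e0" using E[OF e] E[OF e0(1)] by (auto simp: A_def)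
        then show ?thesis by (simp add: z_def monom_def)
      qed
      have "ksign u A * lookup (y (V - {v})) (ind {v}) + ksign v A * lookup (y (V - {u})) (ind {u})
          = a () * (if e = e0 then 1 else 0)"
        using quad[OF bnd[of A] e] by (simp only: lookup_minus lookup_scale bd zz sum.insert sum.empty
              finite.emptyI empty_iff not_False_eq_True add_0_right right_minus_eq eq_commute) simp
      moreover have "ksign u A * lookup (y (V - {v})) (ind {v}) = s e * C v"
        by (simp add: s_def C_def u_def[symmetric] v_def[symmetric] A_def[symmetric] mult.assoc tt)
      moreover have "ksign v A * lookup (y (V - {u})) (ind {u}) = - (s e * C u)"
      proof -
        have "s e = ksign u A * ksign v (insert u A)"
          by (simp only: s_def t_def A(3) flip: u_def v_def A_def)
        also have "\<dots> = - (ksign v A * ksign u (insert v A))"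
          using uv A by (intro ksign_swap') auto
        finally have "s e = - (ksign v A * t u)" by (simp only: t_def A(4))
        then show ?thesis by (simp add: C_def mult.assoc tt)
      qed
      ultimately show ?thesis by (simp add: u_def v_def right_diff_distrib)
    qed
    show "\<forall>p\<in>{()}. a p = 0"
    proof (rule ccontr)
      assume "\<not> ?thesis"
      then have a: "a () \<noteq> 0" by simp
      define C' where "C' w = - (s e0 / a ()) * C w" for w
      have "C' (hd e) - C' (tl e) = (if e = e0 then 1 else 0)" if e: "e \<in> E" for e
      proof -
        have "C (tl e) - C (hd e) = s e * (s e * (C (tl e) - C (hd e)))"
          by (simp add: mult.assoc[symmetric] ss)
        also have "\<dots> = (if e = e0 then s e0 * a () else 0)" unfolding main[OF e] by simp
        finally have "C (tl e) - C (hd e) = (if e = e0 then s e0 * a () else 0)" .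
        moreover have "C' (hd e) - C' (tl e) = (s e0 / a ()) * (C (tl e) - C (hd e))"
          by (simp add: C'_def algebra_simps)
        ultimately show ?thesis using a ss[of e0] by simp
      qed
      then show False using e0(2)[of C'] by blast
    qed
  qed auto
  then show ?thesis by simp
qed

end

section \<open>The complex of a nearly complete intersection\<close>

lemma exp_dvd_ind_right: "exp_dvd \<beta> (ind X) \<longleftrightarrow> (\<exists>Y\<subseteq>X. \<beta> = ind Y)"
proof
  assume d: "exp_dvd \<beta> (ind X)"
  have le: "lookup \<beta> v \<le> (if v \<in> X then 1 else 0)" for v using d by (simp add: exp_dvd_def)
  have "lookup \<beta> v \<le> 1" for v using le[of v] by (auto split: if_splits)
  then have "squarefree_exp \<beta>" by (simp add: squarefree_exp_def)
  moreover have "keys \<beta> \<subseteq> X"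
  proof
    fix v assume "v \<in> keys \<beta>"
    then show "v \<in> X" using le[of v] by (auto simp: in_keys_iff split: if_splits)
  qed
  ultimately show "\<exists>Y\<subseteq>X. \<beta> = ind Y" using squarefree_exp_eq_ind by blast
next
  assume "\<exists>Y\<subseteq>X. \<beta> = ind Y"
  then show "exp_dvd \<beta> (ind X)" by (auto simp: exp_dvd_def)
qed

lemma ind_mem_min_gens_iff: "ind X \<in> min_gens J \<longleftrightarrow> minimal_set (\<lambda>Y. monom (ind Y) \<in> J) X"
proof -
  have "(\<forall>\<beta>. exp_dvd \<beta> (ind X) \<and> \<beta> \<noteq> ind X \<longrightarrow> monom \<beta> \<notin> J)
      \<longleftrightarrow> (\<forall>Y. Y \<subset> X \<longrightarrow> monom (ind Y) \<notin> J)"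
  proof (intro iffI allI impI)
    fix Y assume "\<forall>\<beta>. exp_dvd \<beta> (ind X) \<and> \<beta> \<noteq> ind X \<longrightarrow> monom \<beta> \<notin> J" "Y \<subset> X"
    moreover have "exp_dvd (ind Y) (ind X)" "ind Y \<noteq> ind X"
      using \<open>Y \<subset> X\<close> exp_dvd_ind_right[of "ind Y" X] by auto
    ultimately show "monom (ind Y) \<notin> J" by blast
  next
    fix \<beta> assume h: "\<forall>Y. Y \<subset> X \<longrightarrow> monom (ind Y) \<notin> J" and \<beta>: "exp_dvd \<beta> (ind X) \<and> \<beta> \<noteq> ind X"
    then obtain Y where "Y \<subseteq> X" "\<beta> = ind Y" unfolding exp_dvd_ind_right by blast
    then show "monom \<beta> \<notin> J" using h \<beta> by blast
  qed
  then show ?thesis by (simp add: min_gens_def minimal_set_def)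
qed

lemma update_ind: "Poly_Mapping.update x 0 (ind X) = ind (X - {x})"
  by (intro poly_mapping_eqI) (auto simp: lookup_update)

locale nci_ideal =
  fixes I :: "('v::finite, 'k::field) mpoly set"
  assumes nci: "NCI I"
begin

lemma monomial_generators:
  obtains A where "finite A" "\<And>\<alpha>. \<alpha> \<in> A \<Longrightarrow> squarefree_exp \<alpha>" "I = ideal_gen (monom ` A)"
proof -
  obtain A where A: "\<forall>\<alpha>\<in>A. squarefree_exp \<alpha>" "I = ideal_gen (monom ` A)"
    using nci unfolding NCI_def squarefree_monomial_ideal_def by blast
  have "A \<subseteq> range ind" using A(1) squarefree_exp_eq_ind by blast
  then have "finite A" by (rule finite_subset) simp
  then show ?thesis using that A by blast
qed

lemma is_ideal_I: "is_ideal I"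
  using monomial_generators is_ideal_ideal_gen by metis

lemma keys_mem: "p \<in> I \<Longrightarrow> \<alpha> \<in> keys p \<Longrightarrow> monom \<alpha> \<in> I"
proof -
  obtain A where A: "I = ideal_gen (monom ` A)" using monomial_generators by blast
  show "p \<in> I \<Longrightarrow> \<alpha> \<in> keys p \<Longrightarrow> monom \<alpha> \<in> I"
    unfolding A monom_mem_ideal_gen_iff by (simp add: mem_ideal_gen_monom_iff)
qed

lemma min_gens_ind: "\<mu> \<in> min_gens I \<Longrightarrow> \<mu> = ind (keys \<mu>)"
proof -
  assume \<mu>: "\<mu> \<in> min_gens I"
  obtain A where A: "\<And>\<alpha>. \<alpha> \<in> A \<Longrightarrow> squarefree_exp \<alpha>" "I = ideal_gen (monom ` A)"
    using monomial_generators by blast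
  then have "\<mu> \<in> A" using min_gens_subset \<mu> by blast
  then show ?thesis using A(1) squarefree_exp_eq_ind by blast
qed

definition nonface :: "'v set \<Rightarrow> bool" where
  "nonface X \<longleftrightarrow> monom (ind X) \<in> I"

lemma minimal_nonface_iff: "minimal_set nonface X \<longleftrightarrow> ind X \<in> min_gens I"
  unfolding nonface_def[abs_def] ind_mem_min_gens_iff ..

lemma nonface_iff: "nonface X \<longleftrightarrow> (\<exists>Y\<subseteq>X. ind Y \<in> min_gens I)"
proof
  assume "nonface X"
  then obtain \<mu> where \<mu>: "\<mu> \<in> min_gens I" "exp_dvd \<mu> (ind X)"
    unfolding nonface_def using ex_min_gen_dvd by blast
  then show "\<exists>Y\<subseteq>X. ind Y \<in> min_gens I" unfolding exp_dvd_ind_right by blast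
next
  assume "\<exists>Y\<subseteq>X. ind Y \<in> min_gens I"
  then obtain Y where Y: "Y \<subseteq> X" "ind Y \<in> min_gens I" by blast
  obtain A where A: "I = ideal_gen (monom ` A)" using monomial_generators by blast
  have "ind Y \<in> A" using Y(2) min_gens_subset[of A, where 'k = 'k] unfolding A by blast
  moreover have "exp_dvd (ind Y) (ind X)" using Y(1) unfolding exp_dvd_ind_right by blast
  ultimately have "monom (ind X) \<in> (ideal_gen (monom ` A) :: ('v, 'k) mpoly set)"
    unfolding monom_mem_ideal_gen_iff by blast
  then have "monom (ind X) \<in> I" unfolding A .
  then show "nonface X" by (simp add: nonface_def)
qed

lemma set_var_one_eq: "set_var_one x I = ideal_gen (monom ` Poly_Mapping.update x 0 ` min_gens I)"
  unfolding set_var_one_def image_image ..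

text \<open>The squarefree monomials of \<open>I(x = 1)\<close> are the nonfaces of the star of
  \<open>x\<close>. The star is a cone over the link, so both have the same minimal
  nonfaces.\<close>

lemma mem_set_var_one_iff: "monom (ind Y) \<in> set_var_one x I \<longleftrightarrow> nonface (insert x Y)"
proof -
  have "monom (ind Y) \<in> set_var_one x I \<longleftrightarrow> (\<exists>\<mu>\<in>min_gens I. exp_dvd (Poly_Mapping.update x 0 \<mu>) (ind Y))"
    unfolding set_var_one_eq monom_mem_ideal_gen_iff by simp
  also have "\<dots> \<longleftrightarrow> (\<exists>X. ind X \<in> min_gens I \<and> exp_dvd (Poly_Mapping.update x 0 (ind X)) (ind Y))"
    using min_gens_ind by metis
  also have "\<dots> \<longleftrightarrow> (\<exists>X. ind X \<in> min_gens I \<and> X - {x} \<subseteq> Y)"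
    unfolding update_ind exp_dvd_ind_right by simp
  also have "\<dots> \<longleftrightarrow> nonface (insert x Y)" unfolding nonface_iff by blast
  finally show ?thesis .
qed

lemma finite_min_gens: "finite (min_gens I)"
proof -
  obtain A where "finite A" "I = ideal_gen (monom ` A)" using monomial_generators by blast
  then show ?thesis using min_gens_subset finite_subset by blast
qed

lemma ideal_gen_min_gens_I: "ideal_gen (monom ` min_gens I) = I"
proof -
  obtain A where A: "I = ideal_gen (monom ` A)" using monomial_generators by blast
  show ?thesis unfolding A by (rule ideal_gen_min_gens)
qed

lemma min_gens_deg: "\<mu> \<in> min_gens I \<Longrightarrow> 2 \<le> exp_deg \<mu>"
  using nci by (simp add: NCI_def)

text \<open>Here the algebra is traded for combinatorics. Disjointness in the links uses that
  monomial complete intersections have coprime generators, and \<open>not_disjoint\<close> uses the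
  converse for \<open>I\<close> itself.\<close>

sublocale nci_complex "mon_support I" nonface
proof
  show "nonface Y" if "nonface X" "X \<subseteq> Y" for X Y using that unfolding nonface_iff by blast
  show "X \<subseteq> mon_support I" if "minimal_set nonface X" for X
    using that by (auto simp: minimal_nonface_iff mon_support_def intro!: bexI[of _ "ind X"])
  show "2 \<le> card X" if "minimal_set nonface X" for X
    using min_gens_deg[of "ind X"] that by (simp add: minimal_nonface_iff)
  show "X \<inter> Y = {}" if x: "x \<in> mon_support I" and XY: "minimal_set (\<lambda>X. nonface (insert x X)) X"
    "minimal_set (\<lambda>X. nonface (insert x X)) Y" "X \<noteq> Y" for x X Y
  proof -
    have "ind X \<in> min_gens (set_var_one x I)" "ind Y \<in> min_gens (set_var_one x I)"
      using XY by (simp_all add: ind_mem_min_gens_iff mem_set_var_one_iff)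
    moreover have "complete_intersection (set_var_one x I)" using nci x by (simp add: NCI_def)
    ultimately have "keys (ind X) \<inter> keys (ind Y) = {}"
      using XY(3) finite_min_gens unfolding set_var_one_eq
      by (intro complete_intersection_min_gens_disjoint) auto
    then show ?thesis by simp
  qed
  show "\<exists>X Y. minimal_set nonface X \<and> minimal_set nonface Y \<and> X \<noteq> Y \<and> X \<inter> Y \<noteq> {}"
  proof (rule ccontr)
    assume n: "\<not> ?thesis"
    have "complete_intersection (ideal_gen (monom ` min_gens I) :: ('v, 'k) mpoly set)"
    proof (rule complete_intersection_disjoint[OF finite_min_gens])
      show "0 \<notin> min_gens I" using min_gens_deg[of 0] by (auto simp: exp_deg_def)
      fix \<alpha> \<beta> assume h: "\<alpha> \<in> min_gens I" "\<beta> \<in> min_gens I" "\<alpha> \<noteq> \<beta>"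
      then have "minimal_set nonface (keys \<alpha>)" "minimal_set nonface (keys \<beta>)" "keys \<alpha> \<noteq> keys \<beta>"
        using min_gens_ind unfolding minimal_nonface_iff by metis+
      then show "keys \<alpha> \<inter> keys \<beta> = {}" using n by blast
    qed
    then show False using nci unfolding ideal_gen_min_gens_I NCI_def by blast
  qed
qed

lemma lookup_face: "p \<in> I \<Longrightarrow> \<not> nonface X \<Longrightarrow> lookup p (ind X) = 0"
  using keys_mem[of p "ind X"] by (auto simp: nonface_def in_keys_iff)

lemma xvar_mult_mem_iff: "u \<noteq> v \<Longrightarrow> xvar u * xvar v \<in> I \<longleftrightarrow> nonface {u, v}"
  by (simp add: xvar_pair nonface_def)

text \<open>No generator is supported inside a face \<open>X\<close>, so \<open>I\<close> lies in
  the prime generated by the support variables outside \<open>X\<close>. A vertex gives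
  \<open>c\<close> at most \<open>n - 1\<close>, an edge at most \<open>n - 2\<close>.\<close>

lemma height_le:
  assumes "ideal_height I = enat c" "\<not> nonface X" "X \<subseteq> mon_support I"
  shows "c \<le> card (mon_support I) - card X"
proof -
  let ?W = "mon_support I - X"
  have "I \<subseteq> var_ideal ?W"
  proof
    fix p assume p: "p \<in> I"
    show "p \<in> var_ideal ?W"
      unfolding var_ideal_def
    proof (clarify)
      fix \<alpha> assume "\<alpha> \<in> keys p"
      then have "monom \<alpha> \<in> I" using keys_mem p by blast
      then obtain \<mu> where \<mu>: "\<mu> \<in> min_gens I" "exp_dvd \<mu> \<alpha>" using ex_min_gen_dvd by blast
      have m: "\<mu> = ind (keys \<mu>)" using min_gens_ind[OF \<mu>(1)] .
      then have "\<not> keys \<mu> \<subseteq> X" using assms(2) \<mu>(1) unfolding nonface_iff by metis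
      then obtain w where w: "w \<in> keys \<mu>" "w \<notin> X" by blast
      have "w \<in> mon_support I" using w \<mu>(1) by (auto simp: mon_support_def in_keys_iff)
      moreover have "lookup \<alpha> w \<noteq> 0"
        using \<mu>(2) w(1) unfolding exp_dvd_def in_keys_iff by (metis le_zero_eq)
      ultimately show "\<exists>w\<in>?W. lookup \<alpha> w \<noteq> 0" using w by blast
    qed
  qed
  then have "enat c \<le> enat (card ?W)" using ideal_height_le_card assms(1) by metis
  then show ?thesis using assms(3) by (simp add: card_Diff_subset)
qed

end

section \<open>Counting estimates for the total Betti number\<close>

lemma sum_weighted_choose: "(\<Sum>i<n. i * (n choose Suc i)) + 2 ^ n = n * 2 ^ (n - 1) + (1 :: nat)"
proof -
  have "(\<Sum>i\<le>n. i * (n choose i)) = (\<Sum>i<n. Suc i * (n choose Suc i))"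
    by (simp add: lessThan_Suc_atMost[symmetric] sum.lessThan_Suc_shift del: sum.lessThan_Suc)
  then have 1: "(\<Sum>i<n. Suc i * (n choose Suc i)) = n * 2 ^ (n - 1)" by (simp add: choose_linear_sum)
  have "(\<Sum>i\<le>n. n choose i) = 1 + (\<Sum>i<n. n choose Suc i)"
    by (simp add: lessThan_Suc_atMost[symmetric] sum.lessThan_Suc_shift del: sum.lessThan_Suc)
  then have 2: "1 + (\<Sum>i<n. n choose Suc i) = 2 ^ n" by (simp add: choose_row_sum)
  have "(\<Sum>i<n. Suc i * (n choose Suc i)) = (\<Sum>i<n. n choose Suc i) + (\<Sum>i<n. i * (n choose Suc i))"
    by (simp add: sum.distrib)
  then show ?thesis using 1 2 by linarith
qed

text \<open>Equivalent to (2^(a-1) - 1) (2^(b-1) - 1) >= 0. Equality occurs when one part is a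
  single vertex.\<close>

lemma two_power_split_le:
  assumes "1 \<le> a" "1 \<le> (b :: nat)"
  shows "2 ^ a + 2 ^ b \<le> (2 ^ (a + b - 1) + 2 :: nat)"
proof -
  obtain x where x: "a = Suc x" using assms(1) by (cases a) auto
  obtain y where y: "b = Suc y" using assms(2) by (cases b) auto
  have "(2 ^ x - 1) * (2 ^ y - 1) \<ge> (0 :: int)" by simp
  then have "int (2 ^ x + 2 ^ y) \<le> int (2 ^ x * 2 ^ y + 1)" by (simp add: algebra_simps)
  then have "2 ^ x + 2 ^ y \<le> (2 ^ x * 2 ^ y + 1 :: nat)" by linarith
  then show ?thesis by (simp add: x y power_add)
qed

locale nci_resolution = nci_ideal I + resolution I b d
  for I :: "('v::finite, 'k::field) mpoly set" and b d
begin

abbreviation V :: "'v set" where "V \<equiv> mon_support I"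

lemma linear_terms: "p \<in> I \<Longrightarrow> lookup p (ind {v}) = 0"
  by (simp add: lookup_face)

lemma betti_ge: "i * (card V choose Suc i) \<le> b i + card edges * ((card V - 2) choose (i - 1))"
proof (rule betti_ge_graph[OF linear_terms edges_subset])
  fix u v assume "u \<in> V" "v \<in> V" "u \<noteq> v" "{u, v} \<notin> edges"
  then show "xvar u * xvar v \<in> I" unfolding edges_def xvar_mult_mem_iff[OF \<open>u \<noteq> v\<close>]
    by (auto simp: adj_def)
qed

lemma finite_betti: "finite {i. b i \<noteq> 0}"
proof -
  obtain N where N: "\<forall>i>N. b i = 0" using res by (auto simp: min_free_res_def)
  have "i \<le> N" if "b i \<noteq> 0" for i using N that by (meson not_le)
  then have "{i. b i \<noteq> 0} \<subseteq> {..N}" by auto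
  then show ?thesis by (rule finite_subset) simp
qed

definition total :: nat where
  "total = (\<Sum>i | b i \<noteq> 0. b i)"

lemma sum_betti_ge: "finite K \<Longrightarrow> (\<Sum>i\<in>K. b i) \<le> total"
proof -
  assume K: "finite K"
  have "(\<Sum>i\<in>K. b i) = (\<Sum>i\<in>K \<inter> {i. b i \<noteq> 0}. b i)"
    using K by (intro sum.mono_neutral_right) auto
  also have "\<dots> \<le> total" unfolding total_def using finite_betti by (intro sum_mono2) auto
  finally show ?thesis .
qed

text \<open>The graph bounds summed over all degrees; each edge is charged 2^(n-2) times. The
  summand 2 consists of \<open>b 0\<close> and the 1 in \<open>sum_weighted_choose\<close>.\<close>

lemma sum_betti_lower:
  assumes n: "2 \<le> card V"
  shows "card V * 2 ^ (card V - 1) + 2 \<le> total + 2 ^ card V + card edges * 2 ^ (card V - 2)"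
proof -
  let ?n = "card V" and ?m = "card edges"
  \<comment> \<open>The index 0 is dropped because \<open>i - 1\<close> truncates there and would
    charge each edge once more.\<close>
  have "(\<Sum>i<?n. i * (?n choose Suc i)) = (\<Sum>i=1..<?n. i * (?n choose Suc i))"
    by (intro sum.mono_neutral_right) auto
  also have "\<dots> \<le> (\<Sum>i=1..<?n. b i + ?m * ((?n - 2) choose (i - 1)))"
    using betti_ge by (intro sum_mono) auto
  also have "\<dots> = (\<Sum>i=1..<?n. b i) + ?m * (\<Sum>i=1..<?n. (?n - 2) choose (i - 1))"
    by (simp add: sum.distrib sum_distrib_left)
  also have "(\<Sum>i=1..<?n. (?n - 2) choose (i - 1)) = (\<Sum>i\<le>?n - 2. (?n - 2) choose i)"
    using n by (intro sum.reindex_bij_witness[of _ Suc "\<lambda>i. i - 1"]) auto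
  also have "\<dots> = 2 ^ (?n - 2)" by (rule choose_row_sum)
  finally have 1: "(\<Sum>i<?n. i * (?n choose Suc i)) \<le> (\<Sum>i=1..<?n. b i) + ?m * 2 ^ (?n - 2)" .
  have "(\<Sum>i\<in>insert 0 {1..<?n}. b i) = 1 + (\<Sum>i=1..<?n. b i)" using b0 by simp
  then have "1 + (\<Sum>i=1..<?n. b i) \<le> total"
    using sum_betti_ge[of "insert 0 {1..<?n}"] by simp
  then show ?thesis using 1 sum_weighted_choose[of ?n] by linarith
qed

text \<open>Of the 2^n vertex sets, 2^a + 2^b - 1 lie within one side of a splitting into parts of
  sizes a and b. At least 2^(n-1) - 1 sets remain, and \<open>b 0\<close> supplies the missing
  1.\<close>

lemma sum_betti_disconnected:
  assumes "\<not> connected"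
  shows "2 ^ (card V - 1) \<le> total"
proof -
  obtain A where A: "A \<subseteq> V" "A \<noteq> {}" "\<forall>u\<in>A. \<forall>v. adj u v \<longrightarrow> v \<in> A" "A \<noteq> V"
    using assms unfolding connected_def by blast
  define B where "B = V - A"
  have AB: "A \<union> B = V" "A \<inter> B = {}" "B \<noteq> {}" using A by (auto simp: B_def)
  have prod: "xvar u * xvar v \<in> I" if "u \<in> A" "v \<in> B" for u v
  proof -
    have "u \<noteq> v" using that AB by blast
    moreover have "\<not> adj u v" using A(3) that AB by blast
    ultimately show ?thesis using that AB nonadj_iff[of u v] by (auto simp: xvar_mult_mem_iff)
  qed
  define T where "T i = {\<sigma>. \<sigma> \<subseteq> A \<union> B \<and> card \<sigma> = Suc i \<and> \<sigma> \<inter> A \<noteq> {} \<and> \<sigma> \<inter> B \<noteq> {}}" for i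
  define n where "n = card V"
  have "Pow V - (Pow A \<union> Pow B) \<subseteq> (\<Union>i\<in>{1..n}. T i)"
  proof
    fix \<sigma> assume \<sigma>: "\<sigma> \<in> Pow V - (Pow A \<union> Pow B)"
    then obtain u v where uv: "u \<in> \<sigma>" "u \<in> A" "v \<in> \<sigma>" "v \<in> B" using AB by blast
    then have "u \<noteq> v" using AB by blast
    then have c: "2 \<le> card \<sigma>" using uv card_mono[of \<sigma> "{u, v}"] by simp
    have "card \<sigma> \<le> n" unfolding n_def using \<sigma> by (intro card_mono) auto
    then show "\<sigma> \<in> (\<Union>i\<in>{1..n}. T i)"
      using c uv \<sigma> AB by (intro UN_I[of "card \<sigma> - 1"]) (auto simp: T_def)
  qed
  then have "card (Pow V - (Pow A \<union> Pow B)) \<le> card (\<Union>i\<in>{1..n}. T i)" by (intro card_mono) auto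
  also have "\<dots> \<le> (\<Sum>i=1..n. card (T i))" by (rule card_UN_le) simp
  also have "\<dots> \<le> (\<Sum>i=1..n. b i)"
    unfolding T_def using betti_ge_card_split_sets[OF linear_terms AB(2) prod] by (intro sum_mono) auto
  finally have 1: "card (Pow V - (Pow A \<union> Pow B)) \<le> (\<Sum>i=1..n. b i)" .
  have "(\<Sum>i\<in>insert 0 {1..n}. b i) = 1 + (\<Sum>i=1..n. b i)" using b0 by simp
  then have 2: "1 + (\<Sum>i=1..n. b i) \<le> total"
    using sum_betti_ge[of "insert 0 {1..n}"] by simp
  have "card (Pow A \<union> Pow B) + card (Pow A \<inter> Pow B) = 2 ^ card A + 2 ^ card B"
    using card_Un_Int[of "Pow A" "Pow B"] by (simp add: card_Pow)
  moreover have "Pow A \<inter> Pow B = {{}}" using AB by auto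
  ultimately have 3: "card (Pow A \<union> Pow B) + 1 = 2 ^ card A + 2 ^ card B" by simp
  have n: "card A + card B = n" using card_Un_disjoint[of A B] AB by (simp add: n_def)
  have ab: "1 \<le> card A" "1 \<le> card B" using A(2) AB(3) by (simp_all add: Suc_le_eq card_gt_0_iff)
  then have 4: "2 ^ card A + 2 ^ card B \<le> (2 ^ (n - 1) + 2 :: nat)"
    using two_power_split_le[of "card A" "card B"] n by simp
  have "card (Pow V - (Pow A \<union> Pow B)) = 2 ^ n - card (Pow A \<union> Pow B)"
    using AB by (subst card_Diff_subset) (auto simp: card_Pow n_def)
  moreover have "(2 :: nat) ^ n = 2 * 2 ^ (n - 1)" using n ab by (cases n) auto
  ultimately show ?thesis using 1 2 3 4 unfolding n_def by linarith
qed

end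

section \<open>Comparison with the height, case by case\<close>

context nci_resolution
begin

lemma total_eq:
  assumes "\<forall>i>m. b i = 0"
  shows "total = (\<Sum>i\<le>m. b i)"
proof -
  have "i \<le> m" if "b i \<noteq> 0" for i using assms that by (meson not_le)
  then show ?thesis unfolding total_def by (intro sum.mono_neutral_left) auto
qed

lemma betti_132_imp_total: "b 1 = 3 \<Longrightarrow> b 2 = 2 \<Longrightarrow> \<forall>i>2. b i = 0 \<Longrightarrow> total = 6"
  using total_eq[of 2] b0 by (simp add: numeral_2_eq_2)

lemma betti_1551_imp_total: "b 1 = 5 \<Longrightarrow> b 2 = 5 \<Longrightarrow> b 3 = 1 \<Longrightarrow> \<forall>i>3. b i = 0 \<Longrightarrow> total = 12"
  using total_eq[of 3] b0 by (simp add: numeral_2_eq_2 numeral_3_eq_3)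

definition conclusion :: "nat \<Rightarrow> bool" where
  "conclusion c \<longleftrightarrow> total \<ge> 2 ^ c + 2 ^ (c - 1)
    \<and> (total = 2 ^ c + 2 ^ (c - 1) \<longleftrightarrow>
         (c = 2 \<and> b 0 = 1 \<and> b 1 = 3 \<and> b 2 = 2 \<and> (\<forall>i>2. b i = 0))
       \<or> (c = 3 \<and> b 0 = 1 \<and> b 1 = 5 \<and> b 2 = 5 \<and> b 3 = 1 \<and> (\<forall>i>3. b i = 0)))"

text \<open>The two listed Betti sequences sum to 6 and 12, which settles one half of the
  equivalence.\<close>

lemma conclusionI:
  assumes "2 ^ c + 2 ^ (c - 1) \<le> total"
    and "total = 2 ^ c + 2 ^ (c - 1) \<Longrightarrow>
         (c = 2 \<and> b 1 = 3 \<and> b 2 = 2 \<and> (\<forall>i>2. b i = 0))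
       \<or> (c = 3 \<and> b 1 = 5 \<and> b 2 = 5 \<and> b 3 = 1 \<and> (\<forall>i>3. b i = 0))"
  shows "conclusion c"
proof -
  have "total = 2 ^ c + 2 ^ (c - 1)" if "c = 2" "b 1 = 3" "b 2 = 2" "\<forall>i>2. b i = 0"
    using betti_132_imp_total[OF that(2-4)] that(1) by simp
  moreover have "total = 2 ^ c + 2 ^ (c - 1)" if "c = 3" "b 1 = 5" "b 2 = 5" "b 3 = 1" "\<forall>i>3. b i = 0"
    using betti_1551_imp_total[OF that(2-5)] that(1) by simp
  ultimately show ?thesis unfolding conclusion_def using assms b0 by blast
qed

lemma bound_mono: "c \<le> m \<Longrightarrow> 2 ^ c + 2 ^ (c - 1) \<le> (2 ^ m + 2 ^ (m - 1) :: nat)"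
  by (intro add_mono power_increasing) auto

lemma conclusion_strict:
  assumes "c \<le> m" "2 ^ m + 2 ^ (m - 1) < total"
  shows "conclusion c"
  using bound_mono[OF assms(1)] assms(2) by (intro conclusionI) auto

text \<open>The bounds 1, 3, 2 already add up to 6. Equality leaves no room for another Betti
  number, and it excludes smaller heights, whose bound is at most 3.\<close>

lemma conclusion_132:
  assumes c: "c \<le> 2" and b: "3 \<le> b 1" "2 \<le> b 2"
  shows "conclusion c"
proof -
  have t: "1 + b 1 + b 2 \<le> total" using sum_betti_ge[of "{0, 1, 2}"] b0 by simp
  show ?thesis
  proof (rule conclusionI)
    show "2 ^ c + 2 ^ (c - 1) \<le> total" using bound_mono[OF c] t b by simp
    assume eq: "total = 2 ^ c + 2 ^ (c - 1)"
    have "c = 2"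
    proof (rule ccontr)
      assume "c \<noteq> 2"
      then have "c \<le> 1" using c by simp
      then show False using bound_mono[of c 1] eq t b by simp
    qed
    then have "total = 6" using eq by simp
    moreover have "b i = 0" if "i > 2" for i
      using sum_betti_ge[of "{0, 1, 2, i}"] that b0 b \<open>total = 6\<close> by simp
    ultimately show "(c = 2 \<and> b 1 = 3 \<and> b 2 = 2 \<and> (\<forall>i>2. b i = 0))
       \<or> (c = 3 \<and> b 1 = 5 \<and> b 2 = 5 \<and> b 3 = 1 \<and> (\<forall>i>3. b i = 0))"
      using t b \<open>c = 2\<close> by simp
  qed
qed

lemma conclusion_1551:
  assumes c: "c \<le> 3" and b: "5 \<le> b 1" "5 \<le> b 2" "1 \<le> b 3"
  shows "conclusion c"
proof -
  have t: "1 + b 1 + b 2 + b 3 \<le> total" using sum_betti_ge[of "{0, 1, 2, 3}"] b0 by simp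
  show ?thesis
  proof (rule conclusionI)
    show "2 ^ c + 2 ^ (c - 1) \<le> total" using bound_mono[OF c] t b by simp
    assume eq: "total = 2 ^ c + 2 ^ (c - 1)"
    have "c = 3"
    proof (rule ccontr)
      assume "c \<noteq> 3"
      then have "c \<le> 2" using c by simp
      then show False using bound_mono[of c 2] eq t b by simp
    qed
    then have "total = 12" using eq by simp
    moreover have "b i = 0" if "i > 3" for i
      using sum_betti_ge[of "{0, 1, 2, 3, i}"] that b0 b \<open>total = 12\<close> by simp
    ultimately show "(c = 2 \<and> b 1 = 3 \<and> b 2 = 2 \<and> (\<forall>i>2. b i = 0))
       \<or> (c = 3 \<and> b 1 = 5 \<and> b 2 = 5 \<and> b 3 = 1 \<and> (\<forall>i>3. b i = 0))"
      using t b \<open>c = 3\<close> by simp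
  qed
qed

lemma three_le_card: "3 \<le> card V"
proof -
  obtain z x y where "z \<in> V" "x \<in> V" "y \<in> V" "z \<noteq> x" "z \<noteq> y" "x \<noteq> y"
    using ex_vertex_with_two_nonneighbours by blast
  then have "card {z, x, y} = 3" "{z, x, y} \<subseteq> V" by auto
  then show ?thesis using card_mono[of V "{z, x, y}"] by simp
qed

lemma height_le_edge:
  assumes "ideal_height I = enat c" "edges \<noteq> {}"
  shows "c \<le> card V - 2"
proof -
  obtain u v where "adj u v" using assms(2) unfolding edges_def by blast
  then have "\<not> nonface {u, v}" "{u, v} \<subseteq> V" "card {u, v} = 2" by (auto simp: adj_def)
  then show ?thesis using height_le[OF assms(1), of "{u, v}"] by simp
qed

text \<open>Only \<open>c \<le> n - 1\<close> is available, but without edges the count is (n - 2)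
  2^(n-1) + 2. This exceeds 2^(n-1) + 2^(n-2) from n = 4 on, and n = 3 gives the sequence 1, 3,
  2.\<close>

lemma conclusion_no_edges:
  assumes h: "ideal_height I = enat c" and E: "edges = {}"
  shows "conclusion c"
proof -
  obtain v where "v \<in> V" using three_le_card by fastforce
  then have c: "c \<le> card V - 1" using height_le[OF h, of "{v}"] by simp
  have be: "i * (card V choose Suc i) \<le> b i" for i using betti_ge[of i] E by simp
  show ?thesis
  proof (cases "card V = 3")
    case True
    then show ?thesis using be[of 1] be[of 2] c
      by (intro conclusion_132) (simp_all add: numeral_2_eq_2 numeral_3_eq_3)
  next
    case False
    then have "4 \<le> card V" using three_le_card by simp
    from le_Suc_ex[OF this] obtain m where "card V = 4 + m" by blast
    then have m: "card V = m + 4" by simp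
    have e: "m + 4 - 1 = m + 3" "m + 4 - 2 = m + 2" by simp_all
    have "(m + 4) * 2 ^ (m + 3) + 2 \<le> total + 2 ^ (m + 4)"
      using sum_betti_lower[unfolded m e] E by simp
    then have "2 ^ (m + 3) + 2 ^ (m + 2) < total" by (simp add: power_add algebra_simps)
    then show ?thesis using c by (intro conclusion_strict[of c "m + 3"]) (simp_all add: m)
  qed
qed

text \<open>With \<open>m + 3\<close> vertices the bound at height \<open>m + 1\<close> is three
  times 2^m, while the splitting count gives four times 2^m; no equality case arises.\<close>

lemma conclusion_disconnected:
  assumes h: "ideal_height I = enat c" and "\<not> connected" "edges \<noteq> {}"
  shows "conclusion c"
proof -
  obtain m where "card V = 3 + m" using le_Suc_ex[OF three_le_card] by blast
  then have m: "card V = m + 3" by simp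
  have e: "m + 3 - 1 = m + 2" by simp
  have "2 ^ (m + 2) \<le> total" using sum_betti_disconnected[OF assms(2), unfolded m e] .
  moreover have "2 ^ (m + 1) + 2 ^ m < (2 ^ (m + 2) :: nat)" by (simp add: power_add)
  ultimately have "2 ^ (m + 1) + 2 ^ m < total" by linarith
  then show ?thesis using height_le_edge[OF h assms(3)]
    by (intro conclusion_strict[of c "m + 1"]) (simp_all add: m)
qed

lemma conclusion_connected:
  assumes h: "ideal_height I = enat c" and conn: connected
  shows "conclusion c"
proof -
  note st = connected_structure[OF conn]
  have c: "c \<le> card V - 2" using height_le_edge[OF h st(4)] .
  have be: "i * (card V choose Suc i) \<le> b i + card edges * ((card V - 2) choose (i - 1))" for i
    by (rule betti_ge)
  consider "card V = 4" | "card V = 5" | "6 \<le> card V" using st(1) by linarith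
  then show ?thesis
  proof cases
    case 1
    \<comment> \<open>With at most 3 edges the graph bounds become 6 - 3 = 3 and 8 - 6 = 2.\<close>
    have n: "4 choose Suc 1 = 6" "4 choose Suc 2 = 4" by (simp_all add: eval_nat_numeral)
    show ?thesis using be[of 1] be[of 2] st(3) c 1 n by (intro conclusion_132) simp_all
  next
    case 2
    \<comment> \<open>Degrees 1 and 2 are used separately: the summed count would give only 10 for
      five edges, since its contribution in degree 4 is negative.\<close>
    have n: "5 choose Suc 1 = 10" "5 choose Suc 2 = 10" by (simp_all add: eval_nat_numeral)
    have m: "card edges \<le> 5" using st(2) 2 by simp
    have b1: "10 \<le> b 1 + card edges" and b2: "20 \<le> b 2 + 3 * card edges"
      using be[of 1] be[of 2] 2 n by simp_all
    show ?thesis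
    proof (cases "card edges = 5")
      case True
      \<comment> \<open>As many edges as vertices and no triangle: the cycle class in multidegree
        \<open>V\<close> gives \<open>b 3 \<ge> 1\<close>.\<close>
      have "1 \<le> b (card V - 2)"
      proof (rule betti_ge_one_cycle[OF edges_subset])
        fix p e assume "p \<in> I" "e \<in> edges"
        then show "lookup p (ind e) = 0" by (auto simp: edges_def adj_def intro: lookup_face)
      next
        fix e w assume e: "e \<in> edges" and w: "w \<in> V" "w \<notin> e"
        then obtain u v where uv: "e = {u, v}" "adj u v" unfolding edges_def by blast
        then have "nonface {u, v} \<or> nonface {u, w} \<or> nonface {v, w}"
          using w by (intro st(5)) (auto simp: adj_def)
        moreover have "{u, v} \<subseteq> insert w e" "{u, w} \<subseteq> insert w e" "{v, w} \<subseteq> insert w e"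
          using uv(1) by auto
        ultimately have "nonface (insert w e)" using nonface_mono[of _ "insert w e"] by metis
        moreover have "xvar w * monom (ind e) = (monom (ind (insert w e)) :: ('v, 'k) mpoly)"
        proof -
          have "ind {w} + ind e = ind (insert w e)"
            using w(2) by (intro poly_mapping_eqI) (auto simp: lookup_add)
          then show ?thesis by (simp add: xvar_eq_monom_ind monom_def mult_single)
        qed
        ultimately show "xvar w * monom (ind e) \<in> I" by (simp add: nonface_def)
      qed (use True 2 in auto)
      then show ?thesis using b1 b2 True c 2 by (intro conclusion_1551) simp_all
    next
      case False
      then have "15 \<le> 1 + b 1 + b 2" using m b1 b2 by linarith
      also have "\<dots> \<le> total" using sum_betti_ge[of "{0, 1, 2}"] b0 by simp
      finally show ?thesis using c 2 by (intro conclusion_strict[of c 3]) simp_all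
    qed
  next
    case 3
    from le_Suc_ex[OF this] obtain m where "card V = 6 + m" by blast
    then have m: "card V = m + 6" by simp
    have e: "m + 6 - 1 = m + 5" "m + 6 - 2 = m + 4" "m + 4 - 1 = m + 3" by simp_all
    have "card edges * 2 ^ (m + 4) \<le> (m + 6) * 2 ^ (m + 4)" using st(2) m by (intro mult_le_mono1) simp
    moreover have "(m + 6) * 2 ^ (m + 5) + 2 \<le> total + 2 ^ (m + 6) + card edges * 2 ^ (m + 4)"
      using sum_betti_lower[unfolded m e] by simp
    ultimately have "(m + 6) * 2 ^ (m + 5) + 2 \<le> total + 2 ^ (m + 6) + (m + 6) * 2 ^ (m + 4)" by linarith
    then have "2 ^ (m + 4) + 2 ^ (m + 3) < total" by (simp add: power_add algebra_simps)
    then show ?thesis using c unfolding m e by (intro conclusion_strict[of c "m + 4", unfolded e])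
  qed
qed

end

theorem theorem2p7:
  fixes I :: "('v::finite, 'k::field) mpoly set"
    and c :: nat
    and b :: "nat \<Rightarrow> nat"
    and d :: "nat \<Rightarrow> nat \<Rightarrow> nat \<Rightarrow> ('v, 'k) mpoly"
  assumes "squarefree_monomial_ideal I"
    and "ideal_height I = enat c"
    and "NCI I"
    and "min_free_res I b d"
  shows "(\<Sum>i | b i \<noteq> 0. b i) \<ge> 2 ^ c + 2 ^ (c - 1)
    \<and> ((\<Sum>i | b i \<noteq> 0. b i) = 2 ^ c + 2 ^ (c - 1) \<longleftrightarrow>
         (c = 2 \<and> b 0 = 1 \<and> b 1 = 3 \<and> b 2 = 2 \<and> (\<forall>i>2. b i = 0))
       \<or> (c = 3 \<and> b 0 = 1 \<and> b 1 = 5 \<and> b 2 = 5 \<and> b 3 = 1 \<and> (\<forall>i>3. b i = 0)))"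
proof -
  interpret nci_ideal I by unfold_locales (rule assms(3))
  interpret nci_resolution I b d by unfold_locales (use assms(4) is_ideal_I in auto)
  have "conclusion c"
    using conclusion_no_edges conclusion_disconnected conclusion_connected assms(2) by blast
  then show ?thesis unfolding conclusion_def total_def .
qed

end
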